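(* Let $J\neq F_n^\infty$ be a WOT-closed two-sided ideal of $F_n^\infty$ generated by a family $\mathcal P_J$ of homogeneous polynomials, let $\mathcal H$ be a separable Hilbert space, and let $T:=[T_1,\ldots,T_n]$, $T_i\in B(\mathcal H)$, be a row contraction such that $p(T_1,\ldots,T_n)=0$ for any $p\in\mathcal P_J$. Assume in addition that $$\overline{\mathrm{span}}\,\{B_\alpha B_\beta^*:\ \alpha,\beta\in\mathbb F_n^+\}=C^*(B_1,\ldots,B_n).$$ Then the $*$-cyclic constrained dilation $V=[V_1,\ldots,V_n]$ of $T$ on $\tilde{\mathcal K}=(\mathcal N_J\otimes\overline{\Delta_T\mathcal H})\oplus\mathcal K_\pi$ (as defined in the context) is minimal, i.e. $\tilde{\mathcal K}=\bigvee_{\alpha\in\mathbb F_n^+}V_\alpha\mathcal H$, and it is unique up to a unitary equivalence. Let $T':=[T_1',\ldots,T_n']$, $T_i'\in B(\mathcal H')$, $\mathcal H'$ separable, be another row contraction subject to the same constraints as $T$ (i.e. $p(T_1',\ldots,T_n')=0$ for any $p\in\mathcal P_J$) and let $V':=[V_1',\ldots,V_n']$ be the corresponding dilation, with representation $\pi'$ on $\mathcal K_{\pi'}$. Then $T$ and $T'$ are unitarily equivalent if and only if $$\dim\overline{\Delta_T\mathcal H}=\dim\overline{\Delta_{T'}\mathcal H'}$$ and there are unitary operators $\Lambda:\mathcal N_J\otimes\overline{\Delta_T\mathcal H}\to\mathcal N_J\otimes\overline{\Delta_{T'}\mathcal H'}$ and $\Gamma:\mathcal K_\pi\to\mathcal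 K_{\pi'}$ such that $$\Lambda(B_i\otimes I_{\overline{\Delta_T\mathcal H}})=(B_i\otimes I_{\overline{\Delta_{T'}\mathcal H'}})\Lambda\quad\text{and}\quad \Gamma\pi(B_i)=\pi'(B_i)\Gamma\quad\text{for }i=1,\ldots,n,$$ and $$\begin{bmatrix}\Lambda&0\\0&\Gamma\end{bmatrix}\mathcal H=\mathcal H'.$$
   Context: Let $n\in\{1,2,\dots\}$ and let $F^2(H_n)=\bigoplus_{k\ge 0}H_n^{\otimes k}$ be the full Fock space of an $n$-dimensional complex Hilbert space $H_n$ with orthonormal basis $e_1,\dots,e_n$ (with $H_n^{\otimes 0}=\mathbb C1$). The left creation operators are $S_i\varphi=e_i\otimes\varphi$. $F_n^\infty\subset B(F^2(H_n))$ is the WOT-closed algebra generated by $S_1,\dots,S_n$ and the identity. Polynomials in $F_n^\infty$ are the operators $p(S_1,\dots,S_n)$, $p$ a polynomial in $n$ noncommuting indeterminates; $p(T_1,\dots,T_n)$ is the corresponding evaluation. "Generated by $\mathcal P_J$" means $J$ is the smallest WOT-closed two-sided ideal containing $\mathcal P_J$. Put $\mathcal N_J=F^2(H_n)\ominus\overline{JF^2(H_n)}$ and $B_i=P_{\mathcal N_J}S_i|_{\mathcal N_J}$. $C^*(B_1,\dots,B_n)$ is the $C^*$-algebra generated by $B_1,\dots,B_n$ and the identity on $\mathcal N_J$. $\mathbb F_n^+$ is the unital free semigroup on $g_1,\dots,g_n$ and, for operators $X_1,\dots,X_n$, $X_\alpha=X_{i_1}\cdots X_{i_k}$ if $\alpha=g_{i_1}\cdots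 g_{i_k}$, with $X_{g_0}=I$ for the neutral element $g_0$. $T$ is a row contraction if $\sum_iT_iT_i^*\le I$; $\Delta_T=(I-\sum_iT_iT_i^* )^{1/2}$. $[T_i]$ and $[T_i']$ are unitarily equivalent if there is a unitary $U:\mathcal H\to\mathcal H'$ with $T_i=U^*T_i'U$ for all $i$. The dilation in question: there exist a separable Hilbert space $\mathcal K_\pi$ and a $*$-representation $\pi:C^*(B_1,\dots,B_n)\to B(\mathcal K_\pi)$ annihilating the compact operators with $\sum_i\pi(B_i)\pi(B_i)^*=I_{\mathcal K_\pi}$, such that $\mathcal H$ is identified, via an isometry, with a subspace of $\tilde{\mathcal K}=(\mathcal N_J\otimes\overline{\Delta_T\mathcal H})\oplus\mathcal K_\pi$ which is invariant under $V_1^*,\dots,V_n^*$, where $V_i=(B_i\otimes I_{\overline{\Delta_T\mathcal H}})\oplus\pi(B_i)$, which is $*$-cyclic for $V_1,\dots,V_n$ (the smallest closed reducing subspace for the $V_i$ containing $\mathcal H$ is $\tilde{\mathcal K}$), and for which $T_i^*=V_i^*|_{\mathcal H}$, $i=1,\dots,n$. Such a dilation always exists under the stated hypotheses on $J$ and $T$. Uniqueness up to unitary equivalence means: for any two such dilations of $T$, on $\tilde{\mathcal K}$ and $\tilde{\mathcal K}'$ with embeddings $\iota:\mathcal H\to\tilde{\mathcal K}$, $\iota':\mathcal H\to\tilde{\mathcal K}'$, there is a unitary $U:\tilde{\mathcal K}\to\tilde{\mathcal K}'$ intertwining the dilating $n$-tuples and satisfying $U\iota=\iota'$. *)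

theory Defs
  imports "HOL-Analysis.Analysis" "HOL-Library.Poly_Mapping"
begin

section \<open>Complex Hilbert spaces\<close>

class complex_normed_vector = real_normed_vector +
  fixes scaleC :: "complex \<Rightarrow> 'a \<Rightarrow> 'a"  (infixr \<open>*\<^sub>C\<close> 75)
  assumes scaleC_add_right: "a *\<^sub>C (x + y) = a *\<^sub>C x + a *\<^sub>C y"
    and scaleC_add_left: "(a + b) *\<^sub>C x = a *\<^sub>C x + b *\<^sub>C x"
    and scaleC_scaleC: "a *\<^sub>C b *\<^sub>C x = (a * b) *\<^sub>C x"
    and scaleC_of_real: "complex_of_real r *\<^sub>C x = r *\<^sub>R x"
    and norm_scaleC: "norm (a *\<^sub>C x) = cmod a * norm x"

text \<open>The inner product is conjugate-linear in its first argument.\<close>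

class complex_inner = complex_normed_vector +
  fixes cinner :: "'a \<Rightarrow> 'a \<Rightarrow> complex"
  assumes cinner_commute: "cinner x y = cnj (cinner y x)"
    and cinner_add_right: "cinner x (y + z) = cinner x y + cinner x z"
    and cinner_scaleC_right: "cinner x (a *\<^sub>C y) = a * cinner x y"
    and cinner_self: "cinner x x = complex_of_real ((norm x)\<^sup>2)"

class chilbert_space = complex_inner + complete_space

subclass (in chilbert_space) banach ..

lemma vector_space_scaleC:
  "vector_space (scaleC :: complex \<Rightarrow> 'a \<Rightarrow> 'a::complex_normed_vector)"
proof
  show "1 *\<^sub>C x = x" for x :: 'a
    using scaleC_of_real[of 1 x] by simp
qed (simp_all add: scaleC_add_right scaleC_add_left scaleC_scaleC)

definition csubspace :: "'a::complex_normed_vector set \<Rightarrow> bool" where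
  "csubspace = module.subspace scaleC"

definition cspan :: "'a::complex_normed_vector set \<Rightarrow> 'a set" where
  "cspan = module.span scaleC"

lemma Cauchy_Schwarz_cinner:
  fixes x y :: "'a::complex_inner"
  shows "cmod (cinner x y) \<le> norm x * norm y"
proof (cases "y = 0")
  case True
  have "cinner x (0 + 0) = cinner x 0 + cinner x 0"
    by (rule cinner_add_right)
  then show ?thesis
    using True by simp
next
  case False
  define c where "c = cinner x y"
  define n where "n = (norm y)\<^sup>2"
  have n: "n > 0" using False by (simp add: n_def)
  have yx: "cinner y x = cnj c" unfolding c_def by (rule cinner_commute)
  have add_left: "cinner (u + v) w = cinner u w + cinner v w" for u v w :: 'a
    by (metis cinner_commute cinner_add_right complex_cnj_add)
  have scale_left: "cinner (a *\<^sub>C u) w = cnj a * cinner u w" for a and u w :: 'a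
    by (metis cinner_commute cinner_scaleC_right complex_cnj_mult)
  define a where "a = - cnj c / complex_of_real n"
  have "complex_of_real ((norm (x + a *\<^sub>C y))\<^sup>2) = cinner (x + a *\<^sub>C y) (x + a *\<^sub>C y)"
    by (rule cinner_self[symmetric])
  also have "\<dots> = cinner x x + a * c + (cnj a * cnj c + cnj a * (a * cinner y y))"
    unfolding add_left cinner_add_right scale_left cinner_scaleC_right yx c_def by (simp add: algebra_simps)
  also have "\<dots> = complex_of_real ((norm x)\<^sup>2) + a * c + (cnj a * cnj c + cnj a * (a * complex_of_real n))"
    by (simp only: cinner_self n_def)
  also have "\<dots> = complex_of_real ((norm x)\<^sup>2) - c * cnj c / complex_of_real n"
    using n by (simp add: a_def field_simps)
  also have "\<dots> = complex_of_real ((norm x)\<^sup>2 - (cmod c)\<^sup>2 / n)"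
    by (simp only: complex_norm_square of_real_diff of_real_divide)
  finally have "(norm (x + a *\<^sub>C y))\<^sup>2 = (norm x)\<^sup>2 - (cmod c)\<^sup>2 / n"
    using of_real_eq_iff by blast
  then have "(cmod c)\<^sup>2 / n \<le> (norm x)\<^sup>2"
    by (metis zero_le_power2 diff_ge_0_iff_ge)
  then have "(cmod c)\<^sup>2 \<le> (norm x * norm y)\<^sup>2"
    using n by (simp add: field_simps n_def)
  then show ?thesis
    unfolding c_def by (meson power2_le_imp_le mult_nonneg_nonneg norm_ge_zero)
qed

instantiation complex :: chilbert_space
begin

definition scaleC_complex :: "complex \<Rightarrow> complex \<Rightarrow> complex" where
  "scaleC_complex a x = a * x"

definition cinner_complex :: "complex \<Rightarrow> complex \<Rightarrow> complex" where
  "cinner_complex x y = cnj x * y"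

instance
proof
  show "cinner x x = complex_of_real ((norm x)\<^sup>2)" for x :: complex
    unfolding cinner_complex_def complex_norm_square by (rule mult.commute)
qed (simp_all add: scaleC_complex_def cinner_complex_def algebra_simps norm_mult scaleR_conv_of_real)

end

text \<open>The product type carries the norm of the Hilbert space direct sum.\<close>

instantiation prod :: (complex_normed_vector, complex_normed_vector) complex_normed_vector
begin

definition scaleC_prod :: "complex \<Rightarrow> 'a \<times> 'b \<Rightarrow> 'a \<times> 'b" where
  "scaleC_prod a x = (a *\<^sub>C fst x, a *\<^sub>C snd x)"

instance
proof
  show "norm (a *\<^sub>C x) = cmod a * norm x" for a and x :: "'a \<times> 'b"
    by (simp add: scaleC_prod_def norm_prod_def norm_scaleC power_mult_distrib
        distrib_left[symmetric] real_sqrt_mult)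
qed (simp_all add: scaleC_prod_def prod_eq_iff scaleC_add_right scaleC_add_left scaleC_scaleC
      scaleC_of_real)

end

instantiation prod :: (complex_inner, complex_inner) complex_inner
begin

definition cinner_prod :: "'a \<times> 'b \<Rightarrow> 'a \<times> 'b \<Rightarrow> complex" where
  "cinner_prod x y = cinner (fst x) (fst y) + cinner (snd x) (snd y)"

instance
proof
  show "cinner x y = cnj (cinner y x)" for x y :: "'a \<times> 'b"
    unfolding cinner_prod_def
    by (metis cinner_commute complex_cnj_add)
  show "cinner x x = complex_of_real ((norm x)\<^sup>2)" for x :: "'a \<times> 'b"
    by (simp add: cinner_prod_def norm_prod_def cinner_self)
qed (simp_all add: cinner_prod_def cinner_add_right cinner_scaleC_right scaleC_prod_def
      algebra_simps)

end

instance prod :: (chilbert_space, chilbert_space) chilbert_space ..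

instantiation blinfun :: (real_normed_vector, complex_normed_vector) complex_normed_vector
begin

lift_definition scaleC_blinfun :: "complex \<Rightarrow> 'a \<Rightarrow>\<^sub>L 'b \<Rightarrow> 'a \<Rightarrow>\<^sub>L 'b"
  is "\<lambda>c f x. c *\<^sub>C f x"
proof -
  fix c :: complex and f :: "'a \<Rightarrow> 'b"
  assume "bounded_linear f"
  then interpret bounded_linear f .
  show "bounded_linear (\<lambda>x. c *\<^sub>C f x)"
  proof (rule bounded_linear_intro)
    show "c *\<^sub>C f (x + y) = c *\<^sub>C f x + c *\<^sub>C f y" for x y
      by (simp add: add scaleC_add_right)
    show "c *\<^sub>C f (r *\<^sub>R x) = r *\<^sub>R c *\<^sub>C f x" for r x
      by (simp add: scaleR scaleC_scaleC mult.commute flip: scaleC_of_real)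
    show "norm (c *\<^sub>C f x) \<le> norm x * (cmod c * onorm f)" for x
      using mult_left_mono[OF onorm[OF \<open>bounded_linear f\<close>, of x], of "cmod c"]
      by (simp add: norm_scaleC mult_ac)
  qed
qed

instance
proof
  fix a :: complex and A :: "'a \<Rightarrow>\<^sub>L 'b"
  have le: "norm (c *\<^sub>C B) \<le> cmod c * norm B" for c and B :: "'a \<Rightarrow>\<^sub>L 'b"
  proof (rule norm_blinfun_bound)
    show "norm ((c *\<^sub>C B) x) \<le> cmod c * norm B * norm x" for x
      using mult_left_mono[OF norm_blinfun[of B x], of "cmod c"]
      by (simp add: scaleC_blinfun.rep_eq norm_scaleC mult_ac)
  qed simp
  show "norm (a *\<^sub>C A) = cmod a * norm A"
  proof (cases "a = 0")
    case True
    then show ?thesis using le[of a A] by simp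
  next
    case False
    have "inverse a *\<^sub>C a *\<^sub>C A = A"
      using False scaleC_of_real[of 1]
      by (intro blinfun_eqI) (simp add: scaleC_blinfun.rep_eq scaleC_scaleC)
    then have "norm A \<le> inverse (cmod a) * norm (a *\<^sub>C A)"
      using le[of "inverse a" "a *\<^sub>C A"] by (simp add: norm_inverse)
    then show ?thesis
      using le[of a A] False by (simp add: field_simps)
  qed
qed (transfer, simp add: scaleC_add_right scaleC_add_left scaleC_scaleC scaleC_of_real)+

end


section \<open>Square summable families\<close>

typedef (overloaded) ('i, 'a) ell2 =
  "{f :: 'i \<Rightarrow> 'a::real_normed_vector. (\<lambda>i. (norm (f i))\<^sup>2) summable_on UNIV}"
  morphisms ell2_apply Abs_ell2
  by (rule exI[of _ "\<lambda>_. 0"]) simp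

setup_lifting type_definition_ell2

lemma summable_sq_iff:
  fixes f :: "'i \<Rightarrow> 'a::real_normed_vector"
  shows "(\<lambda>i. (norm (f i))\<^sup>2) summable_on UNIV \<longleftrightarrow>
    (\<exists>C\<ge>0. \<forall>F. finite F \<longrightarrow> L2_set (\<lambda>i. norm (f i)) F \<le> C)"
proof
  assume s: "(\<lambda>i. (norm (f i))\<^sup>2) summable_on UNIV"
  have "L2_set (\<lambda>i. norm (f i)) F \<le> sqrt (\<Sum>\<^sub>\<infinity>i. (norm (f i))\<^sup>2)" if "finite F" for F
    unfolding L2_set_def
    by (rule real_sqrt_le_mono, rule finite_sum_le_infsum[OF s that]) auto
  moreover have "0 \<le> sqrt (\<Sum>\<^sub>\<infinity>i. (norm (f i))\<^sup>2)"
    by (simp add: infsum_nonneg)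
  ultimately show "\<exists>C\<ge>0. \<forall>F. finite F \<longrightarrow> L2_set (\<lambda>i. norm (f i)) F \<le> C"
    by blast
next
  assume "\<exists>C\<ge>0. \<forall>F. finite F \<longrightarrow> L2_set (\<lambda>i. norm (f i)) F \<le> C"
  then obtain C where C: "C \<ge> 0" "\<And>F. finite F \<Longrightarrow> L2_set (\<lambda>i. norm (f i)) F \<le> C"
    by blast
  show "(\<lambda>i. (norm (f i))\<^sup>2) summable_on UNIV"
  proof (rule nonneg_bdd_above_summable_on)
    show "bdd_above (sum (\<lambda>i. (norm (f i))\<^sup>2) ` {F. F \<subseteq> UNIV \<and> finite F})"
    proof (rule bdd_aboveI2)
      fix F :: "'i set"
      assume "F \<in> {F. F \<subseteq> UNIV \<and> finite F}"
      then have "sqrt (\<Sum>i\<in>F. (norm (f i))\<^sup>2) \<le> C"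
        using C(2)[of F] by (simp add: L2_set_def)
      then show "(\<Sum>i\<in>F. (norm (f i))\<^sup>2) \<le> C\<^sup>2"
        by (rule sqrt_le_D)
    qed
  qed simp
qed

lemma summable_sq_scale:
  fixes f g :: "'i \<Rightarrow> 'a::real_normed_vector"
  assumes "(\<lambda>i. (norm (f i))\<^sup>2) summable_on UNIV" "\<And>i. norm (g i) = c * norm (f i)"
  shows "(\<lambda>i. (norm (g i))\<^sup>2) summable_on UNIV"
  using summable_on_cmult_right[OF assms(1), of "c\<^sup>2"] by (simp add: assms(2) power_mult_distrib)

lemma summable_sq_add:
  fixes f g :: "'i \<Rightarrow> 'a::real_normed_vector"
  assumes "(\<lambda>i. (norm (f i))\<^sup>2) summable_on UNIV" "(\<lambda>i. (norm (g i))\<^sup>2) summable_on UNIV"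
  shows "(\<lambda>i. (norm (f i + g i))\<^sup>2) summable_on UNIV"
proof -
  obtain C where C: "C \<ge> 0" "\<And>F. finite F \<Longrightarrow> L2_set (\<lambda>i. norm (f i)) F \<le> C"
    using assms(1) unfolding summable_sq_iff by blast
  obtain D where D: "D \<ge> 0" "\<And>F. finite F \<Longrightarrow> L2_set (\<lambda>i. norm (g i)) F \<le> D"
    using assms(2) unfolding summable_sq_iff by blast
  have "L2_set (\<lambda>i. norm (f i + g i)) F \<le> C + D" if "finite F" for F
  proof -
    have "L2_set (\<lambda>i. norm (f i + g i)) F \<le> L2_set (\<lambda>i. norm (f i) + norm (g i)) F"
      by (rule L2_set_mono) (auto simp: norm_triangle_ineq)
    also have "\<dots> \<le> L2_set (\<lambda>i. norm (f i)) F + L2_set (\<lambda>i. norm (g i)) F"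
      by (rule L2_set_triangle_ineq)
    finally show ?thesis using C(2)[OF that] D(2)[OF that] by linarith
  qed
  then show ?thesis
    unfolding summable_sq_iff using C(1) D(1) by (intro exI[of _ "C + D"]) auto
qed

instantiation ell2 :: (type, real_normed_vector) real_normed_vector
begin

lift_definition zero_ell2 :: "('a, 'b) ell2" is "\<lambda>_. 0"
  by simp

lift_definition plus_ell2 :: "('a, 'b) ell2 \<Rightarrow> ('a, 'b) ell2 \<Rightarrow> ('a, 'b) ell2"
  is "\<lambda>f g i. f i + g i"
  by (rule summable_sq_add)

lift_definition uminus_ell2 :: "('a, 'b) ell2 \<Rightarrow> ('a, 'b) ell2" is "\<lambda>f i. - f i"
  by simp

definition minus_ell2 :: "('a, 'b) ell2 \<Rightarrow> ('a, 'b) ell2 \<Rightarrow> ('a, 'b) ell2" where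
  "minus_ell2 f g = f + (- g)"

lift_definition scaleR_ell2 :: "real \<Rightarrow> ('a, 'b) ell2 \<Rightarrow> ('a, 'b) ell2" is "\<lambda>r f i. r *\<^sub>R f i"
  by (erule summable_sq_scale) (rule norm_scaleR)

definition norm_ell2 :: "('a, 'b) ell2 \<Rightarrow> real" where
  "norm_ell2 f = sqrt (\<Sum>\<^sub>\<infinity>i. (norm (ell2_apply f i))\<^sup>2)"

definition dist_ell2 :: "('a, 'b) ell2 \<Rightarrow> ('a, 'b) ell2 \<Rightarrow> real" where
  "dist_ell2 f g = norm (f - g)"

definition sgn_ell2 :: "('a, 'b) ell2 \<Rightarrow> ('a, 'b) ell2" where
  "sgn_ell2 f = inverse (norm f) *\<^sub>R f"

definition uniformity_ell2 :: "(('a, 'b) ell2 \<times> ('a, 'b) ell2) filter" where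
  "uniformity_ell2 = (INF e\<in>{0<..}. principal {(x, y). dist x y < e})"

definition open_ell2 :: "('a, 'b) ell2 set \<Rightarrow> bool" where
  "open_ell2 U \<longleftrightarrow> (\<forall>x\<in>U. \<forall>\<^sub>F (x', y) in uniformity. x' = x \<longrightarrow> y \<in> U)"

lemma ell2_summable: "(\<lambda>i. (norm (ell2_apply f i))\<^sup>2) summable_on UNIV"
  using ell2_apply[of f] by simp

lemma L2_set_le_norm_ell2:
  "finite F \<Longrightarrow> L2_set (\<lambda>i. norm (ell2_apply f i)) F \<le> norm f"
  unfolding L2_set_def norm_ell2_def
  by (rule real_sqrt_le_mono, rule finite_sum_le_infsum[OF ell2_summable]) auto

lemma norm_ell2_le:
  assumes "\<And>F. finite F \<Longrightarrow> L2_set (\<lambda>i. norm (ell2_apply f i)) F \<le> C"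
  shows "norm f \<le> C"
proof -
  have "0 \<le> C" using assms[of "{}"] by simp
  have "(\<Sum>\<^sub>\<infinity>i. (norm (ell2_apply f i))\<^sup>2) \<le> C\<^sup>2"
  proof (rule infsum_le_finite_sums[OF ell2_summable])
    fix F :: "'a set"
    assume "finite F"
    then show "(\<Sum>i\<in>F. (norm (ell2_apply f i))\<^sup>2) \<le> C\<^sup>2"
      using assms[of F] sqrt_le_D by (auto simp: L2_set_def)
  qed
  then show ?thesis
    unfolding norm_ell2_def using \<open>0 \<le> C\<close> by (simp add: real_le_lsqrt)
qed

instance
proof
  fix f g h :: "('a, 'b) ell2" and r s :: real
  show "f + g + h = f + (g + h)" "f + g = g + f" "0 + f = f" "- f + f = 0"
    by (transfer, simp add: add_ac)+
  show "f - g = f + - g" by (rule minus_ell2_def)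
  show "r *\<^sub>R (f + g) = r *\<^sub>R f + r *\<^sub>R g" "(r + s) *\<^sub>R f = r *\<^sub>R f + s *\<^sub>R f"
    "r *\<^sub>R s *\<^sub>R f = (r * s) *\<^sub>R f" "1 *\<^sub>R f = f"
    by (transfer, simp add: scaleR_add_right scaleR_add_left)+
  show "dist f g = norm (f - g)" by (rule dist_ell2_def)
  show "sgn f = inverse (norm f) *\<^sub>R f" by (rule sgn_ell2_def)
  show "uniformity = (INF e\<in>{0<..}. principal {(x :: ('a, 'b) ell2, y). dist x y < e})"
    by (rule uniformity_ell2_def)
  show "open U \<longleftrightarrow> (\<forall>x\<in>U. \<forall>\<^sub>F (x', y) in uniformity. x' = x \<longrightarrow> y \<in> U)"
    for U :: "('a, 'b) ell2 set"
    by (rule open_ell2_def)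
  show "norm f = 0 \<longleftrightarrow> f = 0"
  proof
    assume "norm f = 0"
    have "ell2_apply f i = 0" for i
      using L2_set_le_norm_ell2[of "{i}" f] \<open>norm f = 0\<close> by (simp add: L2_set_def)
    then show "f = 0" by transfer auto
  next
    assume "f = 0"
    then show "norm f = 0" by (simp add: norm_ell2_def zero_ell2.rep_eq)
  qed
  show "norm (r *\<^sub>R f) = \<bar>r\<bar> * norm f"
    by (simp add: norm_ell2_def scaleR_ell2.rep_eq power_mult_distrib infsum_cmult_right'
        real_sqrt_mult)
  show "norm (f + g) \<le> norm f + norm g"
  proof (rule norm_ell2_le)
    fix F :: "'a set"
    assume F: "finite F"
    have "L2_set (\<lambda>i. norm (ell2_apply (f + g) i)) F
        \<le> L2_set (\<lambda>i. norm (ell2_apply f i) + norm (ell2_apply g i)) F"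
      by (rule L2_set_mono) (auto simp: plus_ell2.rep_eq norm_triangle_ineq)
    also have "\<dots> \<le> L2_set (\<lambda>i. norm (ell2_apply f i)) F + L2_set (\<lambda>i. norm (ell2_apply g i)) F"
      by (rule L2_set_triangle_ineq)
    finally show "L2_set (\<lambda>i. norm (ell2_apply (f + g) i)) F \<le> norm f + norm g"
      using L2_set_le_norm_ell2[OF F, of f] L2_set_le_norm_ell2[OF F, of g] by linarith
  qed
qed

end

lemma minus_ell2_apply: "ell2_apply (f - g) i = ell2_apply f i - ell2_apply g i"
  unfolding minus_ell2_def plus_ell2.rep_eq uminus_ell2.rep_eq by simp

instance ell2 :: (type, banach) banach
proof
  fix X :: "nat \<Rightarrow> ('a, 'b) ell2"
  assume X: "Cauchy X"
  have coord: "norm (ell2_apply h i) \<le> norm h" for h :: "('a, 'b) ell2" and i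
    using L2_set_le_norm_ell2[of "{i}" h] by (simp add: L2_set_def)
  have "Cauchy (\<lambda>k. ell2_apply (X k) i)" for i
  proof (rule CauchyI)
    fix e :: real
    assume "e > 0"
    then obtain M where M: "\<forall>m\<ge>M. \<forall>n\<ge>M. norm (X m - X n) < e"
      using CauchyD[OF X] by blast
    have "norm (ell2_apply (X m) i - ell2_apply (X n) i) < e" if "m \<ge> M" "n \<ge> M" for m n
    proof -
      have "norm (ell2_apply (X m) i - ell2_apply (X n) i) = norm (ell2_apply (X m - X n) i)"
        by (simp only: minus_ell2_apply)
      also have "\<dots> \<le> norm (X m - X n)" by (rule coord)
      also have "\<dots> < e" using M that by blast
      finally show ?thesis .
    qed
    then show "\<exists>M. \<forall>m\<ge>M. \<forall>n\<ge>M. norm (ell2_apply (X m) i - ell2_apply (X n) i) < e"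
      by blast
  qed
  then have "\<exists>l. (\<lambda>k. ell2_apply (X k) i) \<longlonglongrightarrow> l" for i
    by (simp add: Cauchy_convergent_iff convergent_def)
  then obtain f where f: "\<And>i. (\<lambda>k. ell2_apply (X k) i) \<longlonglongrightarrow> f i"
    by metis
  have bound: "L2_set (\<lambda>i. norm (f i - ell2_apply (X n) i)) F \<le> e"
    if M: "\<forall>m\<ge>M. \<forall>n\<ge>M. norm (X m - X n) < e" and "n \<ge> M" "finite F" for M n F and e :: real
  proof (rule tendsto_upperbound)
    show "(\<lambda>m. L2_set (\<lambda>i. norm (ell2_apply (X m) i - ell2_apply (X n) i)) F)
        \<longlonglongrightarrow> L2_set (\<lambda>i. norm (f i - ell2_apply (X n) i)) F"
      unfolding L2_set_def by (intro tendsto_intros f)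
    have "L2_set (\<lambda>i. norm (ell2_apply (X m) i - ell2_apply (X n) i)) F \<le> e" if "m \<ge> M" for m
    proof -
      have "L2_set (\<lambda>i. norm (ell2_apply (X m) i - ell2_apply (X n) i)) F
          = L2_set (\<lambda>i. norm (ell2_apply (X m - X n) i)) F"
        by (simp only: minus_ell2_apply)
      also have "\<dots> \<le> norm (X m - X n)"
        by (rule L2_set_le_norm_ell2[OF \<open>finite F\<close>])
      also have "\<dots> \<le> e" using M that \<open>n \<ge> M\<close> less_imp_le by blast
      finally show ?thesis .
    qed
    then show "\<forall>\<^sub>F m in sequentially.
        L2_set (\<lambda>i. norm (ell2_apply (X m) i - ell2_apply (X n) i)) F \<le> e"
      using eventually_sequentially by blast
  qed simp
  obtain M where M: "\<forall>m\<ge>M. \<forall>n\<ge>M. norm (X m - X n) < 1"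
    using CauchyD[OF X, of 1] by auto
  have "(\<lambda>i. (norm (f i - ell2_apply (X M) i))\<^sup>2) summable_on UNIV"
    unfolding summable_sq_iff using bound[OF M order_refl] by (intro exI[of _ 1]) auto
  from summable_sq_add[OF this ell2_summable[of "X M"]]
  have "(\<lambda>i. (norm (f i))\<^sup>2) summable_on UNIV" by simp
  then have app: "ell2_apply (Abs_ell2 f) = f"
    by (simp add: Abs_ell2_inverse)
  have "X \<longlonglongrightarrow> Abs_ell2 f"
  proof (rule LIMSEQ_I)
    fix e :: real
    assume "e > 0"
    then obtain M where M: "\<forall>m\<ge>M. \<forall>n\<ge>M. norm (X m - X n) < e / 2"
      using CauchyD[OF X, of "e / 2"] by auto
    have "norm (X n - Abs_ell2 f) < e" if "n \<ge> M" for n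
    proof -
      have "norm (Abs_ell2 f - X n) \<le> e / 2"
        by (rule norm_ell2_le) (use bound[OF M that] in \<open>simp add: minus_ell2_apply app\<close>)
      then show ?thesis
        using \<open>e > 0\<close> by (simp add: norm_minus_commute)
    qed
    then show "\<exists>M. \<forall>n\<ge>M. norm (X n - Abs_ell2 f) < e" by blast
  qed
  then show "convergent X" by (rule convergentI)
qed

instantiation ell2 :: (type, complex_normed_vector) complex_normed_vector
begin

lift_definition scaleC_ell2 :: "complex \<Rightarrow> ('a, 'b) ell2 \<Rightarrow> ('a, 'b) ell2"
  is "\<lambda>c f i. c *\<^sub>C f i"
  by (erule summable_sq_scale) (rule norm_scaleC)

instance
proof
  show "norm (a *\<^sub>C f) = cmod a * norm f" for a and f :: "('a, 'b) ell2"
    by (simp add: norm_ell2_def scaleC_ell2.rep_eq norm_scaleC power_mult_distrib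
        infsum_cmult_right' real_sqrt_mult)
qed (transfer, simp add: scaleC_add_right scaleC_add_left scaleC_scaleC scaleC_of_real)+

end

lemma ell2_cinner_summable:
  fixes f g :: "('i, 'a::complex_inner) ell2"
  shows "(\<lambda>i. cinner (ell2_apply f i) (ell2_apply g i)) summable_on UNIV"
proof -
  have "(\<lambda>i. (norm (ell2_apply f i))\<^sup>2 + (norm (ell2_apply g i))\<^sup>2) summable_on UNIV"
    by (intro summable_on_add ell2_summable)
  then have "(\<lambda>i. norm (cinner (ell2_apply f i) (ell2_apply g i))) summable_on UNIV"
  proof (rule summable_on_comparison_test)
    fix i
    have "norm (cinner (ell2_apply f i) (ell2_apply g i))
        \<le> norm (ell2_apply f i) * norm (ell2_apply g i)"
      by (rule Cauchy_Schwarz_cinner)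
    also have "\<dots> \<le> (norm (ell2_apply f i))\<^sup>2 + (norm (ell2_apply g i))\<^sup>2"
    proof -
      have "2 * a * b \<le> a\<^sup>2 + b\<^sup>2 \<Longrightarrow> 0 \<le> a * b \<Longrightarrow> a * b \<le> a\<^sup>2 + b\<^sup>2" for a b :: real
        by linarith
      then show ?thesis
        using sum_squares_bound mult_nonneg_nonneg norm_ge_zero by blast
    qed
    finally show "norm (cinner (ell2_apply f i) (ell2_apply g i))
        \<le> (norm (ell2_apply f i))\<^sup>2 + (norm (ell2_apply g i))\<^sup>2" .
  qed simp
  then show ?thesis by (rule abs_summable_summable)
qed

instantiation ell2 :: (type, complex_inner) complex_inner
begin

definition cinner_ell2 :: "('a, 'b) ell2 \<Rightarrow> ('a, 'b) ell2 \<Rightarrow> complex" where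
  "cinner_ell2 f g = (\<Sum>\<^sub>\<infinity>i. cinner (ell2_apply f i) (ell2_apply g i))"

instance
proof
  fix f g h :: "('a, 'b) ell2" and a :: complex
  show "cinner f g = cnj (cinner g f)"
    unfolding cinner_ell2_def infsum_cnj[symmetric] by (metis cinner_commute)
  show "cinner f (g + h) = cinner f g + cinner f h"
    by (simp add: cinner_ell2_def plus_ell2.rep_eq cinner_add_right infsum_add
        ell2_cinner_summable)
  show "cinner f (a *\<^sub>C g) = a * cinner f g"
    by (simp add: cinner_ell2_def scaleC_ell2.rep_eq cinner_scaleC_right infsum_cmult_right')
  have "(\<Sum>\<^sub>\<infinity>i. complex_of_real ((norm (ell2_apply f i))\<^sup>2))
      = complex_of_real (\<Sum>\<^sub>\<infinity>i. (norm (ell2_apply f i))\<^sup>2)"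
    by (rule infsumI[OF has_sum_of_real[OF has_sum_infsum[OF ell2_summable]]])
  then show "cinner f f = complex_of_real ((norm f)\<^sup>2)"
    by (simp add: cinner_ell2_def norm_ell2_def cinner_self infsum_nonneg)
qed

end

instance ell2 :: (type, chilbert_space) chilbert_space ..


section \<open>Operators\<close>

definition cblin :: "('a::complex_normed_vector \<Rightarrow>\<^sub>L 'b::complex_normed_vector) set" where
  "cblin = {A. \<forall>c x. blinfun_apply A (c *\<^sub>C x) = c *\<^sub>C A x}"

definition adj :: "('a::complex_inner \<Rightarrow>\<^sub>L 'b::complex_inner) \<Rightarrow> ('b \<Rightarrow>\<^sub>L 'a)" where
  "adj A = (THE A' :: 'b \<Rightarrow>\<^sub>L 'a. \<forall>x y. cinner (A' y) x = cinner y (A x))"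

definition orth_compl :: "'a::complex_inner set \<Rightarrow> 'a set" where
  "orth_compl M = {x. \<forall>y\<in>M. cinner y x = 0}"

definition orth_proj :: "'a::complex_inner set \<Rightarrow> ('a \<Rightarrow>\<^sub>L 'a)" where
  "orth_proj M = (THE P :: 'a \<Rightarrow>\<^sub>L 'a. \<forall>x. P x \<in> M \<and> x - P x \<in> orth_compl M)"

text \<open>For closed subspaces \<open>M\<close> and \<open>N\<close>, a bounded operator from \<open>M\<close> to \<open>N\<close> is represented by its
  extension to the ambient spaces which vanishes on the orthogonal complement of \<open>M\<close>. This
  representation preserves norms, sums, products and adjoints; the identity operator of \<open>M\<close> is
  represented by \<open>orth_proj M\<close>.\<close>

definition bop ::
  "'a::complex_inner set \<Rightarrow> 'b::complex_inner set \<Rightarrow> ('a \<Rightarrow>\<^sub>L 'b) set" where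
  "bop M N = {A \<in> cblin. orth_proj N o\<^sub>L A o\<^sub>L orth_proj M = A}"

definition isometry ::
  "'a::complex_inner set \<Rightarrow> 'b::complex_inner set \<Rightarrow> ('a \<Rightarrow>\<^sub>L 'b) \<Rightarrow> bool" where
  "isometry M N U \<longleftrightarrow> U \<in> bop M N \<and> adj U o\<^sub>L U = orth_proj M"

definition unitary ::
  "'a::complex_inner set \<Rightarrow> 'b::complex_inner set \<Rightarrow> ('a \<Rightarrow>\<^sub>L 'b) \<Rightarrow> bool" where
  "unitary M N U \<longleftrightarrow> isometry M N U \<and> U o\<^sub>L adj U = orth_proj N"

definition positive_op :: "('a::complex_inner \<Rightarrow>\<^sub>L 'a) \<Rightarrow> bool" where
  "positive_op A \<longleftrightarrow> A \<in> cblin \<and> (\<forall>x. cinner x (A x) \<in> \<real>\<^sub>\<ge>\<^sub>0)"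

definition op_sqrt :: "('a::complex_inner \<Rightarrow>\<^sub>L 'a) \<Rightarrow> ('a \<Rightarrow>\<^sub>L 'a)" where
  "op_sqrt A = (THE R. positive_op R \<and> R o\<^sub>L R = A)"

definition compact_op :: "('a::complex_normed_vector \<Rightarrow>\<^sub>L 'b::complex_normed_vector) \<Rightarrow> bool" where
  "compact_op A \<longleftrightarrow> compact (closure (A ` cball 0 1))"

lift_definition op_dsum :: "('a::complex_normed_vector \<Rightarrow>\<^sub>L 'b::complex_normed_vector) \<Rightarrow>
    ('c::complex_normed_vector \<Rightarrow>\<^sub>L 'd::complex_normed_vector) \<Rightarrow> (('a \<times> 'c) \<Rightarrow>\<^sub>L ('b \<times> 'd))"
  is "\<lambda>f g x. (f (fst x), g (snd x))"
  by (intro bounded_linear_Pair bounded_linear_compose[OF _ bounded_linear_fst]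
      bounded_linear_compose[OF _ bounded_linear_snd])

definition wot :: "('a::complex_inner \<Rightarrow>\<^sub>L 'a) topology" where
  "wot = pullback_topology cblin (\<lambda>A (x, y). cinner y (blinfun_apply A x))
     (product_topology (\<lambda>_. euclidean) UNIV)"

definition orthonormal_basis :: "'a::complex_inner set \<Rightarrow> 'a set \<Rightarrow> bool" where
  "orthonormal_basis M B \<longleftrightarrow> B \<subseteq> M \<and> (\<forall>x\<in>B. \<forall>y\<in>B. cinner x y = (if x = y then 1 else 0)) \<and>
     closure (cspan B) = M"

definition hilbert_dim :: "'a::complex_inner set \<Rightarrow> 'a rel" where
  "hilbert_dim M = card_of (SOME B. orthonormal_basis M B)"

text \<open>\<open>word_op E X\<close> takes the word \<open>i\<^sub>1\<dots>i\<^sub>k\<close> to the product of \<open>X i\<^sub>1, \<dots>, X i\<^sub>k\<close>;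
  \<open>E\<close> is the identity of the space on which the tuple \<open>X\<close> acts.\<close>

definition word_op ::
  "('a::complex_normed_vector \<Rightarrow>\<^sub>L 'a) \<Rightarrow> ('n \<Rightarrow> 'a \<Rightarrow>\<^sub>L 'a) \<Rightarrow> 'n list \<Rightarrow> ('a \<Rightarrow>\<^sub>L 'a)" where
  "word_op E X \<alpha> = foldr (\<lambda>i A. X i o\<^sub>L A) \<alpha> E"


section \<open>Noncommutative polynomials\<close>

text \<open>The monomials in the noncommuting indeterminates indexed by \<open>'n\<close> are the words over \<open>'n\<close>.\<close>

type_synonym 'n ncpoly = "'n list \<Rightarrow>\<^sub>0 complex"

definition homogeneous :: "'n ncpoly \<Rightarrow> bool" where
  "homogeneous p \<longleftrightarrow> (\<exists>k. \<forall>\<alpha>\<in>Poly_Mapping.keys p. length \<alpha> = k)"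

definition poly_eval :: "('n \<Rightarrow> 'a::complex_normed_vector \<Rightarrow>\<^sub>L 'a) \<Rightarrow> 'n ncpoly \<Rightarrow> ('a \<Rightarrow>\<^sub>L 'a)" where
  "poly_eval X p =
     (\<Sum>\<alpha>\<in>Poly_Mapping.keys p. Poly_Mapping.lookup p \<alpha> *\<^sub>C word_op id_blinfun X \<alpha>)"


section \<open>The full Fock space\<close>

text \<open>For \<open>H\<^sub>n\<close> with orthonormal basis \<open>e\<^sub>i\<close> indexed by a finite type \<open>'n\<close>, the \<open>k\<close>-th tensor power
  has the orthonormal basis \<open>e\<^bsub>i\<^sub>1\<^esub> \<otimes> \<dots> \<otimes> e\<^bsub>i\<^sub>k\<^esub>\<close> indexed by the words of length \<open>k\<close>, and the Fock space
  consists of the square summable coefficient families over all words. The empty word carries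
  the summand \<open>\<complex>1\<close>.\<close>

type_synonym 'n fock = "('n list, complex) ell2"

lemma summable_sq_creation:
  fixes f :: "'n list \<Rightarrow> 'a::real_normed_vector"
  assumes "(\<lambda>w. (norm (f w))\<^sup>2) summable_on UNIV"
  shows "(\<lambda>w. (norm (case w of [] \<Rightarrow> 0 | j # v \<Rightarrow> if j = i then f v else 0))\<^sup>2) summable_on UNIV"
    and "(\<Sum>\<^sub>\<infinity>w. (norm (case w of [] \<Rightarrow> 0 | j # v \<Rightarrow> if j = i then f v else 0))\<^sup>2)
      = (\<Sum>\<^sub>\<infinity>w. (norm (f w))\<^sup>2)"
proof -
  let ?g = "\<lambda>w. (norm (case w of [] \<Rightarrow> 0 | j # v \<Rightarrow> if j = i then f v else 0))\<^sup>2"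
  have inj: "inj_on ((#) i) UNIV" by simp
  have eq: "(\<lambda>w. (norm (f w))\<^sup>2) = ?g \<circ> (#) i" by auto
  have zero: "?g w = 0" if "w \<in> UNIV - range ((#) i)" for w
    using that by (auto split: list.split)
  have "?g summable_on range ((#) i)"
    using assms unfolding eq by (simp add: summable_on_reindex[OF inj])
  then show "?g summable_on UNIV"
    by (rule summable_on_cong_neutral[THEN iffD1, rotated -1]) (use zero in auto)
  have "infsum ?g UNIV = infsum ?g (range ((#) i))"
    by (rule infsum_cong_neutral) (use zero in auto)
  also have "\<dots> = (\<Sum>\<^sub>\<infinity>w. (norm (f w))\<^sup>2)"
    unfolding eq by (rule infsum_reindex[OF inj])
  finally show "infsum ?g UNIV = (\<Sum>\<^sub>\<infinity>w. (norm (f w))\<^sup>2)" .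
qed

text \<open>In these coordinates \<open>ell2_cons i \<phi>\<close> is the tensor \<open>e\<^sub>i \<otimes> \<phi>\<close>.\<close>

lift_definition ell2_cons :: "'n \<Rightarrow> ('n list, 'a::real_normed_vector) ell2 \<Rightarrow> ('n list, 'a) ell2"
  is "\<lambda>i f w. case w of [] \<Rightarrow> 0 | j # v \<Rightarrow> if j = i then f v else 0"
  by (rule summable_sq_creation)

lift_definition creation :: "'n \<Rightarrow> ('n fock \<Rightarrow>\<^sub>L 'n fock)" is ell2_cons
proof (rule bounded_linear_intro[where K = 1])
  fix i :: 'n and f g :: "'n fock" and r :: real
  show "ell2_cons i (f + g) = ell2_cons i f + ell2_cons i g"
    by transfer (auto simp: fun_eq_iff split: list.split)
  show "ell2_cons i (r *\<^sub>R f) = r *\<^sub>R ell2_cons i f"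
    by transfer (auto simp: fun_eq_iff split: list.split)
  show "norm (ell2_cons i f) \<le> norm f * 1"
    unfolding norm_ell2_def ell2_cons.rep_eq summable_sq_creation(2)[OF ell2_summable] by simp
qed

definition unital_algebra :: "('a::complex_normed_vector \<Rightarrow>\<^sub>L 'a) \<Rightarrow> ('a \<Rightarrow>\<^sub>L 'a) set \<Rightarrow> bool" where
  "unital_algebra E \<A> \<longleftrightarrow> csubspace \<A> \<and> (\<forall>A\<in>\<A>. \<forall>B\<in>\<A>. A o\<^sub>L B \<in> \<A>) \<and> E \<in> \<A>"

definition F_inf :: "('n fock \<Rightarrow>\<^sub>L 'n fock) set" where
  "F_inf = \<Inter>{\<A>. closedin wot \<A> \<and> unital_algebra id_blinfun \<A> \<and> range creation \<subseteq> \<A>}"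

definition wot_ideal :: "('n fock \<Rightarrow>\<^sub>L 'n fock) set \<Rightarrow> bool" where
  "wot_ideal J \<longleftrightarrow> J \<subseteq> F_inf \<and> csubspace J \<and>
     (\<forall>A\<in>F_inf. \<forall>X\<in>J. A o\<^sub>L X \<in> J \<and> X o\<^sub>L A \<in> J) \<and> closedin wot J"

definition wot_ideal_generated :: "'n ncpoly set \<Rightarrow> ('n fock \<Rightarrow>\<^sub>L 'n fock) set" where
  "wot_ideal_generated P = \<Inter>{I. wot_ideal I \<and> poly_eval creation ` P \<subseteq> I}"

definition model_space :: "('n fock \<Rightarrow>\<^sub>L 'n fock) set \<Rightarrow> 'n fock set" where
  "model_space J = orth_compl (closure {blinfun_apply A \<phi> |A \<phi>. A \<in> J})"

definition model_op :: "('n fock \<Rightarrow>\<^sub>L 'n fock) set \<Rightarrow> 'n \<Rightarrow> ('n fock \<Rightarrow>\<^sub>L 'n fock)" where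
  "model_op J i = orth_proj (model_space J) o\<^sub>L creation i o\<^sub>L orth_proj (model_space J)"

definition model_word :: "('n fock \<Rightarrow>\<^sub>L 'n fock) set \<Rightarrow> 'n list \<Rightarrow> ('n fock \<Rightarrow>\<^sub>L 'n fock)" where
  "model_word J = word_op (orth_proj (model_space J)) (model_op J)"

definition model_cstar :: "('n fock \<Rightarrow>\<^sub>L 'n fock) set \<Rightarrow> ('n fock \<Rightarrow>\<^sub>L 'n fock) set" where
  "model_cstar J = \<Inter>{\<A>. \<A> \<subseteq> bop (model_space J) (model_space J) \<and> closed \<A> \<and>
     unital_algebra (orth_proj (model_space J)) \<A> \<and> adj ` \<A> \<subseteq> \<A> \<and> range (model_op J) \<subseteq> \<A>}"


section \<open>Hilbert space tensor products with subspaces of \<open>\<ell>\<^sup>2\<close>\<close>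

lift_definition ell2_tensor ::
  "('i, complex) ell2 \<Rightarrow> 'a::complex_normed_vector \<Rightarrow> ('i, 'a) ell2"  (infixr \<open>\<otimes>\<^sub>2\<close> 70)
  is "\<lambda>\<xi> d i. \<xi> i *\<^sub>C d"
proof -
  fix \<xi> :: "'i \<Rightarrow> complex" and d :: 'a
  assume "(\<lambda>i. (norm (\<xi> i))\<^sup>2) summable_on UNIV"
  then show "(\<lambda>i. (norm (\<xi> i *\<^sub>C d))\<^sup>2) summable_on UNIV"
    by (simp add: norm_scaleC power_mult_distrib summable_on_cmult_left)
qed

text \<open>Since the inner product of \<open>\<xi> \<otimes>\<^sub>2 d\<close> and \<open>\<eta> \<otimes>\<^sub>2 e\<close> is \<open>cinner \<xi> \<eta> * cinner d e\<close>, the closed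
  linear span of the tensors \<open>\<xi> \<otimes>\<^sub>2 d\<close> with \<open>\<xi> \<in> N\<close> and \<open>d \<in> D\<close> is the Hilbert space tensor product
  of \<open>N\<close> and \<open>D\<close>.\<close>

definition tensor_space ::
  "('i, complex) ell2 set \<Rightarrow> 'a::complex_inner set \<Rightarrow> ('i, 'a) ell2 set" where
  "tensor_space N D = closure (cspan {\<xi> \<otimes>\<^sub>2 d |\<xi> d. \<xi> \<in> N \<and> d \<in> D})"

text \<open>The operator \<open>A \<otimes> I\<^sub>D\<close> for an operator \<open>A\<close> on \<open>N\<close>.\<close>

definition tensor_id :: "('i, complex) ell2 set \<Rightarrow> 'a::complex_inner set \<Rightarrow>
    (('i, complex) ell2 \<Rightarrow>\<^sub>L ('i, complex) ell2) \<Rightarrow> (('i, 'a) ell2 \<Rightarrow>\<^sub>L ('i, 'a) ell2)" where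
  "tensor_id N D A = (THE X. X \<in> bop (tensor_space N D) (tensor_space N D) \<and>
     (\<forall>\<xi>\<in>N. \<forall>d\<in>D. X (\<xi> \<otimes>\<^sub>2 d) = A \<xi> \<otimes>\<^sub>2 d))"


section \<open>Constrained row contractions and their dilations\<close>

definition row_contraction :: "('n::finite \<Rightarrow> 'h::chilbert_space \<Rightarrow>\<^sub>L 'h) \<Rightarrow> bool" where
  "row_contraction T \<longleftrightarrow> range T \<subseteq> cblin \<and> positive_op (id_blinfun - (\<Sum>i\<in>UNIV. T i o\<^sub>L adj (T i)))"

definition defect_op :: "('n::finite \<Rightarrow> 'h::chilbert_space \<Rightarrow>\<^sub>L 'h) \<Rightarrow> ('h \<Rightarrow>\<^sub>L 'h)" where
  "defect_op T = op_sqrt (id_blinfun - (\<Sum>i\<in>UNIV. T i o\<^sub>L adj (T i)))"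

definition defect_space :: "('n::finite \<Rightarrow> 'h::chilbert_space \<Rightarrow>\<^sub>L 'h) \<Rightarrow> 'h set" where
  "defect_space T = closure (range (defect_op T))"

definition unitarily_equivalent ::
  "('n \<Rightarrow> 'h::chilbert_space \<Rightarrow>\<^sub>L 'h) \<Rightarrow> ('n \<Rightarrow> 'h'::chilbert_space \<Rightarrow>\<^sub>L 'h') \<Rightarrow> bool" where
  "unitarily_equivalent T T' \<longleftrightarrow>
     (\<exists>U. unitary UNIV UNIV U \<and> (\<forall>i. T i = adj U o\<^sub>L T' i o\<^sub>L U))"

definition star_representation ::
  "('a::complex_inner \<Rightarrow>\<^sub>L 'a) set \<Rightarrow> (('a \<Rightarrow>\<^sub>L 'a) \<Rightarrow> ('k::complex_inner \<Rightarrow>\<^sub>L 'k)) \<Rightarrow> bool" where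
  "star_representation \<A> \<pi> \<longleftrightarrow> \<pi> ` \<A> \<subseteq> cblin \<and>
     (\<forall>A\<in>\<A>. \<forall>B\<in>\<A>. \<pi> (A + B) = \<pi> A + \<pi> B \<and> \<pi> (A o\<^sub>L B) = \<pi> A o\<^sub>L \<pi> B) \<and>
     (\<forall>A\<in>\<A>. (\<forall>c. \<pi> (c *\<^sub>C A) = c *\<^sub>C \<pi> A) \<and> \<pi> (adj A) = adj (\<pi> A))"

definition coupled_space :: "('n fock \<Rightarrow>\<^sub>L 'n fock) set \<Rightarrow>
    ('n::finite \<Rightarrow> 'h::chilbert_space \<Rightarrow>\<^sub>L 'h) \<Rightarrow> ('n list, 'h) ell2 set" where
  "coupled_space J T = tensor_space (model_space J) (defect_space T)"

definition coupled_op :: "('n fock \<Rightarrow>\<^sub>L 'n fock) set \<Rightarrow>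
    ('n::finite \<Rightarrow> 'h::chilbert_space \<Rightarrow>\<^sub>L 'h) \<Rightarrow> 'n \<Rightarrow> (('n list, 'h) ell2 \<Rightarrow>\<^sub>L ('n list, 'h) ell2)"
  where
  "coupled_op J T i = tensor_id (model_space J) (defect_space T) (model_op J i)"

definition dil_space :: "('n fock \<Rightarrow>\<^sub>L 'n fock) set \<Rightarrow> ('n::finite \<Rightarrow> 'h::chilbert_space \<Rightarrow>\<^sub>L 'h) \<Rightarrow>
    (('n list, 'h) ell2 \<times> 'k::chilbert_space) set" where
  "dil_space J T = coupled_space J T \<times> UNIV"

definition dil_op :: "('n fock \<Rightarrow>\<^sub>L 'n fock) set \<Rightarrow> ('n::finite \<Rightarrow> 'h::chilbert_space \<Rightarrow>\<^sub>L 'h) \<Rightarrow>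
    (('n fock \<Rightarrow>\<^sub>L 'n fock) \<Rightarrow> ('k::chilbert_space \<Rightarrow>\<^sub>L 'k)) \<Rightarrow> 'n \<Rightarrow>
    ((('n list, 'h) ell2 \<times> 'k) \<Rightarrow>\<^sub>L (('n list, 'h) ell2 \<times> 'k))" where
  "dil_op J T \<pi> i = op_dsum (coupled_op J T i) (\<pi> (model_op J i))"

text \<open>\<open>\<iota>\<close> is the isometry that identifies the Hilbert space of \<open>T\<close> with a subspace of
  \<open>dil_space J T\<close>.\<close>

definition constrained_dilation :: "('n fock \<Rightarrow>\<^sub>L 'n fock) set \<Rightarrow>
    ('n::finite \<Rightarrow> 'h::chilbert_space \<Rightarrow>\<^sub>L 'h) \<Rightarrow>
    (('n fock \<Rightarrow>\<^sub>L 'n fock) \<Rightarrow> ('k::chilbert_space \<Rightarrow>\<^sub>L 'k)) \<Rightarrow>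
    ('h \<Rightarrow>\<^sub>L (('n list, 'h) ell2 \<times> 'k)) \<Rightarrow> bool" where
  "constrained_dilation J T \<pi> \<iota> \<longleftrightarrow>
     separable_space (euclidean :: 'k topology) \<and>
     star_representation (model_cstar J) \<pi> \<and>
     (\<forall>A\<in>model_cstar J. compact_op A \<longrightarrow> \<pi> A = 0) \<and>
     (\<Sum>i\<in>UNIV. \<pi> (model_op J i) o\<^sub>L adj (\<pi> (model_op J i))) = id_blinfun \<and>
     isometry UNIV (dil_space J T) \<iota> \<and>
     (\<forall>i. adj (dil_op J T \<pi> i) ` range \<iota> \<subseteq> range \<iota>) \<and>
     \<Inter>{M. closed M \<and> csubspace M \<and> M \<subseteq> dil_space J T \<and> range \<iota> \<subseteq> M \<and>
         (\<forall>i. dil_op J T \<pi> i ` M \<subseteq> M \<and> adj (dil_op J T \<pi> i) ` M \<subseteq> M)} = dil_space J T \<and>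
     (\<forall>i. \<iota> o\<^sub>L adj (T i) = adj (dil_op J T \<pi> i) o\<^sub>L \<iota>)"

definition minimal_dilation :: "('n fock \<Rightarrow>\<^sub>L 'n fock) set \<Rightarrow>
    ('n::finite \<Rightarrow> 'h::chilbert_space \<Rightarrow>\<^sub>L 'h) \<Rightarrow>
    (('n fock \<Rightarrow>\<^sub>L 'n fock) \<Rightarrow> ('k::chilbert_space \<Rightarrow>\<^sub>L 'k)) \<Rightarrow>
    ('h \<Rightarrow>\<^sub>L (('n list, 'h) ell2 \<times> 'k)) \<Rightarrow> bool" where
  "minimal_dilation J T \<pi> \<iota> \<longleftrightarrow>
     dil_space J T =
       closure (cspan {word_op (orth_proj (dil_space J T)) (dil_op J T \<pi>) \<alpha> (\<iota> h) |\<alpha> h. True})"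

end

theory Submission
  imports Defs
begin

text \<open>A dilation is studied through the single star representation
  \<open>\<rho>(X) = (X \<otimes> I) \<oplus> \<pi>(X)\<close> of the \<open>C\<^sup>*\<close>-algebra of the model. Since \<open>V\<^sub>\<beta>\<^sup>*\<close> restricts to \<open>T\<^sub>\<beta>\<^sup>*\<close>, the moments
  \<open>\<langle>\<iota>h, \<rho>(B\<^sub>\<alpha>B\<^sub>\<beta>\<^sup>*)\<iota>k\<rangle> = \<langle>T\<^sub>\<alpha>\<^sup>*h, T\<^sub>\<beta>\<^sup>*k\<rangle>\<close> depend only on \<open>T\<close>; by the density hypothesis and the automatic
  continuity of \<open>\<rho>\<close> they determine \<open>\<langle>\<iota>h, \<rho>(X)\<iota>k\<rangle>\<close> for all \<open>X\<close>, hence the star-cyclic dilation up to a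
  unitary, and \<open>\<rho>(X)\<iota>h\<close> lies in the closed span of the \<open>V\<^sub>\<alpha>\<iota>h\<close>, which is minimality. As the ideal is
  homogeneous and proper, the vacuum lies in the model space and \<open>I - \<Sum>V\<^sub>iV\<^sub>i\<^sup>*\<close> is the projection onto
  the vacuum tensored with the defect space. A unitary intertwining two dilations therefore maps these
  ranges, and the subspaces \<open>N \<otimes> D\<close> which they generate, onto each other, so it is block diagonal and
  the defect spaces have the same dimension.\<close>

section \<open>Complex inner product spaces\<close>

text \<open>Operators between closed subspaces are represented by extensions by zero, so the unit of
  the model algebra is the projection \<open>E\<close>, a representation sends it to the projection
  onto \<open>K\<close>, and \<open>id_blinfun\<close> need not lie in the algebra. This is why
  continuity of a star representation is derived from a fixed point Y of an iteration without
  constant term: Y can be built inside any norm-closed star algebra, and the representation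
  transports its equation. The same iteration yields positive square roots, hence the defect
  operator and the norm bound for A \<otimes> I. Operators known only on generators, such as A
  \<otimes> I and the unitary between two dilations, are obtained by closing a span of pairs to a
  graph; a norm bound, or equality of inner products, makes the graph single-valued with closed
  domain. Homogeneity puts the vacuum into the model space as follows: a homogeneous generator with
  a constant term is a nonzero scalar, which would make the ideal all of \<open>F_inf\<close>, so no
  generator has a constant term.\<close>

interpretation cvs: vector_space "scaleC :: complex \<Rightarrow> 'a \<Rightarrow> 'a::complex_normed_vector"
  rewrites "module.span scaleC = cspan" and "module.subspace scaleC = csubspace"
  by (simp_all add: vector_space_scaleC cspan_def csubspace_def)

lemma bounded_linear_scaleC: "bounded_linear (\<lambda>x::'a::complex_normed_vector. c *\<^sub>C x)"
  by (rule bounded_linear_intro[where K = "cmod c"])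
    (simp_all add: scaleC_add_right norm_scaleC scaleC_scaleC mult.commute flip: scaleC_of_real)

lemmas tendsto_scaleC [tendsto_intros] = bounded_linear.tendsto[OF bounded_linear_scaleC]
lemmas continuous_on_scaleC [continuous_intros] =
  bounded_linear.continuous_on[OF bounded_linear_scaleC]

lemma csubspaceI:
  assumes "0 \<in> M" "\<And>x y. x \<in> M \<Longrightarrow> y \<in> M \<Longrightarrow> x + y \<in> M" "\<And>c x. x \<in> M \<Longrightarrow> c *\<^sub>C x \<in> M"
  shows "csubspace M"
  using assms by (auto simp: cvs.subspace_def)

lemma csubspace_closure:
  fixes M :: "'a::complex_normed_vector set"
  assumes "csubspace M"
  shows "csubspace (closure M)"
proof (rule csubspaceI)
  show "0 \<in> closure M"
    using cvs.subspace_0[OF assms] closure_subset by blast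
next
  fix x y assume "x \<in> closure M" "y \<in> closure M"
  then obtain f g where "\<forall>n. f n \<in> M" "f \<longlonglongrightarrow> x" "\<forall>n. g n \<in> M" "g \<longlonglongrightarrow> y"
    unfolding closure_sequential by blast
  then show "x + y \<in> closure M"
    unfolding closure_sequential
    by (intro exI[of _ "\<lambda>n. f n + g n"]) (auto intro: tendsto_add cvs.subspace_add assms)
next
  fix c x assume "x \<in> closure M"
  then obtain f where "\<forall>n. f n \<in> M" "f \<longlonglongrightarrow> x"
    unfolding closure_sequential by blast
  then show "c *\<^sub>C x \<in> closure M"
    unfolding closure_sequential
    by (intro exI[of _ "\<lambda>n. c *\<^sub>C f n"]) (auto intro: tendsto_scaleC cvs.subspace_scale assms)
qed

lemma csubspace_closure_cspan [simp]: "csubspace (closure (cspan S))"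
  by (simp add: csubspace_closure cvs.subspace_span)

lemma closure_cspan_minimal:
  assumes "S \<subseteq> M" "csubspace M" "closed M"
  shows "closure (cspan S) \<subseteq> M"
  using assms by (intro closure_minimal cvs.span_minimal)

lemma closure_cspan_superset: "S \<subseteq> closure (cspan S)"
  using cvs.span_superset closure_subset by blast

lemma cinner_add_left: "cinner (x + y) z = cinner x z + cinner (y::'a::complex_inner) z"
  by (metis cinner_commute cinner_add_right complex_cnj_add)

lemma cinner_scaleC_left: "cinner (c *\<^sub>C x) y = cnj c * cinner (x::'a::complex_inner) y"
  by (metis cinner_commute cinner_scaleC_right complex_cnj_mult)

lemma cinner_zero_right [simp]: "cinner x 0 = 0"
  using cinner_add_right[of x 0 0] by simp

lemma cinner_zero_left [simp]: "cinner 0 x = 0"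
  using cinner_add_left[of 0 0 x] by simp

lemma cinner_minus_right [simp]: "cinner x (- y) = - cinner x y"
  using cinner_add_right[of x y "- y"] by (simp add: eq_neg_iff_add_eq_0 add.commute)

lemma cinner_minus_left [simp]: "cinner (- x) y = - cinner x y"
  using cinner_add_left[of x "- x" y] by (simp add: eq_neg_iff_add_eq_0 add.commute)

lemma cinner_diff_right: "cinner x (y - z) = cinner x y - cinner x z"
  using cinner_add_right[of x y "- z"] by simp

lemma cinner_diff_left: "cinner (x - y) z = cinner x z - cinner y z"
  using cinner_add_left[of x "- y" z] by simp

lemma cinner_scaleR_right: "cinner x (r *\<^sub>R y) = of_real r * cinner x y"
  by (simp add: cinner_scaleC_right flip: scaleC_of_real)

lemma cinner_scaleR_left: "cinner (r *\<^sub>R x) y = of_real r * cinner x y"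
  by (simp add: cinner_scaleC_left flip: scaleC_of_real)

lemmas cinner_algebra = cinner_add_left cinner_add_right cinner_diff_left cinner_diff_right
  cinner_scaleC_left cinner_scaleC_right cinner_scaleR_left cinner_scaleR_right

lemma cinner_sum_right: "cinner x (sum f A) = (\<Sum>i\<in>A. cinner x (f i))"
  by (induction A rule: infinite_finite_induct) (auto simp: cinner_add_right)

lemma bounded_bilinear_cinner: "bounded_bilinear (cinner :: 'a::complex_inner \<Rightarrow> 'a \<Rightarrow> complex)"
proof
  show "\<exists>K. \<forall>(a::'a) b. norm (cinner a b) \<le> norm a * norm b * K"
    by (rule exI[of _ 1]) (simp add: Cauchy_Schwarz_cinner)
qed (auto simp: cinner_algebra scaleR_conv_of_real)

lemmas tendsto_cinner [tendsto_intros] = bounded_bilinear.tendsto[OF bounded_bilinear_cinner]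
lemmas continuous_on_cinner [continuous_intros] =
  bounded_bilinear.continuous_on[OF bounded_bilinear_cinner]

lemma cinner_self_eq_0 [simp]: "cinner x x = 0 \<longleftrightarrow> x = 0"
  by (simp add: cinner_self)

lemma norm_sq_cinner: "(norm x)\<^sup>2 = Re (cinner x x)"
  by (simp add: cinner_self)

lemma cinner_eqI: "(\<And>y. cinner y x = cinner y z) \<Longrightarrow> x = z"
  using cinner_self_eq_0[of "x - z"] by (simp add: cinner_diff_right)

lemma norm_eq_of_cinner_self: "cinner x x = cinner y y \<Longrightarrow> norm x = norm y"
  using norm_sq_cinner[of x] norm_sq_cinner[of y] by (metis norm_ge_zero power2_eq_imp_eq)

lemma cinner_eq_0_commute: "cinner x y = 0 \<longleftrightarrow> cinner y x = 0"
  by (metis cinner_commute complex_cnj_zero)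

lemma cinner_swap: "cinner x y = cinner u v \<Longrightarrow> cinner y x = cinner v u"
  using cinner_commute[of y x] cinner_commute[of v u] by simp

lemma pythagoras:
  assumes "cinner x y = 0"
  shows "(norm (x + y))\<^sup>2 = (norm x)\<^sup>2 + (norm y)\<^sup>2"
  using assms cinner_eq_0_commute[of x y] by (simp add: norm_sq_cinner cinner_algebra)

lemma parallelogram:
  "(norm (x + y))\<^sup>2 + (norm (x - y))\<^sup>2 = 2 * (norm (x::'a::complex_inner))\<^sup>2 + 2 * (norm y)\<^sup>2"
  by (simp add: norm_sq_cinner cinner_algebra)

text \<open>The equaliser of two bounded linear maps is a closed complex subspace. The maps are
  plain functions, not elements of \<open>cblin\<close>, so that composites such as
  \<open>\<lambda>y. snd (U (y, 0))\<close> fit directly.\<close>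

lemma closure_cspan_eqI:
  assumes "\<And>s. s \<in> S \<Longrightarrow> f s = g s" "x \<in> closure (cspan S)"
    and "bounded_linear f" "bounded_linear g"
    and "\<And>c x. f (c *\<^sub>C x) = c *\<^sub>C f x" "\<And>c x. g (c *\<^sub>C x) = c *\<^sub>C g x"
  shows "f x = g x"
proof -
  have "closed {x. f x = g x}"
    by (intro closed_Collect_eq linear_continuous_on assms)
  moreover have "csubspace {x. f x = g x}"
    using assms(3-6) by (auto intro!: csubspaceI simp: linear_simps)
  ultimately have "closure (cspan S) \<subseteq> {x. f x = g x}"
    using assms(1) by (intro closure_cspan_minimal) auto
  then show ?thesis using assms(2) by blast
qed


section \<open>Orthogonal projections and adjoints\<close>

lemma csubspace_orth_compl [simp]: "csubspace (orth_compl M)"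
  by (rule csubspaceI) (auto simp: orth_compl_def cinner_algebra)

lemma closed_orth_compl [simp]: "closed (orth_compl M)"
proof -
  have "orth_compl M = (\<Inter>y\<in>M. {x. cinner y x = 0})"
    by (auto simp: orth_compl_def)
  also have "closed \<dots>"
    by (intro closed_INT ballI closed_Collect_eq continuous_intros)
  finally show ?thesis .
qed

lemma orth_compl_closure_cspan: "orth_compl (closure (cspan S)) = orth_compl S"
proof
  show "orth_compl (closure (cspan S)) \<subseteq> orth_compl S"
    using closure_cspan_superset by (fastforce simp: orth_compl_def)
  have "closure (cspan S) \<subseteq> orth_compl (orth_compl S)"
    using cinner_eq_0_commute
    by (intro closure_cspan_minimal csubspace_orth_compl closed_orth_compl)
      (fastforce simp: orth_compl_def)
  then show "orth_compl S \<subseteq> orth_compl (closure (cspan S))"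
    using cinner_eq_0_commute by (fastforce simp: orth_compl_def)
qed

lemma orth_compl_closure: "orth_compl (closure S) = orth_compl S"
proof
  show "orth_compl (closure S) \<subseteq> orth_compl S"
    using closure_subset[of S] by (auto simp: orth_compl_def)
  show "orth_compl S \<subseteq> orth_compl (closure S)"
    using orth_compl_closure_cspan[of S] closure_mono[OF cvs.span_superset[of S]]
    by (fastforce simp: orth_compl_def)
qed

lemma orth_compl_Int: "x \<in> M \<Longrightarrow> x \<in> orth_compl M \<Longrightarrow> x = 0"
  by (auto simp: orth_compl_def)

text \<open>The nearest point of M to x exists because a minimising sequence is Cauchy by the
  parallelogram law; minimality forces the error to be orthogonal to M.\<close>

lemma orthogonal_decomposition:
  fixes M :: "'a::chilbert_space set"
  assumes M: "csubspace M" "closed M"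
  shows "\<exists>p\<in>M. x - p \<in> orth_compl M"
proof -
  define d where "d = (INF y\<in>M. (norm (x - y))\<^sup>2)"
  have M0: "0 \<in> M" using M cvs.subspace_0 by blast
  have bdd: "bdd_below ((\<lambda>y. (norm (x - y))\<^sup>2) ` M)" by (rule bdd_belowI2[of _ 0]) auto
  have d_le: "d \<le> (norm (x - y))\<^sup>2" if "y \<in> M" for y
    unfolding d_def using bdd that by (rule cINF_lower)
  have "\<exists>y\<in>M. (norm (x - y))\<^sup>2 < d + inverse (real (Suc n))" for n
    using cINF_less_iff[of M "\<lambda>y. (norm (x - y))\<^sup>2" "d + inverse (real (Suc n))"] M0 bdd
    by (auto simp: d_def)
  then obtain y where yM: "\<And>n. y n \<in> M"
    and y: "\<And>n. (norm (x - y n))\<^sup>2 < d + inverse (real (Suc n))"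
    by metis
  \<comment> \<open>The midpoint of \<open>y m\<close> and \<open>y n\<close> lies in M, so the
    squared norm of a + b is at least 4d, and the parallelogram law leaves only the two excesses
    over d.\<close>
  have diff: "(norm (y m - y n))\<^sup>2 \<le> 2 * inverse (real (Suc m)) + 2 * inverse (real (Suc n))" for m n
  proof -
    define a b where "a = x - y m" and "b = x - y n"
    have "(1/2) *\<^sub>R (y m + y n) \<in> M"
      using yM M by (metis cvs.subspace_add cvs.subspace_scale scaleC_of_real)
    moreover have "x - (1/2) *\<^sub>R (y m + y n) = (1/2) *\<^sub>R (a + b)"
    proof -
      have "x = (1/2) *\<^sub>R (x + x)" by (simp flip: scaleR_2)
      then have "x - (1/2) *\<^sub>R (y m + y n) = (1/2) *\<^sub>R ((x + x) - (y m + y n))"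
        by (metis scaleR_right_diff_distrib)
      then show ?thesis by (simp add: a_def b_def algebra_simps)
    qed
    ultimately have "d \<le> (norm ((1/2) *\<^sub>R (a + b)))\<^sup>2"
      using d_le by metis
    then have "4 * d \<le> (norm (a + b))\<^sup>2" by (simp add: power_divide)
    moreover have "y m - y n = b - a" by (simp add: a_def b_def)
    ultimately show ?thesis
      using parallelogram[of a b] y[of m] y[of n] norm_minus_commute[of a b]
      unfolding a_def[symmetric] b_def[symmetric] by simp
  qed
  have "Cauchy y"
  proof (rule CauchyI)
    fix e :: real assume "e > 0"
    then obtain k where k: "inverse (real (Suc k)) < e\<^sup>2 / 4"
      using reals_Archimedean[of "e\<^sup>2 / 4"] by auto
    have "norm (y m - y n) < e" if "m \<ge> k" "n \<ge> k" for m n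
    proof -
      have "inverse (real (Suc m)) \<le> inverse (real (Suc k))" "inverse (real (Suc n)) \<le> inverse (real (Suc k))"
        using that by (auto intro!: le_imp_inverse_le)
      then have "(norm (y m - y n))\<^sup>2 < e\<^sup>2" using diff[of m n] k by linarith
      then show ?thesis using \<open>e > 0\<close> by (simp add: power_less_imp_less_base)
    qed
    then show "\<exists>M. \<forall>m\<ge>M. \<forall>n\<ge>M. norm (y m - y n) < e" by blast
  qed
  then obtain p where p: "y \<longlonglongrightarrow> p" using Cauchy_convergent convergent_def by blast
  have pM: "p \<in> M" using \<open>closed M\<close> yM p closed_sequentially by blast
  have "(norm (x - p))\<^sup>2 \<le> d + 0"
  proof (rule LIMSEQ_le)
    show "(\<lambda>n. (norm (x - y n))\<^sup>2) \<longlonglongrightarrow> (norm (x - p))\<^sup>2" by (intro tendsto_intros p)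
    show "(\<lambda>n. d + inverse (real (Suc n))) \<longlonglongrightarrow> d + 0"
      by (intro tendsto_intros LIMSEQ_inverse_real_of_nat)
  qed (use y less_imp_le in blast)
  then have min: "(norm (x - p))\<^sup>2 \<le> (norm (x - p - z))\<^sup>2" if "z \<in> M" for z
    using order_trans[OF _ d_le[OF cvs.subspace_add[OF M(1) pM that]], of "(norm (x - p))\<^sup>2"]
    by (simp only: diff_diff_add add_0_right)
  have "cinner z (x - p) = 0" if z: "z \<in> M" for z
  proof (cases "z = 0")
    case False
    \<comment> \<open>Removing the component of x - p along z would shorten x - p by Pythagoras, so
      minimality makes that component vanish.\<close>
    define c where "c = cinner z (x - p) / of_real ((norm z)\<^sup>2)"
    have *: "cinner z (x - p - c *\<^sub>C z) = 0"
      using False by (simp add: cinner_algebra c_def cinner_self)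
    have "(norm (x - p - c *\<^sub>C z + c *\<^sub>C z))\<^sup>2 = (norm (x - p - c *\<^sub>C z))\<^sup>2 + (norm (c *\<^sub>C z))\<^sup>2"
      by (rule pythagoras) (simp add: cinner_scaleC_right cinner_eq_0_commute[THEN iffD1, OF *])
    then have "(norm (c *\<^sub>C z))\<^sup>2 \<le> 0"
      using min[OF cvs.subspace_scale[OF M(1) z], of c] by (simp only: diff_add_cancel)
    then have "c = 0" using False by (simp add: norm_scaleC)
    then show ?thesis using * by simp
  qed simp
  then show ?thesis using pM by (auto simp: orth_compl_def)
qed

text \<open>\<open>orth_proj\<close> is a \<open>THE\<close> over bounded operators, so the
  nearest-point map must be shown linear and bounded: linearity follows from uniqueness of the
  decomposition, the bound from Pythagoras.\<close>

lemma orth_proj_spec: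
  fixes M :: "'a::chilbert_space set"
  assumes M: "csubspace M" "closed M"
  shows "orth_proj M \<in> cblin \<and> (\<forall>x. orth_proj M x \<in> M \<and> x - orth_proj M x \<in> orth_compl M)"
proof -
  obtain p where p: "\<And>x. p x \<in> M" "\<And>x. x - p x \<in> orth_compl M"
    using orthogonal_decomposition[OF M] by metis
  have uniq: "q = p x" if "q \<in> M" "x - q \<in> orth_compl M" for q x
  proof -
    have "q - p x \<in> M" using that p M cvs.subspace_diff by blast
    moreover have "(x - p x) - (x - q) \<in> orth_compl M"
      using that p by (metis cvs.subspace_diff[OF csubspace_orth_compl])
    ultimately show ?thesis using orth_compl_Int[of "q - p x" M] by simp
  qed
  have add: "p (x + y) = p x + p y" for x y
    by (rule uniq[symmetric]) (use p M cvs.subspace_add[OF csubspace_orth_compl p(2)[of x] p(2)[of y]]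
        in \<open>auto simp: cvs.subspace_add algebra_simps\<close>)
  have scale: "p (c *\<^sub>C x) = c *\<^sub>C p x" for c x
    by (rule uniq[symmetric]) (use p M cvs.subspace_scale[OF csubspace_orth_compl p(2)[of x], of c]
        in \<open>auto simp: cvs.subspace_scale cvs.scale_right_diff_distrib\<close>)
  have bound: "norm (p x) \<le> norm x" for x
  proof -
    have "(norm (p x + (x - p x)))\<^sup>2 = (norm (p x))\<^sup>2 + (norm (x - p x))\<^sup>2"
      by (rule pythagoras) (use p in \<open>auto simp: orth_compl_def\<close>)
    then show ?thesis by (simp add: power2_le_imp_le)
  qed
  have "bounded_linear p"
    by (rule bounded_linear_intro[where K = 1])
      (use add scale bound in \<open>auto simp flip: scaleC_of_real\<close>)
  then have ap: "blinfun_apply (Blinfun p) = p" by (rule bounded_linear_Blinfun_apply)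
  have "orth_proj M = Blinfun p"
    unfolding orth_proj_def
  proof (rule the_equality)
    fix P :: "'a \<Rightarrow>\<^sub>L 'a" assume "\<forall>x. P x \<in> M \<and> x - P x \<in> orth_compl M"
    then show "P = Blinfun p" by (intro blinfun_eqI) (simp add: ap uniq)
  qed (simp add: ap p)
  then show ?thesis by (simp add: ap p cblin_def scale)
qed

lemma orth_proj_eqI:
  fixes M :: "'a::chilbert_space set"
  assumes "csubspace M" "closed M" "q \<in> M" "x - q \<in> orth_compl M"
  shows "orth_proj M x = q"
proof -
  note P = orth_proj_spec[OF assms(1,2)]
  have "q - orth_proj M x \<in> M" using P assms cvs.subspace_diff by blast
  moreover have "(x - orth_proj M x) - (x - q) \<in> orth_compl M"
    using P assms by (metis cvs.subspace_diff[OF csubspace_orth_compl])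
  ultimately show ?thesis using orth_compl_Int[of "q - orth_proj M x" M] by simp
qed

locale closed_csubspace =
  fixes M :: "'a::chilbert_space set"
  assumes csub: "csubspace M" and clo: "closed M"
begin

lemma orth_proj_cblin: "orth_proj M \<in> cblin"
  and orth_proj_in: "orth_proj M x \<in> M"
  and orth_proj_diff: "x - orth_proj M x \<in> orth_compl M"
  using orth_proj_spec[OF csub clo] by auto

lemma orth_proj_id: "x \<in> M \<Longrightarrow> orth_proj M x = x"
  by (rule orth_proj_eqI[OF csub clo]) (auto simp: cvs.subspace_0)

lemma orth_proj_id_iff: "orth_proj M x = x \<longleftrightarrow> x \<in> M"
  using orth_proj_id orth_proj_in by metis

lemma orth_proj_zero: "x \<in> orth_compl M \<Longrightarrow> orth_proj M x = 0"
  by (rule orth_proj_eqI[OF csub clo]) (auto simp: cvs.subspace_0 csub)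

lemma orth_proj_idem [simp]: "orth_proj M (orth_proj M x) = orth_proj M x"
  by (simp add: orth_proj_id orth_proj_in)

lemma cinner_orth_proj: "cinner (orth_proj M x) y = cinner x (orth_proj M y)"
proof -
  have "cinner (orth_proj M x) (y - orth_proj M y) = 0"
    using orth_proj_in orth_proj_diff by (auto simp: orth_compl_def)
  moreover have "cinner (x - orth_proj M x) (orth_proj M y) = 0"
    using orth_proj_in orth_proj_diff by (subst cinner_eq_0_commute) (auto simp: orth_compl_def)
  ultimately show ?thesis by (simp add: cinner_algebra)
qed

end

text \<open>For nonzero f, take w orthogonal to the kernel with f w nonzero. Then x - (f x / f w) w
  lies in the kernel, so pairing x with w computes f x up to a constant.\<close>

lemma riesz_representation:
  fixes f :: "'a::chilbert_space \<Rightarrow>\<^sub>L complex"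
  assumes "f \<in> cblin"
  shows "\<exists>z. \<forall>x. f x = cinner z x"
proof (cases "\<forall>x. f x = 0")
  case True then show ?thesis by (intro exI[of _ 0]) simp
next
  case False
  then obtain u where u: "f u \<noteq> 0" by blast
  have f: "f (c *\<^sub>C x) = c * f x" for c x
    using assms by (auto simp: cblin_def scaleC_complex_def)
  interpret closed_csubspace "{x. f x = 0}"
  proof
    show "closed {x. f x = 0}"
      by (intro closed_Collect_eq continuous_intros blinfun.continuous_on)
  qed (auto intro!: csubspaceI simp: f blinfun.add_right)
  define w where "w = u - orth_proj {x. f x = 0} u"
  have fw: "f w \<noteq> 0" using u orth_proj_in[of u] by (simp add: w_def blinfun.diff_right)
  have w: "cinner w x = 0" if "f x = 0" for x
    using orth_proj_diff[of u] that by (subst cinner_eq_0_commute) (auto simp: orth_compl_def w_def)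
  have "w \<noteq> 0" using fw by auto
  have "cinner w (x - (f x / f w) *\<^sub>C w) = 0" for x
    using fw by (intro w) (simp add: blinfun.diff_right f)
  then have "f x = cinner ((cnj (f w) / cinner w w) *\<^sub>C w) x" for x
    using fw \<open>w \<noteq> 0\<close> by (simp add: cinner_algebra cinner_self field_simps)
  then show ?thesis by blast
qed

section \<open>Adjoints of bounded complex-linear operators\<close>

lemma cblin_scaleC: "A \<in> cblin \<Longrightarrow> A (c *\<^sub>C x) = c *\<^sub>C A x"
  by (simp add: cblin_def)

lemma blinfun_scaleC_apply [simp]: "blinfun_apply (c *\<^sub>C A) x = c *\<^sub>C A x"
  by (simp add: scaleC_blinfun.rep_eq)

text \<open>Riesz representation of x \<mapsto> \<open>cinner y (A x)\<close>. The representing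
  vector \<open>g y\<close> is linear in y because inner products determine it, and testing with x =
  \<open>g y\<close> gives the bound by \<open>norm A\<close>.\<close>

lemma adjI_exists:
  fixes A :: "'a::chilbert_space \<Rightarrow>\<^sub>L 'b::complex_inner"
  assumes A: "A \<in> cblin"
  shows "\<exists>A'\<in>cblin. \<forall>x y. cinner (blinfun_apply A' y) x = cinner y (blinfun_apply A x)"
proof -
  have "\<exists>z. \<forall>x. cinner y (A x) = cinner z x" for y
  proof -
    have "bounded_linear (\<lambda>x. cinner y (A x))"
      by (intro bounded_linear_compose[OF bounded_bilinear.bounded_linear_right[OF bounded_bilinear_cinner]]
          blinfun.bounded_linear_right)
    then have ap: "blinfun_apply (Blinfun (\<lambda>x. cinner y (A x))) = (\<lambda>x. cinner y (A x))"
      by (rule bounded_linear_Blinfun_apply)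
    have "Blinfun (\<lambda>x. cinner y (A x)) \<in> cblin"
      by (simp add: cblin_def ap cblin_scaleC[OF A] cinner_scaleC_right scaleC_complex_def)
    from riesz_representation[OF this] show ?thesis by (simp add: ap)
  qed
  then obtain g where g: "\<And>x y. cinner y (A x) = cinner (g y) x" by metis
  have eq: "z = w" if "\<And>x. cinner z x = cinner w x" for z w :: 'a
    by (rule cinner_eqI, rule cinner_swap, rule that)
  have add: "g (x + y) = g x + g y" for x y
    by (rule eq) (simp add: g[symmetric] cinner_add_left)
  have scale: "g (c *\<^sub>C x) = c *\<^sub>C g x" for c x
    by (rule eq) (simp add: g[symmetric] cinner_scaleC_left)
  have bound: "norm (g y) \<le> norm y * norm A" for y
  proof (cases "g y = 0")
    case False
    have "(norm (g y))\<^sup>2 = cmod (cinner y (A (g y)))"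
      by (simp add: g cinner_self norm_power)
    also have "\<dots> \<le> norm y * norm (A (g y))" by (rule Cauchy_Schwarz_cinner)
    also have "\<dots> \<le> norm y * (norm A * norm (g y))" by (intro mult_left_mono norm_blinfun) auto
    finally show ?thesis using False by (simp add: power2_eq_square)
  qed simp
  have "bounded_linear g"
    by (rule bounded_linear_intro[where K = "norm A"])
      (use add scale bound in \<open>auto simp flip: scaleC_of_real\<close>)
  then have ap: "blinfun_apply (Blinfun g) = g" by (rule bounded_linear_Blinfun_apply)
  show ?thesis
    by (rule bexI[of _ "Blinfun g"]) (auto simp: ap g cblin_def scale)
qed

lemma adj_eqI:
  assumes "\<And>x y. cinner (blinfun_apply A' y) x = cinner y (blinfun_apply A x)"
  shows "adj A = A'"
  unfolding adj_def
proof (rule the_equality)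
  fix B assume "\<forall>x y. cinner (blinfun_apply B y) x = cinner y (A x)"
  then have "cinner (B y) x = cinner (A' y) x" for x y
    using assms by simp
  then have "cinner x (B y) = cinner x (A' y)" for x y
    by (rule cinner_swap)
  then show "B = A'" by (rule blinfun_eqI[OF cinner_eqI])
qed (use assms in blast)

lemma
  fixes A :: "'a::chilbert_space \<Rightarrow>\<^sub>L 'b::complex_inner"
  assumes A: "A \<in> cblin"
  shows adj_cblin: "adj A \<in> cblin"
    and cinner_adj_left: "cinner (adj A y) x = cinner y (A x)"
    and cinner_adj_right: "cinner x (adj A y) = cinner (A x) y"
proof -
  obtain A' where A': "A' \<in> cblin" "\<And>x y. cinner (blinfun_apply A' y) x = cinner y (blinfun_apply A x)"
    using adjI_exists[OF A] by blast
  have "adj A = A'" by (rule adj_eqI) (rule A')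
  then show "adj A \<in> cblin" and 1: "cinner (adj A y) x = cinner y (A x)" using A' by simp_all
  show "cinner x (adj A y) = cinner (A x) y" by (rule cinner_swap) (rule 1)
qed

lemma adj_adj: "A \<in> cblin \<Longrightarrow> adj (adj A) = A"
  for A :: "'a::chilbert_space \<Rightarrow>\<^sub>L 'b::complex_inner"
  by (rule adj_eqI) (simp add: cinner_adj_right)

lemma adj_compose:
  fixes A :: "'b::chilbert_space \<Rightarrow>\<^sub>L 'c::complex_inner" and B :: "'a::chilbert_space \<Rightarrow>\<^sub>L 'b"
  assumes "A \<in> cblin" "B \<in> cblin"
  shows "adj (A o\<^sub>L B) = adj B o\<^sub>L adj A"
  by (rule adj_eqI) (simp add: assms cinner_adj_left)

lemma adj_id [simp]: "adj id_blinfun = id_blinfun"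
  by (rule adj_eqI) simp

lemma norm_adj_le:
  fixes A :: "'a::chilbert_space \<Rightarrow>\<^sub>L 'b::complex_inner"
  assumes A: "A \<in> cblin"
  shows "norm (adj A) \<le> norm A"
proof (rule norm_blinfun_bound)
  fix y
  show "norm (adj A y) \<le> norm A * norm y"
  proof (cases "adj A y = 0")
    case False
    have "(norm (adj A y))\<^sup>2 = cmod (cinner y (A (adj A y)))"
      by (simp add: cinner_adj_left[OF A, symmetric] cinner_self norm_power)
    also have "\<dots> \<le> norm y * (norm A * norm (adj A y))"
      by (rule order_trans[OF Cauchy_Schwarz_cinner]) (intro mult_left_mono norm_blinfun norm_ge_zero)
    finally show ?thesis using False by (simp add: power2_eq_square mult_ac)
  qed simp
qed simp

lemma cblin_id [simp]: "id_blinfun \<in> cblin"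
  by (simp add: cblin_def)

lemma cblin_compose [simp]: "A \<in> cblin \<Longrightarrow> B \<in> cblin \<Longrightarrow> A o\<^sub>L B \<in> cblin"
  by (simp add: cblin_def)

lemma csubspace_cblin: "csubspace (cblin :: ('a::complex_normed_vector \<Rightarrow>\<^sub>L 'b::complex_normed_vector) set)"
  by (rule csubspaceI)
    (auto simp: cblin_def blinfun.add_left scaleC_add_right scaleC_scaleC mult.commute)

lemmas cblin_add [simp] = cvs.subspace_add[OF csubspace_cblin]
lemmas cblin_diff [simp] = cvs.subspace_diff[OF csubspace_cblin]
lemmas cblin_scale [simp] = cvs.subspace_scale[OF csubspace_cblin]
lemmas cblin_0 [simp] = cvs.subspace_0[OF csubspace_cblin]
lemmas cblin_sum = cvs.subspace_sum[OF csubspace_cblin]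

lemma cblin_scaleR [simp]: "A \<in> cblin \<Longrightarrow> r *\<^sub>R A \<in> cblin"
  by (simp flip: scaleC_of_real)

lemma closed_cblin: "closed (cblin :: ('a::complex_normed_vector \<Rightarrow>\<^sub>L 'b::complex_normed_vector) set)"
proof -
  have "cblin = (\<Inter>c. \<Inter>x. {A :: 'a \<Rightarrow>\<^sub>L 'b. A (c *\<^sub>C x) = c *\<^sub>C A x})"
    by (auto simp: cblin_def)
  also have "closed \<dots>"
    by (intro closed_INT ballI closed_Collect_eq continuous_intros)
  finally show ?thesis .
qed

lemma (in closed_csubspace) adj_orth_proj: "adj (orth_proj M) = orth_proj M"
  by (rule adj_eqI) (rule cinner_orth_proj)

lemma orth_proj_UNIV [simp]: "orth_proj (UNIV :: 'a::chilbert_space set) = id_blinfun"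
proof -
  interpret closed_csubspace "UNIV :: 'a set" by standard (auto intro: csubspaceI)
  show ?thesis by (rule blinfun_eqI) (simp add: orth_proj_id)
qed


section \<open>Square roots of operators\<close>

definition self_adjoint :: "('a::complex_inner \<Rightarrow>\<^sub>L 'a) \<Rightarrow> bool" where
  "self_adjoint A \<longleftrightarrow> A \<in> cblin \<and> (\<forall>x y. cinner (A x) y = cinner x (A y))"

lemma self_adjointD: "self_adjoint A \<Longrightarrow> cinner (A x) y = cinner x (A y)"
  by (simp add: self_adjoint_def)

lemma self_adjoint_cblin: "self_adjoint A \<Longrightarrow> A \<in> cblin"
  by (simp add: self_adjoint_def)

lemma self_adjoint_adj: "self_adjoint A \<Longrightarrow> adj A = A"
  by (rule adj_eqI) (simp add: self_adjointD)

lemma self_adjointI_adj: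
  fixes A :: "'a::chilbert_space \<Rightarrow>\<^sub>L 'a"
  shows "A \<in> cblin \<Longrightarrow> adj A = A \<Longrightarrow> self_adjoint A"
  using cinner_adj_left[of A] by (simp add: self_adjoint_def)

lemma self_adjoint_diff: "self_adjoint A \<Longrightarrow> self_adjoint B \<Longrightarrow> self_adjoint (A - B)"
  by (simp add: self_adjoint_def blinfun.diff_left cinner_algebra)

lemma self_adjoint_add: "self_adjoint A \<Longrightarrow> self_adjoint B \<Longrightarrow> self_adjoint (A + B)"
  by (simp add: self_adjoint_def blinfun.add_left cinner_algebra)

lemma self_adjoint_scaleR: "self_adjoint A \<Longrightarrow> self_adjoint (r *\<^sub>R A)"
  by (simp add: self_adjoint_def blinfun.scaleR_left cinner_algebra)

lemma self_adjoint_id: "self_adjoint id_blinfun"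
  by (simp add: self_adjoint_def)

lemma self_adjoint_square: "self_adjoint A \<Longrightarrow> self_adjoint (A o\<^sub>L A)"
  by (simp add: self_adjoint_def)

lemma closed_self_adjoint: "closed {A :: 'a::complex_inner \<Rightarrow>\<^sub>L 'a. self_adjoint A}"
proof -
  have "{A :: 'a \<Rightarrow>\<^sub>L 'a. self_adjoint A} =
      cblin \<inter> (\<Inter>x. \<Inter>y. {A. cinner (blinfun_apply A x) y = cinner x (A y)})"
    by (auto simp: self_adjoint_def)
  also have "closed \<dots>"
    by (intro closed_Int closed_cblin closed_INT ballI closed_Collect_eq continuous_intros)
  finally show ?thesis .
qed

lemma closed_commutant: "closed {A :: 'a::real_normed_vector \<Rightarrow>\<^sub>L 'a. A o\<^sub>L B = B o\<^sub>L A}"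
  by (intro closed_Collect_eq continuous_intros
      bounded_bilinear.continuous_on[OF bounded_bilinear_blinfun_compose])

lemma norm_blinfun_compose_le: "norm A \<le> a \<Longrightarrow> norm B \<le> b \<Longrightarrow> norm (A o\<^sub>L B) \<le> a * b"
  by (rule order_trans[OF norm_blinfun_compose]) (auto intro!: mult_mono intro: order_trans[OF norm_ge_zero])

text \<open>The iteration \<open>Y \<mapsto> (X + Y\<^sup>2) / 2\<close> produces polynomials in \<open>X\<close> with nonnegative coefficients,
  so that the increments are dominated by those of the bounded scalar iteration for \<open>X = 1\<close>.\<close>

lemma quadratic_fixed_point:
  fixes X :: "'a::banach \<Rightarrow>\<^sub>L 'a"
  assumes X: "norm X \<le> 1" and "closed S"
    and step: "\<And>Y. Y \<in> S \<Longrightarrow> (1/2) *\<^sub>R (X + (Y o\<^sub>L Y)) \<in> S" and zero: "0 \<in> S"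
  shows "\<exists>Y\<in>S. norm Y \<le> 1 \<and> 2 *\<^sub>R Y = X + (Y o\<^sub>L Y)"
proof -
  interpret comp: bounded_bilinear "(o\<^sub>L) :: ('a \<Rightarrow>\<^sub>L 'a) \<Rightarrow> ('a \<Rightarrow>\<^sub>L 'a) \<Rightarrow> _"
    by (rule bounded_bilinear_blinfun_compose)
  define Y where "Y n = ((\<lambda>Y. (1/2) *\<^sub>R (X + (Y o\<^sub>L Y))) ^^ n) 0" for n
  \<comment> \<open>The scalar iteration for X = 1 starts at 0 and increases within [0, 1]; it
    majorises both the norms and the increments of \<open>Y\<close>.\<close>
  define y :: "nat \<Rightarrow> real" where "y n = ((\<lambda>t. (1 + t\<^sup>2) / 2) ^^ n) 0" for n
  have Y0: "Y 0 = 0" and YS: "Y (Suc n) = (1/2) *\<^sub>R (X + (Y n o\<^sub>L Y n))" for n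
    by (simp_all add: Y_def)
  have y0: "y 0 = 0" and yS: "y (Suc n) = (1 + (y n)\<^sup>2) / 2" for n
    by (simp_all add: y_def)
  have y_bounds: "0 \<le> y n \<and> y n \<le> 1" for n
    by (induction n) (auto simp: y0 yS power_le_one)
  have Y_le: "norm (Y n) \<le> y n" for n
  proof (induction n)
    case (Suc n)
    have "norm (X + (Y n o\<^sub>L Y n)) \<le> 1 + y n * y n"
      using X norm_blinfun_compose_le[OF Suc Suc] norm_triangle_ineq[of X "Y n o\<^sub>L Y n"] by linarith
    then show ?case by (simp add: YS yS power2_eq_square)
  qed (simp add: Y0 y0)
  have inc: "norm (Y (Suc n) - Y n) \<le> y (Suc n) - y n" for n
  proof (induction n)
    case 0
    then show ?case using X by (simp add: YS Y0 yS y0)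
  next
    case (Suc n)
    have "Y (Suc (Suc n)) - Y (Suc n) =
        (1/2) *\<^sub>R (X + (Y (Suc n) o\<^sub>L Y (Suc n))) - (1/2) *\<^sub>R (X + (Y n o\<^sub>L Y n))"
      by (rule arg_cong2[where f = "(-)"]; rule YS)
    also have "\<dots> = (1/2) *\<^sub>R ((Y (Suc n) o\<^sub>L Y (Suc n)) - (Y n o\<^sub>L Y n))"
      by (simp flip: scaleR_right_diff_distrib)
    \<comment> \<open>This splitting needs no commutativity and matches the scalar identity a^2 -
      b^2 = a(a - b) + (a - b)b.\<close>
    also have "(Y (Suc n) o\<^sub>L Y (Suc n)) - (Y n o\<^sub>L Y n) =
        (Y (Suc n) o\<^sub>L (Y (Suc n) - Y n)) + ((Y (Suc n) - Y n) o\<^sub>L Y n)"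
      by (simp add: comp.diff_left comp.diff_right)
    finally have "norm (Y (Suc (Suc n)) - Y (Suc n)) =
        norm ((Y (Suc n) o\<^sub>L (Y (Suc n) - Y n)) + ((Y (Suc n) - Y n) o\<^sub>L Y n)) / 2"
      by simp
    also have "\<dots> \<le> (y (Suc n) * (y (Suc n) - y n) + (y (Suc n) - y n) * y n) / 2"
      using norm_triangle_ineq[of "Y (Suc n) o\<^sub>L (Y (Suc n) - Y n)" "(Y (Suc n) - Y n) o\<^sub>L Y n"]
        norm_blinfun_compose_le[OF Y_le[of "Suc n"] Suc] norm_blinfun_compose_le[OF Suc Y_le[of n]]
      by simp
    also have "\<dots> = (1 + (y (Suc n))\<^sup>2) / 2 - (1 + (y n)\<^sup>2) / 2"
      by (simp add: power2_eq_square field_simps)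
    also have "\<dots> = y (Suc (Suc n)) - y (Suc n)"
      by (rule arg_cong2[where f = "(-)"]; rule yS[symmetric])
    finally show ?case .
  qed
  have dist: "norm (Y (m + k) - Y m) \<le> y (m + k) - y m" for m k
  proof (induction k)
    case (Suc k)
    then show ?case
      using inc[of "m + k"] norm_triangle_ineq[of "Y (Suc (m + k)) - Y (m + k)" "Y (m + k) - Y m"]
      by simp
  qed simp
  have "incseq y"
    using order_trans[OF norm_ge_zero inc] by (intro incseq_SucI) simp
  then have "convergent y"
    using incseq_convergent[of y 1] y_bounds by (metis convergentI)
  then have "Cauchy y" by (rule convergent_Cauchy)
  have "Cauchy Y"
  proof (rule CauchyI)
    fix e :: real assume "e > 0"
    then obtain M where M: "\<And>m n. m \<ge> M \<Longrightarrow> n \<ge> M \<Longrightarrow> norm (y m - y n) < e / 2"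
      using CauchyD[OF \<open>Cauchy y\<close>, of "e / 2"] by auto
    have M': "norm (Y n - Y M) < e / 2" if "n \<ge> M" for n
      using dist[of M "n - M"] M[of n M] that abs_ge_self[of "y n - y M"] by simp
    have "norm (Y m - Y n) < e" if "m \<ge> M" "n \<ge> M" for m n
      using M'[OF that(1)] M'[OF that(2)] norm_triangle_ineq4[of "Y m - Y M" "Y n - Y M"] by simp
    then show "\<exists>M. \<forall>m\<ge>M. \<forall>n\<ge>M. norm (Y m - Y n) < e" by blast
  qed
  then obtain Z where Z: "Y \<longlonglongrightarrow> Z" using Cauchy_convergent convergent_def by blast
  \<comment> \<open>The closed set S carries the extra properties wanted of the limit:
    self-adjointness, together with commutation relations for square roots or with membership in an
    operator algebra for representations.\<close>
  have "Y n \<in> S" for n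
    by (induction n) (auto simp: Y0 YS zero intro: step)
  then have "Z \<in> S" using \<open>closed S\<close> Z closed_sequentially by blast
  moreover have "norm Z \<le> 1"
    by (rule LIMSEQ_le_const2[OF tendsto_norm[OF Z]]) (use order_trans[OF Y_le] y_bounds in blast)
  moreover have "2 *\<^sub>R Z = X + (Z o\<^sub>L Z)"
  proof -
    have "(\<lambda>n. Y (Suc n)) \<longlonglongrightarrow> (1/2) *\<^sub>R (X + (Z o\<^sub>L Z))"
      unfolding YS by (intro tendsto_intros comp.tendsto Z)
    then have "Z = (1/2) *\<^sub>R (X + (Z o\<^sub>L Z))"
      by (rule LIMSEQ_unique[OF LIMSEQ_Suc[OF Z]])
    from arg_cong[OF this, of "\<lambda>V. 2 *\<^sub>R V"] show ?thesis by simp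
  qed
  ultimately show ?thesis by blast
qed

section \<open>Operators controlled by their quadratic forms, and positive square roots\<close>

lemma cinner_self_adjoint_real:
  assumes "self_adjoint A"
  shows "cinner x (A x) \<in> \<real>"
  using cinner_commute[of x "A x"] self_adjointD[OF assms, of x x] by (simp add: complex_is_Real_iff complex_eq_iff)

text \<open>Polarisation turns the bound on the quadratic form into a bound on the real part of
  \<open>cinner y (A x)\<close>; choosing y parallel to A x recovers the norm of A x.\<close>

lemma self_adjoint_norm_le:
  assumes A: "self_adjoint A" and le: "\<And>x. \<bar>Re (cinner x (A x))\<bar> \<le> (norm x)\<^sup>2"
  shows "norm A \<le> 1"
proof (rule norm_blinfun_bound)
  fix x
  have "norm (A x) \<le> norm x"
  proof (cases "A x = 0")
    case False
    \<comment> \<open>This scaling makes \<open>norm y = norm x\<close>, so the parallelogram law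
      bounds the polarised form by 4 times the squared norm of x.\<close>
    define t where "t = norm x / norm (A x)"
    define y where "y = t *\<^sub>R A x"
    have ny: "norm y = norm x" using False by (simp add: y_def t_def)
    have "4 * Re (cinner y (A x)) = Re (cinner (x + y) (A (x + y))) - Re (cinner (x - y) (A (x - y)))"
    proof -
      have "Re (cinner x (A y)) = Re (cinner y (A x))"
        using self_adjointD[OF A, of x y] cinner_commute[of y "A x"] by simp
      then show ?thesis by (simp add: blinfun.add_right blinfun.diff_right cinner_algebra)
    qed
    also have "\<dots> \<le> (norm (x + y))\<^sup>2 + (norm (x - y))\<^sup>2"
      using le[of "x + y"] le[of "x - y"] by linarith
    also have "\<dots> = 4 * (norm x)\<^sup>2" by (simp add: parallelogram ny)
    finally have "Re (cinner y (A x)) \<le> (norm x)\<^sup>2" by simp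
    moreover have "Re (cinner y (A x)) = norm x * norm (A x)"
      using False by (simp add: y_def cinner_algebra cinner_self t_def power2_eq_square)
    ultimately show ?thesis
      using False by (cases "x = 0") (auto simp: power2_eq_square)
  qed simp
  then show "norm (A x) \<le> 1 * norm x" by simp
qed simp

text \<open>Complex scalars matter: polarising with v and with \<open>\<i> *\<^sub>C v\<close>
  separates the two terms, whereas a real skew operator has zero quadratic form.\<close>

lemma quadratic_form_zero:
  assumes A: "A \<in> cblin" and 0: "\<And>x. cinner x (A x) = 0"
  shows "A = 0"
proof (rule blinfun_eqI)
  fix x
  have eq: "cinner u (A v) + cinner v (A u) = 0" for u v
    using 0[of "u + v"] 0[of u] 0[of v] by (simp add: blinfun.add_right cinner_algebra add.commute)
  have "cinner u (A v) = 0" for u v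
    using eq[of u v] eq[of u "\<i> *\<^sub>C v"] by (simp add: cblin_scaleC[OF A] cinner_algebra)
  then show "A x = (0 :: 'a \<Rightarrow>\<^sub>L 'a) x" using cinner_self_eq_0[of "A x"] by simp
qed

lemma positive_op_self_adjoint:
  fixes A :: "'a::chilbert_space \<Rightarrow>\<^sub>L 'a"
  assumes "positive_op A"
  shows "self_adjoint A"
proof -
  have A: "A \<in> cblin" and real: "cnj (cinner x (A x)) = cinner x (A x)" for x
    using assms by (auto simp: positive_op_def complex_nonneg_Reals_iff complex_eq_iff)
  have "A - adj A = 0"
  proof (rule quadratic_form_zero)
    show "cinner x ((A - adj A) x) = 0" for x
      using real[of x] cinner_commute[of "A x" x]
      by (simp add: blinfun.diff_left cinner_algebra cinner_adj_right[OF A])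
  qed (simp add: A adj_cblin)
  then show ?thesis using A by (intro self_adjointI_adj) auto
qed

text \<open>The second assumption is the quadratic form of D^3, so D^3 = 0; self-adjointness then
  lowers the power twice. It is applied to the difference of two positive square roots.\<close>

lemma self_adjoint_cube_zero:
  assumes D: "self_adjoint D" and "\<And>x. cinner (D x) (D (D x)) = 0"
  shows "D = 0"
proof -
  have "D o\<^sub>L (D o\<^sub>L D) = 0"
    by (rule quadratic_form_zero)
      (use assms in \<open>auto simp: self_adjoint_cblin self_adjointD[OF D, symmetric]\<close>)
  then have D3: "D (D (D x)) = 0" for x by (metis blinfun_apply_blinfun_compose zero_blinfun.rep_eq)
  have "D (D x) = 0" for x
    using self_adjointD[OF D, of "D x" "D (D x)"] D3[of x] cinner_self_eq_0[of "D (D x)"] by simp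
  then have "D x = 0" for x
    using self_adjointD[OF D, of x "D x"] cinner_self_eq_0[of "D x"] by simp
  then show ?thesis by (intro blinfun_eqI) simp
qed

text \<open>With A = I - X and 2Y = X + Y^2, the operator I - Y is a root: its square is I - 2Y +
  Y^2 = I - X. The bound A \<le> I helps to give \<open>norm X \<le> 1\<close> for the iteration.
  Since \<open>op_sqrt\<close> is a \<open>THE\<close>, uniqueness has to be proved as well.\<close>

lemma
  fixes A :: "'a::chilbert_space \<Rightarrow>\<^sub>L 'a"
  assumes A: "positive_op A" and le: "positive_op (id_blinfun - A)"
  shows positive_op_sqrt: "positive_op (op_sqrt A)" "op_sqrt A o\<^sub>L op_sqrt A = A"
proof -
  define X where "X = id_blinfun - A"
  have sX: "self_adjoint X" using le positive_op_self_adjoint by (simp add: X_def)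
  have sA: "self_adjoint A" using A positive_op_self_adjoint by blast
  have nX: "norm X \<le> 1"
  proof (rule self_adjoint_norm_le[OF sX])
    fix x
    have "Re (cinner x (X x)) \<ge> 0" "Re (cinner x (A x)) \<ge> 0"
      using A le by (auto simp: positive_op_def X_def complex_nonneg_Reals_iff)
    moreover have "Re (cinner x (X x)) + Re (cinner x (A x)) = (norm x)\<^sup>2"
      by (simp add: X_def blinfun.diff_left cinner_algebra cinner_self)
    ultimately show "\<bar>Re (cinner x (X x))\<bar> \<le> (norm x)\<^sup>2" by linarith
  qed
  \<comment> \<open>Besides self-adjointness, S demands commutation with everything that commutes
    with X. Any other positive root commutes with its square A, hence with X, hence with Y;
    uniqueness rests on this.\<close>
  define S where "S = {Y. self_adjoint Y} \<inter> (\<Inter>B\<in>{B. B o\<^sub>L X = X o\<^sub>L B}. {Y. Y o\<^sub>L B = B o\<^sub>L Y})"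
  have "\<exists>Y\<in>S. norm Y \<le> 1 \<and> 2 *\<^sub>R Y = X + (Y o\<^sub>L Y)"
  proof (rule quadratic_fixed_point[OF nX])
    show "closed S" unfolding S_def
      by (intro closed_Int closed_INT ballI closed_self_adjoint closed_commutant)
    show "0 \<in> S" by (auto simp: S_def self_adjoint_def)
    fix Y assume Y: "Y \<in> S"
    have c: "Y (B x) = B (Y x)" "X (B x) = B (X x)" if "B o\<^sub>L X = X o\<^sub>L B" for B x
    proof -
      have "Y o\<^sub>L B = B o\<^sub>L Y" using Y that by (auto simp: S_def)
      then show "Y (B x) = B (Y x)" "X (B x) = B (X x)"
        using that by (metis blinfun_apply_blinfun_compose)+
    qed
    have "self_adjoint Y" using Y by (simp add: S_def)
    then have "self_adjoint ((1/2) *\<^sub>R (X + (Y o\<^sub>L Y)))"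
      by (intro self_adjoint_scaleR self_adjoint_add self_adjoint_square sX)
    moreover have "(1/2) *\<^sub>R (X + (Y o\<^sub>L Y)) o\<^sub>L B = B o\<^sub>L (1/2) *\<^sub>R (X + (Y o\<^sub>L Y))"
      if "B o\<^sub>L X = X o\<^sub>L B" for B
      by (rule blinfun_eqI)
        (simp add: blinfun.scaleR_left blinfun.add_left blinfun.scaleR_right blinfun.add_right c[OF that])
    ultimately show "(1/2) *\<^sub>R (X + (Y o\<^sub>L Y)) \<in> S" by (simp add: S_def)
  qed
  then obtain Y where Y: "Y \<in> S" "norm Y \<le> 1" "2 *\<^sub>R Y = X + (Y o\<^sub>L Y)" by blast
  have sY: "self_adjoint Y" using Y(1) by (simp add: S_def)
  define R where "R = id_blinfun - Y"
  have sR: "self_adjoint R" by (simp add: R_def self_adjoint_diff self_adjoint_id sY)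
  have pos: "positive_op R"
    unfolding positive_op_def
  proof (intro conjI allI)
    fix x
    have "Re (cinner x (Y x)) \<le> norm x * norm (Y x)"
      using Cauchy_Schwarz_cinner complex_Re_le_cmod order_trans by blast
    also have "\<dots> \<le> norm x * (1 * norm x)"
      using Y(2) by (intro mult_left_mono order_trans[OF norm_blinfun] mult_right_mono) auto
    finally have "Re (cinner x (R x)) \<ge> 0"
      by (simp add: R_def blinfun.diff_left cinner_algebra cinner_self power2_eq_square)
    then show "cinner x (R x) \<in> \<real>\<^sub>\<ge>\<^sub>0"
      using cinner_self_adjoint_real[OF sR, of x]
      by (simp add: complex_nonneg_Reals_iff complex_is_Real_iff)
  qed (use sR self_adjoint_cblin in blast)
  have RR: "R o\<^sub>L R = A"
  proof (rule blinfun_eqI)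
    fix x
    have "2 *\<^sub>R Y x = X x + Y (Y x)" using arg_cong[OF Y(3), of "\<lambda>B. blinfun_apply B x"]
      by (simp add: blinfun.scaleR_left blinfun.add_left)
    then show "(R o\<^sub>L R) x = A x"
      by (simp add: R_def X_def blinfun.diff_left blinfun.diff_right scaleR_2 algebra_simps)
  qed
  have uniq: "R' = R" if R': "positive_op R'" "R' o\<^sub>L R' = A" for R'
  proof -
    have sR': "self_adjoint R'" using R'(1) by (rule positive_op_self_adjoint)
    have "R' o\<^sub>L X = X o\<^sub>L R'"
      by (rule blinfun_eqI) (simp add: X_def R'(2)[symmetric] blinfun.diff_left blinfun.diff_right)
    then have "Y o\<^sub>L R' = R' o\<^sub>L Y" using Y(1) by (auto simp: S_def)
    then have "Y (R' x) = R' (Y x)" for x by (metis blinfun_apply_blinfun_compose)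
    then have comm: "R (R' x) = R' (R x)" for x
      by (simp add: R_def blinfun.diff_left blinfun.diff_right)
    define D where "D = R - R'"
    have sD: "self_adjoint D" by (simp add: D_def self_adjoint_diff sR sR')
    \<comment> \<open>R and R' commute and have the same square, so (R + R')D = 0; the two
      nonnegative forms at D x add up to 0, and both vanish.\<close>
    have "cinner (D x) (D (D x)) = 0" for x
    proof -
      have "R (R x) = R' (R' x)" using RR R'(2) by (metis blinfun_apply_blinfun_compose)
      then have "R (D x) + R' (D x) = 0"
        by (simp add: D_def blinfun.diff_left blinfun.diff_right comm)
      then have "cinner (D x) (R (D x)) + cinner (D x) (R' (D x)) = 0"
        by (simp flip: cinner_add_right)
      moreover have "cinner (D x) (R (D x)) \<in> \<real>\<^sub>\<ge>\<^sub>0" "cinner (D x) (R' (D x)) \<in> \<real>\<^sub>\<ge>\<^sub>0"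
        using pos R'(1) by (auto simp: positive_op_def)
      ultimately have "cinner (D x) (R (D x)) = 0 \<and> cinner (D x) (R' (D x)) = 0"
        by (simp add: complex_nonneg_Reals_iff complex_eq_iff)
      then show ?thesis by (simp add: D_def blinfun.diff_left cinner_algebra)
    qed
    from self_adjoint_cube_zero[OF sD this] show ?thesis by (simp add: D_def)
  qed
  have "op_sqrt A = R"
    unfolding op_sqrt_def by (rule the_equality, rule conjI[OF pos RR], elim conjE, rule uniq)
  then show "positive_op (op_sqrt A)" "op_sqrt A o\<^sub>L op_sqrt A = A" by (simp_all only: pos RR)
qed

text \<open>Automatic continuity: if \<open>2Y = A\<^sup>*A + Y\<^sup>2\<close>, then \<open>\<parallel>x\<parallel>\<^sup>2 - \<parallel>\<pi>(A)x\<parallel>\<^sup>2 = \<parallel>x - \<pi>(Y)x\<parallel>\<^sup>2\<close>.\<close>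

lemma star_representation_norm_le:
  fixes \<A> :: "('a::chilbert_space \<Rightarrow>\<^sub>L 'a) set"
    and \<pi> :: "('a \<Rightarrow>\<^sub>L 'a) \<Rightarrow> 'k::chilbert_space \<Rightarrow>\<^sub>L 'k"
  assumes \<A>: "\<A> \<subseteq> cblin" "closed \<A>" "csubspace \<A>" "adj ` \<A> \<subseteq> \<A>"
    and mult: "\<And>A B. A \<in> \<A> \<Longrightarrow> B \<in> \<A> \<Longrightarrow> A o\<^sub>L B \<in> \<A>"
    and \<pi>: "star_representation \<A> \<pi>" and A: "A \<in> \<A>"
  shows "norm (\<pi> A) \<le> norm A"
proof -
  have cb: "\<pi> B \<in> cblin" if "B \<in> \<A>" for B
    using that \<pi> by (auto simp: star_representation_def)
  have scale: "\<pi> (c *\<^sub>C B) = c *\<^sub>C \<pi> B" and star: "\<pi> (adj B) = adj (\<pi> B)" if "B \<in> \<A>" for c B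
    using that \<pi> by (auto simp: star_representation_def)
  have add: "\<pi> (B + C) = \<pi> B + \<pi> C" and comp: "\<pi> (B o\<^sub>L C) = \<pi> B o\<^sub>L \<pi> C"
    if "B \<in> \<A>" "C \<in> \<A>" for B C
    using that \<pi> by (auto simp: star_representation_def)
  have sc: "r *\<^sub>R B \<in> \<A>" if "B \<in> \<A>" for r B
    using that \<A>(3) cvs.subspace_scale by (metis scaleC_of_real)
  have le1: "norm (\<pi> B) \<le> 1" if B: "B \<in> \<A>" "norm B \<le> 1" for B
  proof -
    have Bc: "B \<in> cblin" using B \<A> by blast
    define X where "X = adj B o\<^sub>L B"
    have XA: "X \<in> \<A>" using B \<A> mult by (auto simp: X_def)
    have nX: "norm X \<le> 1"
      using norm_blinfun_compose_le[OF order_trans[OF norm_adj_le[OF Bc] B(2)] B(2)] by (simp add: X_def)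
    have sX: "self_adjoint X"
      by (rule self_adjointI_adj) (simp_all add: X_def Bc adj_cblin adj_compose adj_adj)
    \<comment> \<open>Y itself, unlike I - Y, stays in the algebra, which need not contain the
      identity; its equation has no constant term and so survives under \<pi>.\<close>
    have "\<exists>Y\<in>\<A> \<inter> {Y. self_adjoint Y}. norm Y \<le> 1 \<and> 2 *\<^sub>R Y = X + (Y o\<^sub>L Y)"
    proof (rule quadratic_fixed_point[OF nX])
      show "closed (\<A> \<inter> {Y. self_adjoint Y})"
        using \<A> closed_self_adjoint by blast
      show "0 \<in> \<A> \<inter> {Y. self_adjoint Y}"
        using \<A> cvs.subspace_0 by (auto simp: self_adjoint_def)
      show "(1/2) *\<^sub>R (X + (Y o\<^sub>L Y)) \<in> \<A> \<inter> {Y. self_adjoint Y}"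
        if "Y \<in> \<A> \<inter> {Y. self_adjoint Y}" for Y
        using that XA mult cvs.subspace_add[OF \<A>(3)]
        by (auto intro!: sc self_adjoint_scaleR self_adjoint_add self_adjoint_square sX)
    qed
    then obtain Y where Y: "Y \<in> \<A>" "self_adjoint Y" "2 *\<^sub>R Y = X + (Y o\<^sub>L Y)" by blast
    have eq: "2 *\<^sub>R \<pi> Y = (adj (\<pi> B) o\<^sub>L \<pi> B) + (\<pi> Y o\<^sub>L \<pi> Y)"
    proof -
      have "2 *\<^sub>R \<pi> Y = \<pi> (2 *\<^sub>R Y)" using add[OF Y(1) Y(1)] by (simp add: scaleR_2)
      also have "\<dots> = \<pi> X + \<pi> (Y o\<^sub>L Y)" unfolding Y(3) using XA Y mult by (intro add)
      also have "\<pi> X = adj (\<pi> B) o\<^sub>L \<pi> B"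
        unfolding X_def using B \<A> star comp by auto
      finally show ?thesis using Y comp by simp
    qed
    have sY: "self_adjoint (\<pi> Y)"
      using cb[OF Y(1)] star[OF Y(1)] self_adjoint_adj[OF Y(2)] by (simp add: self_adjointI_adj)
    show ?thesis
    proof (rule norm_blinfun_bound)
      fix x
      have e: "2 *\<^sub>R \<pi> Y x = adj (\<pi> B) (\<pi> B x) + \<pi> Y (\<pi> Y x)"
        using arg_cong[OF eq, of "\<lambda>A. blinfun_apply A x"] by (simp add: blinfun.scaleR_left blinfun.add_left)
      have "cinner x (2 *\<^sub>R \<pi> Y x) = cinner (\<pi> B x) (\<pi> B x) + cinner (\<pi> Y x) (\<pi> Y x)"
        unfolding e by (simp add: cinner_add_right cinner_adj_right[OF cb[OF B(1)]] self_adjointD[OF sY])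
      moreover have "cinner (\<pi> Y x) x = cinner x (\<pi> Y x)" by (rule self_adjointD[OF sY])
      ultimately have "cinner (x - \<pi> Y x) (x - \<pi> Y x) = cinner x x - cinner (\<pi> B x) (\<pi> B x)"
        by (simp add: cinner_algebra)
      then have "(norm (\<pi> B x))\<^sup>2 = (norm x)\<^sup>2 - (norm (x - \<pi> Y x))\<^sup>2"
        by (simp add: norm_sq_cinner)
      then show "norm (\<pi> B x) \<le> 1 * norm x"
        by (simp add: power2_le_imp_le)
    qed simp
  qed
  show ?thesis
  proof (cases "A = 0")
    case True
    have "\<pi> 0 = \<pi> 0 + \<pi> 0" using add[of 0 0] A True by simp
    then show ?thesis using True by simp
  next
    case False
    have "norm (\<pi> (inverse (norm A) *\<^sub>R A)) \<le> 1"
      using False by (intro le1 sc A) simp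
    also have "\<pi> (inverse (norm A) *\<^sub>R A) = inverse (norm A) *\<^sub>R \<pi> A"
      using scale[OF A, of "complex_of_real (inverse (norm A))"] by (simp only: scaleC_of_real)
    finally show ?thesis using False by (simp add: field_simps)
  qed
qed


section \<open>Operators between closed subspaces\<close>

lemma closed_csubspace_closure_cspan [simp]:
  "closed_csubspace (closure (cspan (S :: 'a::chilbert_space set)))"
  by (simp add: closed_csubspace_def)

lemma closed_csubspace_orth_compl [simp]: "closed_csubspace (orth_compl (S :: 'a::chilbert_space set))"
  by (simp add: closed_csubspace_def)

lemma closed_csubspace_UNIV [simp]: "closed_csubspace (UNIV :: 'a::chilbert_space set)"
  by (auto simp: closed_csubspace_def intro: csubspaceI)

lemma closed_csubspace_Times:
  assumes "closed_csubspace M" "closed_csubspace N"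
  shows "closed_csubspace (M \<times> N)"
proof -
  interpret M: closed_csubspace M by fact
  interpret N: closed_csubspace N by fact
  show ?thesis
    by standard (auto intro!: csubspaceI closed_Times M.clo N.clo
        simp: scaleC_prod_def zero_prod_def M.csub N.csub cvs.subspace_0 cvs.subspace_add cvs.subspace_scale)
qed

lemma bop_iff:
  assumes "closed_csubspace M" "closed_csubspace N"
  shows "A \<in> bop M N \<longleftrightarrow> A \<in> cblin \<and> (\<forall>x. A x \<in> N) \<and> (\<forall>x\<in>orth_compl M. A x = 0)"
proof -
  interpret M: closed_csubspace M by fact
  interpret N: closed_csubspace N by fact
  have "orth_proj N o\<^sub>L A o\<^sub>L orth_proj M = A \<longleftrightarrow> (\<forall>x. A x \<in> N) \<and> (\<forall>x\<in>orth_compl M. A x = 0)"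
  proof
    assume eq: "orth_proj N o\<^sub>L A o\<^sub>L orth_proj M = A"
    have *: "A x = orth_proj N (A (orth_proj M x))" for x
      using arg_cong[OF eq, of "\<lambda>B. blinfun_apply B x"] by simp
    show "(\<forall>x. A x \<in> N) \<and> (\<forall>x\<in>orth_compl M. A x = 0)"
    proof (intro conjI allI ballI)
      show "A x \<in> N" for x by (subst *) (rule N.orth_proj_in)
      show "A x = 0" if "x \<in> orth_compl M" for x by (subst *) (simp add: M.orth_proj_zero that)
    qed
  next
    assume R: "(\<forall>x. A x \<in> N) \<and> (\<forall>x\<in>orth_compl M. A x = 0)"
    show "orth_proj N o\<^sub>L A o\<^sub>L orth_proj M = A"
    proof (rule blinfun_eqI)
      fix x
      have "A (x - orth_proj M x) = 0" using R M.orth_proj_diff by blast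
      then show "(orth_proj N o\<^sub>L A o\<^sub>L orth_proj M) x = A x"
        using R by (simp add: N.orth_proj_id blinfun.diff_right)
    qed
  qed
  then show ?thesis by (auto simp: bop_def)
qed

lemma bop_apply_orth_proj:
  assumes "closed_csubspace M" "closed_csubspace N" "A \<in> bop M N"
  shows "A (orth_proj M x) = A x"
proof -
  interpret M: closed_csubspace M by fact
  have "A (x - orth_proj M x) = 0" using assms bop_iff M.orth_proj_diff by blast
  then show ?thesis by (simp add: blinfun.diff_right)
qed

lemma bop_eqI:
  fixes S :: "'a::chilbert_space set"
  assumes "closed_csubspace N" "A \<in> bop (closure (cspan S)) N" "B \<in> bop (closure (cspan S)) N"
    and "\<And>s. s \<in> S \<Longrightarrow> A s = B s"
  shows "A = B"
proof (rule blinfun_eqI)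
  fix x
  have "A y = B y" if "y \<in> closure (cspan S)" for y
    by (rule closure_cspan_eqI[OF assms(4) that])
      (use assms(2,3) in \<open>auto simp: blinfun.bounded_linear_right bop_def cblin_scaleC\<close>)
  from this[OF closed_csubspace.orth_proj_in[OF closed_csubspace_closure_cspan]]
  show "A x = B x"
    using bop_apply_orth_proj[OF closed_csubspace_closure_cspan assms(1)] assms(2,3) by metis
qed

lemma adj_bop:
  assumes M: "closed_csubspace M" "closed_csubspace N" and A: "A \<in> bop M N"
  shows "adj A \<in> bop N M"
proof -
  have A': "A \<in> cblin" "\<And>x. A x \<in> N" "\<And>x. x \<in> orth_compl M \<Longrightarrow> A x = 0"
    using A bop_iff[OF M] by auto
  interpret M: closed_csubspace M by fact
  have "adj A x = 0" if "x \<in> orth_compl N" for x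
    using that A'(2)[of "adj A x"] cinner_adj_right[OF A'(1), of "adj A x" x]
    by (simp add: orth_compl_def)
  moreover have "adj A x \<in> M" for x
  proof -
    \<comment> \<open>The component of \<open>adj A x\<close> orthogonal to M is killed by A, so its
      pairing with \<open>adj A x\<close> is 0; that pairing is its own squared norm.\<close>
    have "cinner (adj A x - orth_proj M (adj A x)) (adj A x) = cinner (A (adj A x - orth_proj M (adj A x))) x"
      by (rule cinner_adj_right[OF A'(1)])
    also have "A (adj A x - orth_proj M (adj A x)) = 0" by (intro A' M.orth_proj_diff)
    finally have "cinner (adj A x - orth_proj M (adj A x)) (adj A x - orth_proj M (adj A x)) = 0"
      using M.cinner_orth_proj[of "adj A x" "adj A x - orth_proj M (adj A x)"]
      by (simp add: cinner_diff_right cinner_diff_left blinfun.diff_right M.cinner_orth_proj)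
    then show ?thesis by (simp add: M.orth_proj_id_iff[symmetric])
  qed
  ultimately show ?thesis using bop_iff[OF M(2,1)] adj_cblin[OF A'(1)] by blast
qed

text \<open>An inverse supported on the right subspaces, together with preservation of inner
  products, forces \<open>adj U = U'\<close>, so the adjoint need not be computed
  separately.\<close>

lemma unitaryI:
  assumes M: "closed_csubspace M" "closed_csubspace N" and U: "U \<in> bop M N" and U': "U' \<in> bop N M"
    and inv: "\<And>x. x \<in> M \<Longrightarrow> U' (U x) = x" "\<And>y. y \<in> N \<Longrightarrow> U (U' y) = y"
    and iso: "\<And>x y. x \<in> M \<Longrightarrow> y \<in> M \<Longrightarrow> cinner (U x) (U y) = cinner x y"
  shows "unitary M N U"
proof -
  interpret M: closed_csubspace M by fact
  interpret N: closed_csubspace N by fact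
  have "U' x \<in> M" for x using U' bop_iff[OF M(2,1)] by blast
  have "U x \<in> N" for x using U bop_iff[OF M] by blast
  have "adj U = U'"
  proof (rule adj_eqI)
    fix x y
    have "cinner (U' y) x = cinner (U' y) (orth_proj M x)"
      using \<open>U' y \<in> M\<close> by (metis M.cinner_orth_proj M.orth_proj_id)
    also have "\<dots> = cinner (U (U' y)) (U (orth_proj M x))"
      using \<open>U' y \<in> M\<close> by (intro iso[symmetric] M.orth_proj_in)
    also have "U (U' y) = orth_proj N y"
      using inv(2)[OF N.orth_proj_in, of y] bop_apply_orth_proj[OF M(2,1) U', of y] by simp
    also have "U (orth_proj M x) = U x" by (rule bop_apply_orth_proj[OF M U])
    also have "cinner (orth_proj N y) (U x) = cinner y (U x)"
      using \<open>U x \<in> N\<close> by (simp add: N.cinner_orth_proj N.orth_proj_id)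
    finally show "cinner (U' y) x = cinner y (U x)" .
  qed
  moreover have "U' o\<^sub>L U = orth_proj M"
  proof (rule blinfun_eqI)
    show "(U' o\<^sub>L U) x = orth_proj M x" for x
      using inv(1)[OF M.orth_proj_in, of x] bop_apply_orth_proj[OF M U, of x] by simp
  qed
  moreover have "U o\<^sub>L U' = orth_proj N"
  proof (rule blinfun_eqI)
    show "(U o\<^sub>L U') x = orth_proj N x" for x
      using inv(2)[OF N.orth_proj_in, of x] bop_apply_orth_proj[OF M(2,1) U', of x] by simp
  qed
  ultimately show ?thesis using U by (simp add: unitary_def isometry_def)
qed

lemma
  assumes M: "closed_csubspace M" "closed_csubspace N" and U: "unitary M N U"
  shows unitary_cblin: "U \<in> cblin"
    and unitary_in: "U x \<in> N"
    and unitary_adj_apply: "adj U (U x) = orth_proj M x"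
    and unitary_apply_adj: "U (adj U y) = orth_proj N y"
    and unitary_adj: "unitary N M (adj U)"
proof -
  have bop: "U \<in> bop M N" using U by (simp add: unitary_def isometry_def)
  then show c: "U \<in> cblin" "U x \<in> N" using bop_iff[OF M] by blast+
  have 1: "adj U o\<^sub>L U = orth_proj M" "U o\<^sub>L adj U = orth_proj N"
    using U by (auto simp: unitary_def isometry_def)
  show "adj U (U x) = orth_proj M x" "U (adj U y) = orth_proj N y"
    using 1 by (metis blinfun_apply_blinfun_compose)+
  show "unitary N M (adj U)"
    using adj_bop[OF M bop] 1 by (simp add: unitary_def isometry_def adj_adj c)
qed

lemma fst_scaleC [simp]: "fst (c *\<^sub>C p) = c *\<^sub>C fst p" and snd_scaleC [simp]: "snd (c *\<^sub>C p) = c *\<^sub>C snd p"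
  by (simp_all add: scaleC_prod_def)

lemma csubspace_vimage_fst: "csubspace N \<Longrightarrow> csubspace (fst -` N)"
  and csubspace_vimage_snd: "csubspace N \<Longrightarrow> csubspace (snd -` N)"
  by (auto intro!: csubspaceI simp: cvs.subspace_0 cvs.subspace_add cvs.subspace_scale)

text \<open>The closure of the span of \<open>S\<close> is the graph of an operator on a closed subspace.\<close>

lemma graph_extension:
  fixes S :: "('a::chilbert_space \<times> 'b::chilbert_space) set"
  assumes C: "C \<ge> 0" and bound: "\<And>p. p \<in> cspan S \<Longrightarrow> norm (snd p) \<le> C * norm (fst p)"
  shows "\<exists>U\<in>bop (closure (cspan (fst ` S))) (closure (cspan (snd ` S))).
    (\<forall>p\<in>S. blinfun_apply U (fst p) = snd p) \<and> norm U \<le> C"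
proof -
  define G where "G = closure (cspan S)"
  define M where "M = fst ` G"
  have G: "csubspace G" "closed G" by (auto simp: G_def)
  have SG: "S \<subseteq> G" unfolding G_def by (rule closure_cspan_superset)
  have Gbound: "norm (snd p) \<le> C * norm (fst p)" if "p \<in> G" for p
  proof -
    have "closed {p :: 'a \<times> 'b. norm (snd p) \<le> C * norm (fst p)}"
      by (intro closed_Collect_le continuous_intros)
    then have "G \<subseteq> {p. norm (snd p) \<le> C * norm (fst p)}"
      unfolding G_def using bound by (intro closure_minimal) auto
    then show ?thesis using that by blast
  qed
  have Gsnd: "snd p \<in> closure (cspan (snd ` S))" if "p \<in> G" for p
  proof -
    have "G \<subseteq> snd -` closure (cspan (snd ` S))"
      unfolding G_def using closure_cspan_superset[of "snd ` S"]
      by (intro closure_cspan_minimal csubspace_vimage_snd closed_vimage_snd) auto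
    then show ?thesis using that by blast
  qed
  have csM: "csubspace M"
  proof (rule csubspaceI)
    show "0 \<in> M" using cvs.subspace_0[OF G(1)] by (force simp: M_def)
    show "x + y \<in> M" if "x \<in> M" "y \<in> M" for x y
      using that cvs.subspace_add[OF G(1)] by (force simp: M_def)
    show "c *\<^sub>C x \<in> M" if "x \<in> M" for c x
      using that cvs.subspace_scale[OF G(1), of _ c] by (force simp: M_def)
  qed
  \<comment> \<open>The bound controls second coordinates by first ones, so pairs over a convergent
    sequence of first coordinates are Cauchy, and their limit lies in the closed set G.\<close>
  have clM: "closed M"
    unfolding closed_sequential_limits
  proof (intro allI impI, elim conjE)
    fix x l assume "\<forall>n::nat. x n \<in> M" and lim: "x \<longlonglongrightarrow> l"
    then have "\<forall>n. \<exists>p\<in>G. x n = fst p" by (auto simp: M_def)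
    then obtain p where p: "\<And>n. p n \<in> G" "\<And>n. x n = fst (p n)" by metis
    have np: "norm (p m - p n) \<le> (1 + C) * norm (x m - x n)" for m n
    proof -
      have "p m - p n \<in> G" using p G cvs.subspace_diff by blast
      then have "norm (snd (p m - p n)) \<le> C * norm (x m - x n)"
        using Gbound[of "p m - p n"] by (simp add: p(2))
      then show ?thesis
        using norm_Pair_le[of "fst (p m - p n)" "snd (p m - p n)"] by (simp only: p(2) distrib_right fst_diff snd_diff prod.collapse mult_1 flip: diff_Pair)
    qed
    have "Cauchy p"
    proof (rule CauchyI)
      fix e :: real assume "e > 0"
      then obtain K where K: "\<And>m n. m \<ge> K \<Longrightarrow> n \<ge> K \<Longrightarrow> norm (x m - x n) < e / (1 + C)"
        using CauchyD[OF LIMSEQ_imp_Cauchy[OF lim], of "e / (1 + C)"] C by auto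
      have "norm (p m - p n) < e" if "m \<ge> K" "n \<ge> K" for m n
        using order_le_less_trans[OF np[of m n], of e] K[OF that] C by (simp add: field_simps)
      then show "\<exists>M. \<forall>m\<ge>M. \<forall>n\<ge>M. norm (p m - p n) < e" by blast
    qed
    then obtain q where q: "p \<longlonglongrightarrow> q" using Cauchy_convergent convergent_def by blast
    have "q \<in> G" using G(2) p(1) q closed_sequentially by blast
    moreover have "x = (\<lambda>n. fst (p n))" using p by blast
    then have "x \<longlonglongrightarrow> fst q" using tendsto_fst[OF q] by simp
    then have "l = fst q" using lim LIMSEQ_unique by blast
    ultimately show "l \<in> M" by (simp add: M_def)
  qed
  interpret M: closed_csubspace M by standard (use csM clM in auto)
  have Meq: "M = closure (cspan (fst ` S))"
  proof
    show "closure (cspan (fst ` S)) \<subseteq> M"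
      using SG csM clM by (intro closure_cspan_minimal) (auto simp: M_def)
    have "G \<subseteq> fst -` closure (cspan (fst ` S))"
      unfolding G_def using closure_cspan_superset[of "fst ` S"]
      by (intro closure_cspan_minimal csubspace_vimage_fst closed_vimage_fst) auto
    then show "M \<subseteq> closure (cspan (fst ` S))" by (auto simp: M_def)
  qed
  have "\<forall>x\<in>M. \<exists>y. (x, y) \<in> G" by (auto simp: M_def)
  then obtain g where g: "\<And>x. x \<in> M \<Longrightarrow> (x, g x) \<in> G" by metis
  \<comment> \<open>Single-valuedness: the bound applied to the pair (0, g x - y) forces its second
    entry to be 0.\<close>
  have uniq: "g x = y" if "(x, y) \<in> G" for x y
  proof -
    have "x \<in> M" using that by (force simp: M_def)
    from cvs.subspace_diff[OF G(1) g[OF this] that] Gbound[of "(0, g x - y)"]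
    show ?thesis by simp
  qed
  \<comment> \<open>Composing with the projection extends the operator by zero off M, as membership
    in \<open>bop\<close> requires.\<close>
  define u where "u x = g (orth_proj M x)" for x
  have Pu: "(orth_proj M x, u x) \<in> G" for x unfolding u_def by (intro g M.orth_proj_in)
  have add: "u (x + y) = u x + u y" for x y
    using cvs.subspace_add[OF G(1) Pu[of x] Pu[of y]]
    by (subst u_def) (auto intro!: uniq simp: blinfun.add_right)
  have scale: "u (c *\<^sub>C x) = c *\<^sub>C u x" for c x
    using cvs.subspace_scale[OF G(1) Pu[of x], of c]
    by (subst u_def) (auto intro!: uniq simp: cblin_scaleC[OF M.orth_proj_cblin] scaleC_prod_def)
  have ubound: "norm (u x) \<le> C * norm x" for x
  proof -
    have "norm (u x) \<le> C * norm (orth_proj M x)" using Gbound[OF Pu[of x]] by simp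
    moreover have "(norm (orth_proj M x + (x - orth_proj M x)))\<^sup>2 =
        (norm (orth_proj M x))\<^sup>2 + (norm (x - orth_proj M x))\<^sup>2"
      by (rule pythagoras) (use M.orth_proj_diff M.orth_proj_in in \<open>auto simp: orth_compl_def\<close>)
    then have "norm (orth_proj M x) \<le> norm x" by (simp add: power2_le_imp_le)
    ultimately show ?thesis using C mult_left_mono order_trans by blast
  qed
  have "bounded_linear u"
    by (rule bounded_linear_intro[where K = C])
      (use add scale ubound in \<open>auto simp: mult.commute simp flip: scaleC_of_real\<close>)
  then have ap: "blinfun_apply (Blinfun u) = u" by (rule bounded_linear_Blinfun_apply)
  show ?thesis
  proof (intro bexI[of _ "Blinfun u"] conjI ballI)
    show "norm (Blinfun u) \<le> C" by (rule norm_blinfun_bound) (simp_all add: C ap ubound)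
    show "Blinfun u (fst p) = snd p" if "p \<in> S" for p
    proof -
      have "p \<in> G" using that SG by blast
      then show ?thesis by (auto simp: ap u_def M_def M.orth_proj_id[unfolded M_def] intro!: uniq)
    qed
    have "g 0 = 0" using cvs.subspace_0[OF G(1)] by (intro uniq) (simp add: zero_prod_def)
    then have "\<forall>x\<in>orth_compl M. u x = 0" by (simp add: u_def M.orth_proj_zero)
    moreover have "u x \<in> closure (cspan (snd ` S))" for x using Gsnd[OF Pu[of x]] by simp
    ultimately show "Blinfun u \<in> bop (closure (cspan (fst ` S))) (closure (cspan (snd ` S)))"
      unfolding bop_iff[OF closed_csubspace_closure_cspan closed_csubspace_closure_cspan]
      by (simp add: ap cblin_def scale Meq)
  qed
qed

section \<open>Unitaries determined by the inner products of generators\<close>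

lemma cspan_sesquilinear:
  fixes b :: "'a::complex_normed_vector \<Rightarrow> 'a \<Rightarrow> complex"
  assumes add: "\<And>x y z. b (x + y) z = b x z + b y z" "\<And>x y z. b z (x + y) = b z x + b z y"
    and scale: "\<And>c x y. b (c *\<^sub>C x) y = cnj c * b x y" "\<And>c x y. b x (c *\<^sub>C y) = c * b x y"
    and S: "\<And>x y. x \<in> S \<Longrightarrow> y \<in> S \<Longrightarrow> b x y = 0"
    and xy: "x \<in> cspan S" "y \<in> cspan S"
  shows "b x y = 0"
proof -
  have 0: "b 0 z = 0" "b z 0 = 0" for z using add(1)[of 0 0 z] add(2)[of z 0 0] by simp_all
  have "csubspace {y. b x y = 0}" for x
    by (rule csubspaceI) (auto simp: add scale 0)
  then have "cspan S \<subseteq> {y. b x y = 0}" if "x \<in> S" for x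
    using that S by (intro cvs.span_minimal) auto
  moreover have "csubspace {x. b x y = 0}"
    by (rule csubspaceI) (auto simp: add scale 0)
  ultimately have "cspan S \<subseteq> {x. b x y = 0}"
    using xy by (intro cvs.span_minimal) auto
  then show ?thesis using xy by blast
qed

text \<open>Equal Gram matrices on S give equal norms of the two coordinates on the whole span of S,
  so the graph extension applies with constant 1; inner products are then carried to the closure one
  variable at a time.\<close>

lemma isometry_extension:
  fixes S :: "('a::chilbert_space \<times> 'b::chilbert_space) set"
  assumes eq: "\<And>p q. p \<in> S \<Longrightarrow> q \<in> S \<Longrightarrow> cinner (fst p) (fst q) = cinner (snd p) (snd q)"
  shows "\<exists>U\<in>bop (closure (cspan (fst ` S))) (closure (cspan (snd ` S))).
    (\<forall>p\<in>S. blinfun_apply U (fst p) = snd p) \<and>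
    (\<forall>x\<in>closure (cspan (fst ` S)). \<forall>y\<in>closure (cspan (fst ` S)). cinner (U x) (U y) = cinner x y)"
proof -
  \<comment> \<open>The difference of the two inner products is a single sesquilinear form on the
    product space that vanishes on S.\<close>
  have "cinner (fst p) (fst q) - cinner (snd p) (snd q) = 0" if "p \<in> cspan S" "q \<in> cspan S" for p q
    by (rule cspan_sesquilinear[OF _ _ _ _ _ that]) (auto simp: cinner_algebra eq algebra_simps)
  then have bound: "norm (snd p) \<le> 1 * norm (fst p)" if "p \<in> cspan S" for p
    using norm_eq_of_cinner_self[of "fst p" "snd p"] that by simp
  obtain U where U: "U \<in> bop (closure (cspan (fst ` S))) (closure (cspan (snd ` S)))"
    "\<And>p. p \<in> S \<Longrightarrow> blinfun_apply U (fst p) = snd p"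
    using graph_extension[OF zero_le_one bound] by blast
  have Uc: "U \<in> cblin" using U(1) by (simp add: bop_def)
  have **: "cinner (U x) (U y) = cinner x y" if xy: "x \<in> fst ` S" "y \<in> fst ` S" for x y
  proof -
    obtain p q where "p \<in> S" "q \<in> S" "x = fst p" "y = fst q" using xy by blast
    then show ?thesis by (simp add: U(2) eq)
  qed
  have *: "cinner (U x) (U y) = cinner x y" if "x \<in> fst ` S" "y \<in> closure (cspan (fst ` S))" for x y
  proof -
    have "closure (cspan (fst ` S)) \<subseteq> {y. cinner (U x) (U y) = cinner x y}"
      using that(1) by (intro closure_cspan_minimal csubspaceI closed_Collect_eq continuous_intros)
        (simp_all add: ** subset_iff cblin_scaleC[OF Uc] cinner_algebra blinfun.add_right)
    then show ?thesis using that by blast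
  qed
  have "cinner (U x) (U y) = cinner x y"
    if "x \<in> closure (cspan (fst ` S))" "y \<in> closure (cspan (fst ` S))" for x y
  proof -
    have "closure (cspan (fst ` S)) \<subseteq> {x. cinner (U x) (U y) = cinner x y}"
      using that(2) by (intro closure_cspan_minimal csubspaceI closed_Collect_eq continuous_intros)
        (simp_all add: * subset_iff cblin_scaleC[OF Uc] cinner_algebra blinfun.add_right)
    then show ?thesis using that by blast
  qed
  then show ?thesis using U by blast
qed

text \<open>Swapping the coordinates gives an isometry in the other direction, inverse to the first
  on generators and hence on the closed spans.\<close>

lemma unitary_extension:
  fixes S :: "('a::chilbert_space \<times> 'b::chilbert_space) set"
  assumes eq: "\<And>p q. p \<in> S \<Longrightarrow> q \<in> S \<Longrightarrow> cinner (fst p) (fst q) = cinner (snd p) (snd q)"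
  shows "\<exists>U. unitary (closure (cspan (fst ` S))) (closure (cspan (snd ` S))) U \<and>
    (\<forall>p\<in>S. blinfun_apply U (fst p) = snd p)"
proof -
  obtain U where U: "U \<in> bop (closure (cspan (fst ` S))) (closure (cspan (snd ` S)))"
    "\<And>p. p \<in> S \<Longrightarrow> blinfun_apply U (fst p) = snd p"
    "\<And>x y. x \<in> closure (cspan (fst ` S)) \<Longrightarrow> y \<in> closure (cspan (fst ` S)) \<Longrightarrow>
      cinner (U x) (U y) = cinner x y"
    using isometry_extension[of S, OF eq] by blast
  have sw: "fst ` prod.swap ` S = snd ` S" "snd ` prod.swap ` S = fst ` S" by force+
  have eq': "cinner (fst p) (fst q) = cinner (snd p) (snd q)"
    if "p \<in> prod.swap ` S" "q \<in> prod.swap ` S" for p q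
    using that eq by auto
  obtain U' where U': "U' \<in> bop (closure (cspan (snd ` S))) (closure (cspan (fst ` S)))"
    "\<And>p. p \<in> prod.swap ` S \<Longrightarrow> blinfun_apply U' (fst p) = snd p"
    using isometry_extension[of "prod.swap ` S", OF eq', unfolded sw] by blast
  have U'S: "U' (snd p) = fst p" if "p \<in> S" for p using U'(2)[of "prod.swap p"] that by simp
  have cb: "U' o\<^sub>L U \<in> cblin" "U o\<^sub>L U' \<in> cblin" using U U' by (auto simp: bop_def)
  have S: "U a = b \<and> U' b = a" if "(a, b) \<in> S" for a b
    using U(2)[of "(a, b)"] U'S[of "(a, b)"] that by simp
  have i1: "(U' o\<^sub>L U) x = id_blinfun x" if "x \<in> closure (cspan (fst ` S))" for x
    by (rule closure_cspan_eqI[OF _ that blinfun.bounded_linear_right blinfun.bounded_linear_right])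
      (use cblin_scaleC[OF cb(1)] in \<open>auto dest: S\<close>)
  have i2: "(U o\<^sub>L U') x = id_blinfun x" if "x \<in> closure (cspan (snd ` S))" for x
    by (rule closure_cspan_eqI[OF _ that blinfun.bounded_linear_right blinfun.bounded_linear_right])
      (use cblin_scaleC[OF cb(2)] in \<open>auto dest: S\<close>)
  have "unitary (closure (cspan (fst ` S))) (closure (cspan (snd ` S))) U"
    by (rule unitaryI[OF _ _ U(1) U'(1)]) (use i1 i2 in \<open>simp_all add: U(3)\<close>)
  then show ?thesis using U(2) by blast
qed


section \<open>Tensor products\<close>

lemma ell2_tensor_apply: "ell2_apply (\<xi> \<otimes>\<^sub>2 d) i = ell2_apply \<xi> i *\<^sub>C d"
  by (simp add: ell2_tensor.rep_eq)

lemma ell2_eqI: "(\<And>i. ell2_apply f i = ell2_apply g i) \<Longrightarrow> f = g"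
  by (simp add: ell2_apply_inject[symmetric] fun_eq_iff)

lemma ell2_tensor_add_left: "(\<xi> + \<eta>) \<otimes>\<^sub>2 d = \<xi> \<otimes>\<^sub>2 d + \<eta> \<otimes>\<^sub>2 d"
  by (rule ell2_eqI) (simp add: ell2_tensor_apply plus_ell2.rep_eq scaleC_add_left)

lemma ell2_tensor_add_right: "\<xi> \<otimes>\<^sub>2 (d + e) = \<xi> \<otimes>\<^sub>2 d + \<xi> \<otimes>\<^sub>2 e"
  by (rule ell2_eqI) (simp add: ell2_tensor_apply plus_ell2.rep_eq scaleC_add_right)

lemma ell2_tensor_scaleC_left: "(c *\<^sub>C \<xi>) \<otimes>\<^sub>2 d = c *\<^sub>C (\<xi> \<otimes>\<^sub>2 d)"
  by (rule ell2_eqI) (simp add: ell2_tensor_apply scaleC_ell2.rep_eq scaleC_scaleC scaleC_complex_def)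

lemma ell2_tensor_scaleC_right: "\<xi> \<otimes>\<^sub>2 (c *\<^sub>C d) = c *\<^sub>C (\<xi> \<otimes>\<^sub>2 d)"
  by (rule ell2_eqI) (simp add: ell2_tensor_apply scaleC_ell2.rep_eq scaleC_scaleC mult.commute)

lemma cinner_ell2_tensor: "cinner (\<xi> \<otimes>\<^sub>2 d) (\<eta> \<otimes>\<^sub>2 e) = cinner \<xi> \<eta> * cinner d e"
proof -
  have "cinner (\<xi> \<otimes>\<^sub>2 d) (\<eta> \<otimes>\<^sub>2 e) =
      (\<Sum>\<^sub>\<infinity>i. cinner (ell2_apply \<xi> i) (ell2_apply \<eta> i) * cinner d e)"
    by (simp add: cinner_ell2_def ell2_tensor_apply cinner_algebra cinner_complex_def mult_ac)
  also have "\<dots> = cinner \<xi> \<eta> * cinner d e"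
    by (subst infsum_cmult_left') (simp add: cinner_ell2_def)
  finally show ?thesis .
qed

lemma norm_ell2_tensor: "norm (\<xi> \<otimes>\<^sub>2 d) = norm \<xi> * norm (d :: 'a::complex_inner)"
proof -
  have "(norm (\<xi> \<otimes>\<^sub>2 d))\<^sup>2 = (norm \<xi> * norm d)\<^sup>2"
    using cinner_ell2_tensor[of \<xi> d \<xi> d]
    unfolding cinner_self of_real_mult[symmetric] of_real_eq_iff by (simp add: power_mult_distrib)
  then show ?thesis by (metis mult_nonneg_nonneg norm_ge_zero power2_eq_imp_eq)
qed

lemma bounded_linear_ell2_tensor_left: "bounded_linear (\<lambda>\<xi>. \<xi> \<otimes>\<^sub>2 (d :: 'a::complex_inner))"
  by (rule bounded_linear_intro[where K = "norm d"])
    (simp_all add: ell2_tensor_add_left norm_ell2_tensor ell2_tensor_scaleC_left flip: scaleC_of_real)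

lemma bounded_linear_ell2_tensor_right: "bounded_linear (\<lambda>d :: 'a::complex_inner. \<xi> \<otimes>\<^sub>2 d)"
  by (rule bounded_linear_intro[where K = "norm \<xi>"])
    (simp_all add: ell2_tensor_add_right norm_ell2_tensor ell2_tensor_scaleC_right mult.commute
      flip: scaleC_of_real)

lemma closed_csubspace_tensor_space [simp]:
  "closed_csubspace (tensor_space N (D :: 'a::chilbert_space set))"
  by (simp add: tensor_space_def)

lemma ell2_tensor_in_tensor_space: "\<xi> \<in> N \<Longrightarrow> d \<in> D \<Longrightarrow> \<xi> \<otimes>\<^sub>2 d \<in> tensor_space N D"
  unfolding tensor_space_def by (rule closure_cspan_superset[THEN subsetD]) blast

text \<open>With \<open>R\<^sup>2 = 1 - A\<^sup>*A\<close>, the form \<open>\<parallel>x\<parallel>\<^sup>2 - \<parallel>(A \<otimes> 1)x\<parallel>\<^sup>2\<close> on finite sums of elementary tensors is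
  \<open>\<parallel>(R \<otimes> 1)x\<parallel>\<^sup>2\<close>.\<close>

lemma contraction_tensor_bound:
  fixes A :: "('i, complex) ell2 \<Rightarrow>\<^sub>L ('i, complex) ell2" and D :: "'a::chilbert_space set"
  assumes A: "A \<in> cblin" "norm A \<le> 1"
    and p: "p \<in> cspan {(\<xi> \<otimes>\<^sub>2 d, A \<xi> \<otimes>\<^sub>2 d) |\<xi> d. \<xi> \<in> N \<and> d \<in> D}"
  shows "norm (snd p) \<le> norm (fst p)"
proof -
  define X where "X = adj A o\<^sub>L A"
  define R where "R = op_sqrt (id_blinfun - X)"
  have X: "cinner x (X y) = cinner (A x) (A y)" for x y
    by (simp add: X_def cinner_adj_right A)
  have Xc: "X \<in> cblin" by (simp add: X_def A adj_cblin)
  have nA: "norm (A x) \<le> norm x" for x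
    using norm_blinfun[of A x] mult_right_mono[OF A(2) norm_ge_zero[of x]] by simp
  have "positive_op (id_blinfun - X)"
    unfolding positive_op_def
  proof (intro conjI allI)
    fix x
    have "cinner x ((id_blinfun - X) x) = complex_of_real ((norm x)\<^sup>2 - (norm (A x))\<^sup>2)"
      by (simp add: blinfun.diff_left cinner_algebra X cinner_self)
    then show "cinner x ((id_blinfun - X) x) \<in> \<real>\<^sub>\<ge>\<^sub>0"
      using nA[of x] by (simp add: complex_nonneg_Reals_iff power_mono)
  qed (simp add: Xc)
  \<comment> \<open>\<open>positive_op_sqrt\<close> asks for an operator between 0 and I; the upper
    bound is positivity of X.\<close>
  moreover have "positive_op (id_blinfun - (id_blinfun - X))"
    by (simp add: positive_op_def Xc X cinner_self complex_nonneg_Reals_iff)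
  ultimately have R: "positive_op R" "R o\<^sub>L R = id_blinfun - X"
    using positive_op_sqrt[of "id_blinfun - X"] by (simp_all add: R_def)
  have sR: "self_adjoint R" by (rule positive_op_self_adjoint[OF R(1)])
  have RA: "cinner x y = cinner (A x) (A y) + cinner (R x) (R y)" for x y
  proof -
    have "cinner (R x) (R y) = cinner x ((R o\<^sub>L R) y)" by (simp add: self_adjointD[OF sR])
    then show ?thesis by (simp add: R(2) blinfun.diff_left cinner_algebra X)
  qed
  define S where "S = {((\<xi> \<otimes>\<^sub>2 d, A \<xi> \<otimes>\<^sub>2 d), R \<xi> \<otimes>\<^sub>2 d) |\<xi> d. \<xi> \<in> N \<and> d \<in> D}"
  have S0: "cinner (fst (fst q)) (fst (fst r)) - cinner (snd (fst q)) (snd (fst r)) - cinner (snd q) (snd r) = 0"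
    if "q \<in> S" "r \<in> S" for q r
  proof -
    from that obtain \<xi> d \<eta> e where "q = ((\<xi> \<otimes>\<^sub>2 d, A \<xi> \<otimes>\<^sub>2 d), R \<xi> \<otimes>\<^sub>2 d)"
      "r = ((\<eta> \<otimes>\<^sub>2 e, A \<eta> \<otimes>\<^sub>2 e), R \<eta> \<otimes>\<^sub>2 e)" unfolding S_def by blast
    then show ?thesis by (simp add: cinner_ell2_tensor RA[of \<xi> \<eta>] algebra_simps)
  qed
  have eq: "cinner (fst (fst q)) (fst (fst r)) - cinner (snd (fst q)) (snd (fst r)) - cinner (snd q) (snd r) = 0"
    if "q \<in> cspan S" "r \<in> cspan S" for q r
    by (rule cspan_sesquilinear[where b = "\<lambda>q r. cinner (fst (fst q)) (fst (fst r)) -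
          cinner (snd (fst q)) (snd (fst r)) - cinner (snd q) (snd r)", OF _ _ _ _ S0 that])
      (simp_all add: cinner_algebra algebra_simps)
  \<comment> \<open>An element p of the span of pairs is lifted to an element of
    \<open>cspan S\<close>, whose last entry plays the role of (R \<otimes> I)x; no representation
    of p as a finite sum has to be chosen.\<close>
  have cs: "csubspace (fst ` cspan S)"
  proof (rule csubspaceI)
    show "0 \<in> fst ` cspan S" using cvs.span_zero[of S] by force
    show "x + y \<in> fst ` cspan S" if "x \<in> fst ` cspan S" "y \<in> fst ` cspan S" for x y
      using that cvs.span_add[of _ S] by (metis (no_types, lifting) fst_add image_iff)
    show "c *\<^sub>C x \<in> fst ` cspan S" if "x \<in> fst ` cspan S" for c x
      using that cvs.span_scale[of _ S c] by (metis (no_types, lifting) fst_scaleC image_iff)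
  qed
  have "cspan {(\<xi> \<otimes>\<^sub>2 d, A \<xi> \<otimes>\<^sub>2 d) |\<xi> d. \<xi> \<in> N \<and> d \<in> D} \<subseteq> fst ` cspan S"
  proof (rule cvs.span_minimal[OF _ cs], clarify)
    fix \<xi> d assume "\<xi> \<in> N" "d \<in> D"
    then have "((\<xi> \<otimes>\<^sub>2 d, A \<xi> \<otimes>\<^sub>2 d), R \<xi> \<otimes>\<^sub>2 d) \<in> cspan S"
      by (intro cvs.span_base) (auto simp: S_def)
    then show "(\<xi> \<otimes>\<^sub>2 d, A \<xi> \<otimes>\<^sub>2 d) \<in> fst ` cspan S" by force
  qed
  then obtain q where q: "q \<in> cspan S" "p = fst q" using p by blast
  have "(norm (fst p))\<^sup>2 - (norm (snd p))\<^sup>2 - (norm (snd q))\<^sup>2 = 0"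
    using arg_cong[OF eq[OF q(1) q(1)], of Re] by (simp add: norm_sq_cinner q(2))
  then have "(norm (snd p))\<^sup>2 \<le> (norm (fst p))\<^sup>2" using zero_le_power2[of "norm (snd q)"] by linarith
  then show ?thesis by (rule power2_le_imp_le) simp
qed

text \<open>A is scaled to a contraction, so that \<open>contraction_tensor_bound\<close> makes the
  pairs of elementary tensors generate a bounded graph; scaling back gives A \<otimes> I.\<close>

lemma tensor_id_exists:
  fixes A :: "('i, complex) ell2 \<Rightarrow>\<^sub>L ('i, complex) ell2" and D :: "'a::chilbert_space set"
  assumes N: "closed_csubspace N" and A: "A \<in> bop N N"
  shows "\<exists>X\<in>bop (tensor_space N D) (tensor_space N D). \<forall>\<xi>\<in>N. \<forall>d\<in>D. blinfun_apply X (\<xi> \<otimes>\<^sub>2 d) = A \<xi> \<otimes>\<^sub>2 d"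
proof -
  \<comment> \<open>The maximum with 1 keeps c positive when A = 0.\<close>
  define c where "c = max 1 (norm A)"
  have c: "c > 0" by (simp add: c_def)
  define B where "B = inverse c *\<^sub>R A"
  have A': "A \<in> cblin" "\<And>x. A x \<in> N" using A bop_iff[OF N N] by auto
  then have B: "B \<in> cblin" by (simp add: B_def)
  have nB: "norm B \<le> 1" using c by (simp add: B_def c_def field_simps)
  define S where "S = {(\<xi> \<otimes>\<^sub>2 d, B \<xi> \<otimes>\<^sub>2 d) |\<xi> d. \<xi> \<in> N \<and> d \<in> D}"
  have bound: "norm (snd p) \<le> 1 * norm (fst p)" if "p \<in> cspan S" for p
    using contraction_tensor_bound[OF B nB that[unfolded S_def]] by simp
  obtain U where U: "U \<in> bop (closure (cspan (fst ` S))) (closure (cspan (snd ` S)))"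
    "\<And>p. p \<in> S \<Longrightarrow> blinfun_apply U (fst p) = snd p"
    using graph_extension[OF zero_le_one bound] by blast
  have "fst ` S = {\<xi> \<otimes>\<^sub>2 d |\<xi> d. \<xi> \<in> N \<and> d \<in> D}" by (force simp: S_def)
  then have dom: "closure (cspan (fst ` S)) = tensor_space N D" by (simp add: tensor_space_def)
  interpret N: closed_csubspace N by fact
  have "B x \<in> N" for x
    using cvs.subspace_scale[OF N.csub A'(2), of "of_real (inverse c)" x]
    unfolding scaleC_of_real B_def by (simp add: blinfun.scaleR_left)
  then have "snd ` S \<subseteq> tensor_space N D"
    by (auto simp: S_def intro!: ell2_tensor_in_tensor_space)
  then have ran: "closure (cspan (snd ` S)) \<subseteq> tensor_space N D"
    using closed_csubspace_tensor_space[of N D]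
    by (intro closure_cspan_minimal) (auto simp: closed_csubspace_def)
  have U': "U \<in> cblin" "\<And>x. U x \<in> tensor_space N D" "\<And>x. x \<in> orth_compl (tensor_space N D) \<Longrightarrow> U x = 0"
    using U(1) ran unfolding dom
    by (auto simp: bop_iff[OF closed_csubspace_tensor_space closed_csubspace_closure_cspan])
  have "c *\<^sub>R U \<in> bop (tensor_space N D) (tensor_space N D)"
    using U' closed_csubspace_tensor_space[of N D]
    by (auto simp: bop_iff blinfun.scaleR_left closed_csubspace_def
        intro!: cvs.subspace_scale[where c = "of_real c", unfolded scaleC_of_real])
  moreover have "(c *\<^sub>R U) (\<xi> \<otimes>\<^sub>2 d) = A \<xi> \<otimes>\<^sub>2 d" if "\<xi> \<in> N" "d \<in> D" for \<xi> d
  proof -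
    have "U (\<xi> \<otimes>\<^sub>2 d) = B \<xi> \<otimes>\<^sub>2 d"
      using U(2)[of "(\<xi> \<otimes>\<^sub>2 d, B \<xi> \<otimes>\<^sub>2 d)"] that by (auto simp: S_def)
    also have "\<dots> = inverse c *\<^sub>R (A \<xi> \<otimes>\<^sub>2 d)"
      unfolding B_def blinfun.scaleR_left
      by (simp add: ell2_tensor_scaleC_left flip: scaleC_of_real)
    finally show ?thesis using c by (simp add: blinfun.scaleR_left)
  qed
  ultimately show ?thesis by blast
qed

lemma tensor_bop_eqI:
  fixes D :: "'a::chilbert_space set"
  assumes "X \<in> bop (tensor_space N D) (tensor_space N D)" "Y \<in> bop (tensor_space N D) (tensor_space N D)"
    and "\<And>\<xi> d. \<xi> \<in> N \<Longrightarrow> d \<in> D \<Longrightarrow> blinfun_apply X (\<xi> \<otimes>\<^sub>2 d) = Y (\<xi> \<otimes>\<^sub>2 d)"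
  shows "X = Y"
  using assms(1,2) unfolding tensor_space_def
  by (rule bop_eqI[OF closed_csubspace_closure_cspan]) (use assms(3) in blast)

lemma
  fixes A :: "('i, complex) ell2 \<Rightarrow>\<^sub>L ('i, complex) ell2" and D :: "'a::chilbert_space set"
  assumes N: "closed_csubspace N" and A: "A \<in> bop N N"
  shows tensor_id_bop: "tensor_id N D A \<in> bop (tensor_space N D) (tensor_space N D)"
    and tensor_id_tensor: "\<xi> \<in> N \<Longrightarrow> d \<in> D \<Longrightarrow> tensor_id N D A (\<xi> \<otimes>\<^sub>2 d) = A \<xi> \<otimes>\<^sub>2 d"
proof -
  obtain X where X: "X \<in> bop (tensor_space N D) (tensor_space N D)"
    "\<And>\<xi> d. \<xi> \<in> N \<Longrightarrow> d \<in> D \<Longrightarrow> blinfun_apply X (\<xi> \<otimes>\<^sub>2 d) = A \<xi> \<otimes>\<^sub>2 d"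
    using tensor_id_exists[OF assms, of D] by blast
  have "tensor_id N D A = X"
    unfolding tensor_id_def
  proof (rule the_equality)
    fix Y assume "Y \<in> bop (tensor_space N D) (tensor_space N D) \<and>
      (\<forall>\<xi>\<in>N. \<forall>d\<in>D. blinfun_apply Y (\<xi> \<otimes>\<^sub>2 d) = A \<xi> \<otimes>\<^sub>2 d)"
    then show "Y = X" using X by (intro tensor_bop_eqI[where X = Y]) auto
  qed (use X in blast)
  then show "tensor_id N D A \<in> bop (tensor_space N D) (tensor_space N D)"
    "\<xi> \<in> N \<Longrightarrow> d \<in> D \<Longrightarrow> tensor_id N D A (\<xi> \<otimes>\<^sub>2 d) = A \<xi> \<otimes>\<^sub>2 d"
    using X by auto
qed

section \<open>Operators supported on closed subspaces, and A \<mapsto> A \<otimes> I as a star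
  representation\<close>

lemma bop_cblin: "A \<in> bop M N \<Longrightarrow> A \<in> cblin"
  by (simp add: bop_def)

lemma bop_add: "closed_csubspace M \<Longrightarrow> closed_csubspace N \<Longrightarrow> A \<in> bop M N \<Longrightarrow> B \<in> bop M N \<Longrightarrow> A + B \<in> bop M N"
  by (auto simp: bop_iff blinfun.add_left closed_csubspace_def cvs.subspace_add)

lemma bop_scaleC: "closed_csubspace M \<Longrightarrow> closed_csubspace N \<Longrightarrow> A \<in> bop M N \<Longrightarrow> c *\<^sub>C A \<in> bop M N"
  by (auto simp: bop_iff closed_csubspace_def cvs.subspace_scale)

lemma bop_zero: "closed_csubspace M \<Longrightarrow> closed_csubspace N \<Longrightarrow> 0 \<in> bop M N"
  by (auto simp: bop_iff closed_csubspace_def cvs.subspace_0)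

lemma bop_compose:
  "closed_csubspace L \<Longrightarrow> closed_csubspace M \<Longrightarrow> closed_csubspace N \<Longrightarrow> A \<in> bop M N \<Longrightarrow> B \<in> bop L M \<Longrightarrow> A o\<^sub>L B \<in> bop L N"
  by (auto simp: bop_iff)

lemma csubspace_bop: "closed_csubspace M \<Longrightarrow> closed_csubspace N \<Longrightarrow> csubspace (bop M N)"
  by (intro csubspaceI bop_add bop_scaleC bop_zero)

lemma closed_bop:
  assumes "closed_csubspace M" "closed_csubspace N"
  shows "closed (bop M N)"
proof -
  interpret comp: bounded_bilinear "(o\<^sub>L)" by (rule bounded_bilinear_blinfun_compose)
  have "bop M N = cblin \<inter> {A. orth_proj N o\<^sub>L A o\<^sub>L orth_proj M = A}" by (auto simp: bop_def)
  also have "closed \<dots>"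
    by (intro closed_Int closed_cblin closed_Collect_eq continuous_intros comp.continuous_on
        bounded_bilinear.continuous_on[OF bounded_bilinear_blinfun_compose])
  finally show ?thesis .
qed

lemma orth_proj_bop: "closed_csubspace M \<Longrightarrow> orth_proj M \<in> bop M M"
  using closed_csubspace.orth_proj_cblin closed_csubspace.orth_proj_in closed_csubspace.orth_proj_zero
  by (auto simp: bop_iff)

text \<open>An operator of \<open>bop\<close> on the tensor space is determined by its values on
  elementary tensors, and each identity is reduced to these. Together they make A \<mapsto> A
  \<otimes> I a unital star representation of \<open>bop N N\<close>.\<close>

lemma
  fixes D :: "'a::chilbert_space set"
  assumes N: "closed_csubspace N" and A: "A \<in> bop N N"
  shows tensor_id_compose: "B \<in> bop N N \<Longrightarrow> tensor_id N D (A o\<^sub>L B) = tensor_id N D A o\<^sub>L tensor_id N D B"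
    and tensor_id_add: "B \<in> bop N N \<Longrightarrow> tensor_id N D (A + B) = tensor_id N D A + tensor_id N D B"
    and tensor_id_scaleC: "tensor_id N D (c *\<^sub>C A) = c *\<^sub>C tensor_id N D A"
    and tensor_id_adj: "tensor_id N D (adj A) = adj (tensor_id N D A)"
    and tensor_id_orth_proj: "tensor_id N D (orth_proj N) = orth_proj (tensor_space N D)"
proof -
  note t = tensor_id_bop[OF N] and T = closed_csubspace_tensor_space[of N D]
  note b = bop_compose[OF N N N] bop_compose[OF T T T] bop_add[OF N N] bop_add[OF T T]
    bop_scaleC[OF N N] bop_scaleC[OF T T] adj_bop[OF N N] adj_bop[OF T T]
    orth_proj_bop[OF N] orth_proj_bop[OF T] t
  note v = tensor_id_tensor[OF N]
  have AN: "A x \<in> N" if "A \<in> bop N N" for A x using that bop_iff[OF N N] by blast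
  show "tensor_id N D (A o\<^sub>L B) = tensor_id N D A o\<^sub>L tensor_id N D B" if B: "B \<in> bop N N"
    by (rule tensor_bop_eqI[where N = N and D = D]) (simp_all add: b A B v AN)
  show "tensor_id N D (A + B) = tensor_id N D A + tensor_id N D B" if B: "B \<in> bop N N"
    by (rule tensor_bop_eqI[where N = N and D = D]) (simp_all add: b A B v blinfun.add_left ell2_tensor_add_left)
  show "tensor_id N D (c *\<^sub>C A) = c *\<^sub>C tensor_id N D A"
    by (rule tensor_bop_eqI[where N = N and D = D]) (simp_all add: b A v ell2_tensor_scaleC_left)
  show "tensor_id N D (orth_proj N) = orth_proj (tensor_space N D)"
    by (rule tensor_bop_eqI[where N = N and D = D]) (simp_all add: b v closed_csubspace.orth_proj_id[OF N]
        closed_csubspace.orth_proj_id[OF T] ell2_tensor_in_tensor_space)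
  have c: "A \<in> cblin" "tensor_id N D A \<in> cblin" "tensor_id N D (adj A) \<in> cblin"
    using bop_cblin[OF A] bop_cblin[OF t[OF A]] bop_cblin[OF t[OF adj_bop[OF N N A]]] by blast+
  define t t' where "t = tensor_id N D A" and "t' = tensor_id N D (adj A)"
  have tb: "t \<in> bop (tensor_space N D) (tensor_space N D)" "t' \<in> bop (tensor_space N D) (tensor_space N D)"
    by (simp_all add: t_def t'_def b A)
  have gen: "cinner (t' x) y = cinner x (t y)"
    if "x \<in> {\<xi> \<otimes>\<^sub>2 d |\<xi> d. \<xi> \<in> N \<and> d \<in> D}" "y \<in> {\<xi> \<otimes>\<^sub>2 d |\<xi> d. \<xi> \<in> N \<and> d \<in> D}" for x y
    using that by (auto simp: t_def t'_def v b A cinner_ell2_tensor cinner_adj_left[OF c(1)])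
  show "tensor_id N D (adj A) = adj (tensor_id N D A)"
  proof (rule tensor_bop_eqI[where N = N and D = D])
    fix \<xi> d assume x: "\<xi> \<in> N" "d \<in> D"
    have gen': "{\<xi> \<otimes>\<^sub>2 d |\<xi> d. \<xi> \<in> N \<and> d \<in> D} \<subseteq> {y. cinner (t' (\<xi> \<otimes>\<^sub>2 d)) y = cinner (\<xi> \<otimes>\<^sub>2 d) (t y)}"
      using x by (intro subsetI CollectI gen) auto
    have "tensor_space N D \<subseteq> {y. cinner (t' (\<xi> \<otimes>\<^sub>2 d)) y = cinner (\<xi> \<otimes>\<^sub>2 d) (t y)}"
      unfolding tensor_space_def
      by (intro closure_cspan_minimal[OF gen'] csubspaceI closed_Collect_eq continuous_intros)
        (use c(2) in \<open>auto simp: t_def cblin_scaleC cinner_algebra blinfun.add_right\<close>)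
    then have 1: "cinner (t' (\<xi> \<otimes>\<^sub>2 d)) y = cinner (adj t (\<xi> \<otimes>\<^sub>2 d)) y" if "y \<in> tensor_space N D" for y
      using that c(2) by (auto simp: cinner_adj_left t_def)
    \<comment> \<open>Fact 1 holds against vectors of the tensor space only; z lies there, so it may
      be tested against itself.\<close>
    define z where "z = t' (\<xi> \<otimes>\<^sub>2 d) - adj t (\<xi> \<otimes>\<^sub>2 d)"
    have "z \<in> tensor_space N D"
      unfolding z_def using tb(2) adj_bop[OF T T tb(1)] T
      by (intro cvs.subspace_diff) (auto simp: bop_iff[OF T T] closed_csubspace_def)
    from 1[OF this] have "cinner z z = 0" by (simp add: z_def cinner_diff_left)
    then show "tensor_id N D (adj A) (\<xi> \<otimes>\<^sub>2 d) = adj (tensor_id N D A) (\<xi> \<otimes>\<^sub>2 d)"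
      by (simp add: z_def t_def t'_def)
  qed (simp_all add: b A)
qed


section \<open>The Fock space model\<close>

text \<open>The elementary tensors of the basis vectors of the one-particle space;
  \<open>fock_basis []\<close> is the vacuum.\<close>

lift_definition fock_basis :: "'n list \<Rightarrow> 'n fock" is "\<lambda>w v. if v = w then 1 else 0"
proof -
  fix w :: "'n list"
  have "(\<lambda>v. (norm (if v = w then 1 else 0 :: complex))\<^sup>2) summable_on {w}" by simp
  then show "(\<lambda>v. (norm (if v = w then 1 else 0 :: complex))\<^sup>2) summable_on UNIV"
    by (rule summable_on_cong_neutral[THEN iffD1, rotated -1]) auto
qed

lemma cinner_fock_basis: "cinner (fock_basis w) f = ell2_apply f w"
proof -
  have "cinner (fock_basis w) f = (\<Sum>\<^sub>\<infinity>v\<in>{w}. cinner (ell2_apply (fock_basis w) v) (ell2_apply f v))"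
    unfolding cinner_ell2_def
    by (rule infsum_cong_neutral) (auto simp: fock_basis.rep_eq cinner_complex_def)
  then show ?thesis by (simp add: fock_basis.rep_eq cinner_complex_def)
qed

lemma creation_apply:
  "ell2_apply (creation i f) w = (case w of [] \<Rightarrow> 0 | j # v \<Rightarrow> if j = i then ell2_apply f v else 0)"
  by (simp add: creation.rep_eq ell2_cons.rep_eq)

lemma creation_cblin: "creation i \<in> cblin"
  unfolding cblin_def
  by (auto intro!: ell2_eqI simp: creation_apply scaleC_ell2.rep_eq scaleC_complex_def split: list.split)

lemma creation_fock_basis: "creation i (fock_basis w) = fock_basis (i # w)"
  by (rule ell2_eqI) (auto simp: creation_apply fock_basis.rep_eq split: list.split)

lemma adj_creation_apply: "ell2_apply (adj (creation i) f) w = ell2_apply f (i # w)"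
  using cinner_adj_right[OF creation_cblin, of "fock_basis w" i f]
  by (simp add: cinner_fock_basis creation_fock_basis)

text \<open>Creation after annihilation of the letter i keeps exactly the coefficients of words
  beginning with i; summing over i leaves out only the empty word.\<close>

lemma sum_creation_adj_creation:
  fixes f :: "'n::finite fock"
  shows "f - (\<Sum>i\<in>UNIV. creation i (adj (creation i) f)) = ell2_apply f [] *\<^sub>C fock_basis []"
proof (rule ell2_eqI)
  fix w
  have sum: "ell2_apply (\<Sum>i\<in>A. g i) w = (\<Sum>i\<in>A. ell2_apply (g i) w)" for g :: "'n \<Rightarrow> 'n fock" and A w
    by (induction A rule: infinite_finite_induct) (auto simp: zero_ell2.rep_eq plus_ell2.rep_eq)
  show "ell2_apply (f - (\<Sum>i\<in>UNIV. creation i (adj (creation i) f))) w =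
      ell2_apply (ell2_apply f [] *\<^sub>C fock_basis []) w"
    by (cases w) (auto simp: minus_ell2_apply sum creation_apply adj_creation_apply scaleC_ell2.rep_eq
        scaleC_complex_def fock_basis.rep_eq)
qed

lemma cinner_vacuum_creation: "cinner (fock_basis []) (creation i f) = 0"
  by (simp add: cinner_fock_basis creation_apply)

section \<open>The weak operator topology, \<open>F_inf\<close>, and the ideal of elements without
  constant term\<close>

lemma topspace_wot [simp]: "topspace wot = cblin"
  by (simp add: wot_def topspace_pullback_topology)

lemma closedin_wot_matrix_coefficient: "closedin wot {A \<in> cblin. cinner y (blinfun_apply A x) = 0}"
proof -
  have "continuous_map wot euclidean ((\<lambda>h. h (x, y)) \<circ> (\<lambda>A (x, y). cinner y (blinfun_apply A x)))"
    unfolding wot_def by (intro continuous_map_pullback continuous_map_product_projection) simp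
  from closedin_continuous_map_preimage[OF this, of "{0}"] show ?thesis by (simp add: o_def)
qed

lemma unital_algebra_cblin: "unital_algebra id_blinfun cblin"
  by (auto simp: unital_algebra_def csubspace_cblin)

lemma F_inf_props:
  shows F_inf_cblin: "(F_inf :: ('n fock \<Rightarrow>\<^sub>L 'n fock) set) \<subseteq> cblin"
    and closedin_F_inf: "closedin wot (F_inf :: ('n fock \<Rightarrow>\<^sub>L 'n fock) set)"
    and unital_algebra_F_inf: "unital_algebra id_blinfun (F_inf :: ('n fock \<Rightarrow>\<^sub>L 'n fock) set)"
    and creation_F_inf: "creation (i :: 'n) \<in> F_inf"
proof -
  define \<F> where "\<F> = {\<A> :: ('n fock \<Rightarrow>\<^sub>L 'n fock) set.
    closedin wot \<A> \<and> unital_algebra id_blinfun \<A> \<and> range creation \<subseteq> \<A>}"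
  have F: "F_inf = \<Inter>\<F>" by (simp add: F_inf_def \<F>_def)
  \<comment> \<open>The family must be nonempty: an empty intersection would be \<open>UNIV\<close>,
    which exceeds the topspace \<open>cblin\<close> of \<open>wot\<close>.\<close>
  have cb: "cblin \<in> \<F>"
    using closedin_topspace[of wot] by (auto simp: \<F>_def unital_algebra_cblin creation_cblin)
  show "(F_inf :: ('n fock \<Rightarrow>\<^sub>L 'n fock) set) \<subseteq> cblin" using cb by (auto simp: F)
  show "closedin wot (F_inf :: ('n fock \<Rightarrow>\<^sub>L 'n fock) set)"
    unfolding F using cb by (intro closedin_Inter) (auto simp: \<F>_def)
  have "csubspace (\<Inter>\<F>)"
    by (rule csubspaceI) (auto simp: \<F>_def unital_algebra_def cvs.subspace_0 cvs.subspace_add cvs.subspace_scale)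
  then show "unital_algebra id_blinfun (F_inf :: ('n fock \<Rightarrow>\<^sub>L 'n fock) set)"
    unfolding F unital_algebra_def by (auto simp: \<F>_def unital_algebra_def)
  show "creation (i :: 'n) \<in> F_inf" by (auto simp: F \<F>_def)
qed

lemma word_op_Nil [simp]: "word_op E X [] = E"
  and word_op_Cons [simp]: "word_op E X (i # \<alpha>) = X i o\<^sub>L word_op E X \<alpha>"
  by (simp_all add: word_op_def)

lemma word_op_creation_F_inf: "word_op id_blinfun creation \<alpha> \<in> F_inf"
  using unital_algebra_F_inf by (induction \<alpha>) (auto simp: unital_algebra_def creation_F_inf)

lemma word_op_creation_vacuum: "word_op id_blinfun creation \<alpha> (fock_basis []) = fock_basis \<alpha>"
  by (induction \<alpha>) (auto simp: creation_fock_basis)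

text \<open>The adjoints of the elements of \<open>F_inf\<close> have the vacuum as an eigenvector.\<close>

lemma F_inf_vacuum:
  fixes A :: "'n fock \<Rightarrow>\<^sub>L 'n fock"
  assumes "A \<in> F_inf" "cinner (fock_basis []) \<psi> = 0"
  shows "cinner (fock_basis []) (A \<psi>) = 0"
proof -
  \<comment> \<open>These operators leave the orthogonal complement of the vacuum invariant; they
    form a WOT-closed unital algebra containing the creation operators, hence include
    \<open>F_inf\<close>.\<close>
  define \<A> :: "('n fock \<Rightarrow>\<^sub>L 'n fock) set" where "\<A> = (\<Inter>\<psi>\<in>{\<psi>. cinner (fock_basis []) \<psi> = 0}.
    {A \<in> cblin. cinner (fock_basis []) (blinfun_apply A \<psi>) = 0})"
  have ne: "{\<psi>. cinner (fock_basis []) \<psi> = 0} \<noteq> {}"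
    using cinner_zero_right by blast
  have "closedin wot \<A>"
    unfolding \<A>_def using ne by (intro closedin_INT closedin_wot_matrix_coefficient)
  moreover have "unital_algebra id_blinfun \<A>"
    unfolding unital_algebra_def
  proof (intro conjI ballI)
    show "csubspace \<A>"
      using ne by (intro csubspaceI) (auto simp: \<A>_def blinfun.add_left cinner_algebra)
    show "A o\<^sub>L B \<in> \<A>" if "A \<in> \<A>" "B \<in> \<A>" for A B
      using that ne by (auto simp: \<A>_def)
    show "id_blinfun \<in> \<A>" by (auto simp: \<A>_def)
  qed
  moreover have "range creation \<subseteq> \<A>"
    by (auto simp: \<A>_def creation_cblin cinner_vacuum_creation)
  ultimately have "F_inf \<subseteq> \<A>" unfolding F_inf_def by blast
  then show ?thesis using assms by (auto simp: \<A>_def)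
qed

text \<open>This is the ideal of elements with zero constant term. Left multiplication preserves it
  by the invariance in \<open>F_inf_vacuum\<close>; right multiplication merely changes
  \<phi>.\<close>

lemma wot_ideal_vacuum: "wot_ideal {A \<in> F_inf. \<forall>\<phi>. cinner (fock_basis []) (blinfun_apply A \<phi>) = 0}"
  unfolding wot_ideal_def
proof (intro conjI ballI)
  let ?I = "{A \<in> F_inf. \<forall>\<phi>. cinner (fock_basis []) (blinfun_apply A \<phi>) = 0}"
  have F: "csubspace F_inf" "\<And>A B. A \<in> F_inf \<Longrightarrow> B \<in> F_inf \<Longrightarrow> A o\<^sub>L B \<in> F_inf"
    using unital_algebra_F_inf by (auto simp: unital_algebra_def)
  show "csubspace ?I"
    by (rule csubspaceI)
      (auto simp: cvs.subspace_0 cvs.subspace_add cvs.subspace_scale F(1) blinfun.add_left cinner_algebra)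
  show "A o\<^sub>L X \<in> ?I" "X o\<^sub>L A \<in> ?I" if "A \<in> F_inf" "X \<in> ?I" for A X
    using that by (auto simp: F(2) F_inf_vacuum)
  have "?I = F_inf \<inter> (\<Inter>\<phi>. {A \<in> cblin. cinner (fock_basis []) (blinfun_apply A \<phi>) = 0})"
    using F_inf_cblin by auto
  also have "closedin wot \<dots>"
    by (intro closedin_Int closedin_F_inf closedin_INT closedin_wot_matrix_coefficient) simp
  finally show "closedin wot ?I" .
qed auto

text \<open>No generator has a constant term, so the generators, and with them J, lie in the ideal
  of \<open>wot_ideal_vacuum\<close>.\<close>

lemma homogeneous_ideal_vacuum:
  fixes P :: "'n ncpoly set"
  assumes hom: "\<forall>p\<in>P. homogeneous p" and J: "wot_ideal J" "J = wot_ideal_generated P" "J \<noteq> F_inf"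
    and A: "A \<in> J"
  shows "cinner (fock_basis []) (A \<phi>) = 0"
proof -
  have Fs: "csubspace F_inf" "\<And>A B. A \<in> F_inf \<Longrightarrow> B \<in> F_inf \<Longrightarrow> A o\<^sub>L B \<in> F_inf" "id_blinfun \<in> F_inf"
    using unital_algebra_F_inf by (auto simp: unital_algebra_def)
  have Js: "csubspace J" "J \<subseteq> F_inf" "\<And>A X. A \<in> F_inf \<Longrightarrow> X \<in> J \<Longrightarrow> A o\<^sub>L X \<in> J"
    using J(1) by (auto simp: wot_ideal_def)
  have nil: "[] \<notin> Poly_Mapping.keys p" if p: "p \<in> P" for p
  proof
    assume "[] \<in> Poly_Mapping.keys p"
    moreover obtain k where k: "\<forall>\<alpha>\<in>Poly_Mapping.keys p. length \<alpha> = k"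
      using hom p by (auto simp: homogeneous_def)
    \<comment> \<open>A homogeneous polynomial with a constant term has degree 0 and is a nonzero
      scalar; then the identity lies in J, against properness.\<close>
    ultimately have "k = 0" by auto
    with k \<open>[] \<in> Poly_Mapping.keys p\<close> have keys: "Poly_Mapping.keys p = {[]}" by auto
    define c where "c = Poly_Mapping.lookup p []"
    have c: "c \<noteq> 0" using keys by (simp add: c_def in_keys_iff[symmetric])
    have "poly_eval creation p \<in> J" using p unfolding J(2) wot_ideal_generated_def by auto
    then have "c *\<^sub>C id_blinfun \<in> J" by (simp add: poly_eval_def keys c_def)
    from cvs.subspace_scale[OF Js(1) this, of "inverse c"] have "id_blinfun \<in> J"
      using c by simp
    moreover have "A o\<^sub>L id_blinfun = A" for A :: "'n fock \<Rightarrow>\<^sub>L 'n fock"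
      by (rule blinfun_eqI) simp
    ultimately have "F_inf \<subseteq> J" using Js(3)[of _ id_blinfun] by auto
    then show False using J(3) Js(2) by blast
  qed
  have "poly_eval creation p \<in> {A \<in> F_inf. \<forall>\<phi>. cinner (fock_basis []) (blinfun_apply A \<phi>) = 0}"
    if p: "p \<in> P" for p
    unfolding poly_eval_def
  proof (rule cvs.subspace_sum)
    show "csubspace {A \<in> F_inf. \<forall>\<phi>. cinner (fock_basis []) (blinfun_apply A \<phi>) = 0}"
      using wot_ideal_vacuum by (auto simp: wot_ideal_def)
    fix \<alpha> assume "\<alpha> \<in> Poly_Mapping.keys p"
    then obtain i \<beta> where "\<alpha> = i # \<beta>" using nil[OF p] by (cases \<alpha>) auto
    then show "Poly_Mapping.lookup p \<alpha> *\<^sub>C word_op id_blinfun creation \<alpha>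
        \<in> {A \<in> F_inf. \<forall>\<phi>. cinner (fock_basis []) (blinfun_apply A \<phi>) = 0}"
      using cvs.subspace_scale[OF Fs(1) word_op_creation_F_inf[of \<alpha>]]
      by (simp add: cinner_algebra cinner_vacuum_creation)
  qed
  then have "J \<subseteq> {A \<in> F_inf. \<forall>\<phi>. cinner (fock_basis []) (blinfun_apply A \<phi>) = 0}"
    unfolding J(2) wot_ideal_generated_def using wot_ideal_vacuum by blast
  then show ?thesis using A by blast
qed

section \<open>The model space and the compressed creation operators\<close>

locale fock_ideal =
  fixes J :: "('n::finite fock \<Rightarrow>\<^sub>L 'n fock) set"
  assumes ideal: "wot_ideal J"
    \<comment> \<open>Homogeneity and properness of the ideal enter through this property, supplied
      by \<open>homogeneous_ideal_vacuum\<close>.\<close>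
    and vacuum: "A \<in> J \<Longrightarrow> cinner (fock_basis []) (blinfun_apply A \<phi>) = 0"
begin

abbreviation "N \<equiv> model_space J"
abbreviation "E \<equiv> orth_proj (model_space J)"
abbreviation "B \<equiv> model_op J"

lemma N_def': "N = orth_compl {blinfun_apply A \<phi> |A \<phi>. A \<in> J}"
  by (simp add: model_space_def orth_compl_closure)

lemma N_closed [simp]: "closed_csubspace N"
  by (simp add: N_def')

sublocale N: closed_csubspace N by (rule N_closed)

lemma vacuum_N: "fock_basis [] \<in> N"
proof -
  have "cinner y (fock_basis []) = 0" if "y \<in> {blinfun_apply A \<phi> |A \<phi>. A \<in> J}" for y
    using that vacuum by (subst cinner_eq_0_commute) auto
  then show ?thesis by (simp add: N_def' orth_compl_def)
qed

text \<open>J is a left ideal, so creation operators map the set of all A\<phi> with A in J into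
  itself; their adjoints therefore preserve its orthogonal complement N.\<close>

lemma adj_creation_N: "x \<in> N \<Longrightarrow> adj (creation i) x \<in> N"
proof -
  assume x: "x \<in> N"
  have "cinner (A \<phi>) (adj (creation i) x) = 0" if "A \<in> J" for A \<phi>
  proof -
    have "creation i o\<^sub>L A \<in> J" using ideal that by (simp add: wot_ideal_def creation_F_inf)
    then have "cinner ((creation i o\<^sub>L A) \<phi>) x = 0" using x unfolding N_def' orth_compl_def by blast
    then show ?thesis by (simp add: cinner_adj_right creation_cblin)
  qed
  then show "adj (creation i) x \<in> N" unfolding N_def' orth_compl_def by blast
qed

text \<open>Dual to the invariance of N under the adjoints. It makes compression multiplicative
  here: words in the \<open>B i\<close> are compressions of words in the creation operators.\<close>

lemma proj_creation_proj: "E (creation i (E x)) = E (creation i x)"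
proof -
  have "cinner y (E (creation i (x - E x))) = 0" for y
  proof -
    have "cinner y (E (creation i (x - E x))) = cinner (adj (creation i) (E y)) (x - E x)"
      by (simp add: N.cinner_orth_proj[symmetric] cinner_adj_left creation_cblin)
    also have "\<dots> = 0"
      using N.orth_proj_diff adj_creation_N[OF N.orth_proj_in] by (auto simp: orth_compl_def)
    finally show ?thesis .
  qed
  then have "E (creation i (x - E x)) = 0" using cinner_self_eq_0 by blast
  then show ?thesis by (simp add: blinfun.diff_right)
qed

lemma B_apply: "B i (E x) = E (creation i x)" "B i x = E (creation i x)"
  by (simp_all add: model_op_def proj_creation_proj)

lemma B_bop: "B i \<in> bop N N"
  unfolding model_op_def
  by (simp add: bop_iff creation_cblin N.orth_proj_cblin N.orth_proj_in N.orth_proj_zero)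

lemma adj_B_apply: "x \<in> N \<Longrightarrow> adj (B i) x = adj (creation i) x"
  by (simp add: model_op_def adj_compose creation_cblin N.orth_proj_cblin adj_cblin N.adj_orth_proj
      N.orth_proj_id adj_creation_N)

text \<open>The vacuum identity for the creation operators survives compression because their
  adjoints preserve N and the vacuum lies in N.\<close>

lemma defect_B:
  assumes "x \<in> N"
  shows "x - (\<Sum>i\<in>UNIV. B i (adj (B i) x)) = ell2_apply x [] *\<^sub>C fock_basis []"
proof -
  have "x - (\<Sum>i\<in>UNIV. B i (adj (B i) x)) = E (x - (\<Sum>i\<in>UNIV. creation i (adj (creation i) x)))"
    by (simp add: adj_B_apply assms B_apply(2) blinfun.diff_right blinfun.sum_right N.orth_proj_id)
  also have "\<dots> = ell2_apply x [] *\<^sub>C fock_basis []"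
    unfolding sum_creation_adj_creation
    by (simp add: cblin_scaleC[OF N.orth_proj_cblin] N.orth_proj_id vacuum_N)
  finally show ?thesis .
qed

lemma word_op_B: "word_op E B \<alpha> (E x) = E (word_op id_blinfun creation \<alpha> x)"
  by (induction \<alpha>) (simp_all add: B_apply proj_creation_proj)

lemma word_op_B_vacuum: "word_op E B \<alpha> (fock_basis []) = E (fock_basis \<alpha>)"
  using word_op_B[of \<alpha> "fock_basis []"] by (simp add: N.orth_proj_id vacuum_N word_op_creation_vacuum)

text \<open>By \<open>word_op_B_vacuum\<close> this is cyclicity of the vacuum for the model tuple.
  A vector of N orthogonal to all projected basis vectors has only zero coefficients.\<close>

lemma N_eq_closure: "N = closure (cspan {E (fock_basis \<alpha>) |\<alpha>. True})"
proof
  let ?M = "closure (cspan {E (fock_basis \<alpha>) |\<alpha>. True})"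
  interpret M: closed_csubspace ?M by simp
  show M: "?M \<subseteq> N"
    by (rule closure_cspan_minimal) (auto simp: N.orth_proj_in N.csub N.clo)
  show "N \<subseteq> ?M"
  proof
    fix x assume x: "x \<in> N"
    define y where "y = x - orth_proj ?M x"
    have yN: "y \<in> N"
      unfolding y_def using x M M.orth_proj_in[of x] by (intro cvs.subspace_diff[OF N.csub]) auto
    have "ell2_apply y \<alpha> = 0" for \<alpha>
    proof -
      have "E (fock_basis \<alpha>) \<in> ?M" by (rule closure_cspan_superset[THEN subsetD]) blast
      then have "cinner (E (fock_basis \<alpha>)) y = 0"
        using M.orth_proj_diff[of x] by (auto simp: y_def orth_compl_def)
      then show ?thesis using yN by (simp add: N.cinner_orth_proj N.orth_proj_id cinner_fock_basis)
    qed
    then have "y = 0" by (intro ell2_eqI) (simp add: zero_ell2.rep_eq)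
    then show "x \<in> ?M" using M.orth_proj_in[of x] by (simp add: y_def)
  qed
qed

lemma model_cstar_props:
  shows cstar_bop: "model_cstar J \<subseteq> bop N N"
    and cstar_closed: "closed (model_cstar J)"
    and cstar_csubspace: "csubspace (model_cstar J)"
    and cstar_compose: "X \<in> model_cstar J \<Longrightarrow> Y \<in> model_cstar J \<Longrightarrow> X o\<^sub>L Y \<in> model_cstar J"
    and cstar_unit: "E \<in> model_cstar J"
    and cstar_adj: "adj ` model_cstar J \<subseteq> model_cstar J"
    and cstar_B: "B i \<in> model_cstar J"
proof -
  define \<F> where "\<F> = {\<A>. \<A> \<subseteq> bop N N \<and> closed \<A> \<and> unital_algebra E \<A> \<and> adj ` \<A> \<subseteq> \<A> \<and> range B \<subseteq> \<A>}"
  have F: "model_cstar J = \<Inter>\<F>" by (simp add: model_cstar_def \<F>_def)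
  have "bop N N \<in> \<F>"
    by (auto simp: \<F>_def closed_bop unital_algebra_def csubspace_bop orth_proj_bop adj_bop B_bop
        intro: bop_compose[OF N_closed N_closed N_closed])
  then show "model_cstar J \<subseteq> bop N N" by (auto simp: F)
  show "closed (model_cstar J)" unfolding F by (intro closed_Inter) (auto simp: \<F>_def)
  show "csubspace (model_cstar J)"
    unfolding F
    by (rule csubspaceI) (auto simp: \<F>_def unital_algebra_def cvs.subspace_0 cvs.subspace_add cvs.subspace_scale)
  show "X o\<^sub>L Y \<in> model_cstar J" if "X \<in> model_cstar J" "Y \<in> model_cstar J"
    using that unfolding F \<F>_def unital_algebra_def by blast
  show "E \<in> model_cstar J" "B i \<in> model_cstar J"
    by (auto simp: F \<F>_def unital_algebra_def)
  show "adj ` model_cstar J \<subseteq> model_cstar J"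
  proof clarify
    fix X assume "X \<in> model_cstar J"
    then show "adj X \<in> model_cstar J" unfolding F \<F>_def by blast
  qed
qed

end


section \<open>Cyclic dilations and star representations\<close>

lemma isometry_UNIV_iff:
  fixes \<iota> :: "'h::chilbert_space \<Rightarrow>\<^sub>L 'k::chilbert_space"
  assumes "closed_csubspace K"
  shows "isometry UNIV K \<iota> \<longleftrightarrow> \<iota> \<in> cblin \<and> adj \<iota> o\<^sub>L \<iota> = id_blinfun \<and> (\<forall>h. \<iota> h \<in> K)"
proof -
  have "orth_compl (UNIV :: 'h set) = {0}"
    using orth_compl_Int by (auto simp: orth_compl_def)
  then show ?thesis by (auto simp: isometry_def bop_iff assms)
qed

text \<open>Minimality and uniqueness see a dilation only through one star representation and the
  embedding. As K is a subspace of an ambient type, unitality reads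
  \<open>\<rho> E = orth_proj K\<close>.\<close>

locale cyclic_dilation =
  fixes \<A> :: "('a::chilbert_space \<Rightarrow>\<^sub>L 'a) set" and E :: "'a \<Rightarrow>\<^sub>L 'a" and B :: "'n \<Rightarrow> 'a \<Rightarrow>\<^sub>L 'a"
    and \<rho> :: "('a \<Rightarrow>\<^sub>L 'a) \<Rightarrow> 'k::chilbert_space \<Rightarrow>\<^sub>L 'k" and K :: "'k set"
    and \<iota> :: "'h::chilbert_space \<Rightarrow>\<^sub>L 'k" and T :: "'n \<Rightarrow> 'h \<Rightarrow>\<^sub>L 'h"
  assumes A_cblin: "\<A> \<subseteq> cblin" and A_closed: "closed \<A>" and A_csubspace: "csubspace \<A>"
    and A_adj: "adj ` \<A> \<subseteq> \<A>" and A_compose: "X \<in> \<A> \<Longrightarrow> Y \<in> \<A> \<Longrightarrow> X o\<^sub>L Y \<in> \<A>"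
    and E_in: "E \<in> \<A>" and E_left: "X \<in> \<A> \<Longrightarrow> E o\<^sub>L X = X" and E_right: "X \<in> \<A> \<Longrightarrow> X o\<^sub>L E = X"
    and B_in: "B i \<in> \<A>"
    and dense: "closure (cspan {word_op E B \<alpha> o\<^sub>L adj (word_op E B \<beta>) |\<alpha> \<beta>. True}) = \<A>"
    and rep: "star_representation \<A> \<rho>" and K: "closed_csubspace K" and rho_E: "\<rho> E = orth_proj K"
    and iota_cblin: "\<iota> \<in> cblin" and iota_isometry: "adj \<iota> o\<^sub>L \<iota> = id_blinfun" and iota_in: "\<iota> h \<in> K"
    and T_cblin: "T i \<in> cblin" and dilation: "\<iota> o\<^sub>L adj (T i) = adj (\<rho> (B i)) o\<^sub>L \<iota>"
    and cyclic: "\<Inter>{M. closed M \<and> csubspace M \<and> M \<subseteq> K \<and> range \<iota> \<subseteq> M \<and>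
      (\<forall>i. \<rho> (B i) ` M \<subseteq> M \<and> adj (\<rho> (B i)) ` M \<subseteq> M)} = K"
begin

sublocale K: closed_csubspace K by (rule K)

lemma rho_cblin: "X \<in> \<A> \<Longrightarrow> \<rho> X \<in> cblin"
  and rho_add: "X \<in> \<A> \<Longrightarrow> Y \<in> \<A> \<Longrightarrow> \<rho> (X + Y) = \<rho> X + \<rho> Y"
  and rho_compose: "X \<in> \<A> \<Longrightarrow> Y \<in> \<A> \<Longrightarrow> \<rho> (X o\<^sub>L Y) = \<rho> X o\<^sub>L \<rho> Y"
  and rho_scaleC: "X \<in> \<A> \<Longrightarrow> \<rho> (c *\<^sub>C X) = c *\<^sub>C \<rho> X"
  and rho_adj: "X \<in> \<A> \<Longrightarrow> \<rho> (adj X) = adj (\<rho> X)"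
  using rep by (auto simp: star_representation_def)

lemma adj_in: "X \<in> \<A> \<Longrightarrow> adj X \<in> \<A>"
  using A_adj by blast

lemma rho_diff: "X \<in> \<A> \<Longrightarrow> Y \<in> \<A> \<Longrightarrow> \<rho> (X - Y) = \<rho> X - \<rho> Y"
  using rho_add[of "X - Y" Y] cvs.subspace_diff[OF A_csubspace] by (simp add: eq_diff_eq)

lemma rho_zero: "\<rho> 0 = 0"
  using rho_diff[OF E_in E_in] by simp

text \<open>Only the values of \<rho> on \<A> are constrained, hence continuity relative to \<A>;
  \<open>star_representation_norm_le\<close> is applied to differences.\<close>

lemma continuous_on_rho: "continuous_on \<A> \<rho>"
proof (rule continuous_onI)
  fix X and e :: real assume X: "X \<in> \<A>" and "e > 0"
  have "dist (\<rho> Y) (\<rho> X) \<le> e" if Y: "Y \<in> \<A>" "dist Y X < e" for Y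
  proof -
    have "norm (\<rho> (Y - X)) \<le> norm (Y - X)"
      by (rule star_representation_norm_le[OF A_cblin A_closed A_csubspace A_adj A_compose rep])
        (auto intro: cvs.subspace_diff A_csubspace X Y)
    then show ?thesis using Y X by (simp add: dist_norm rho_diff)
  qed
  then show "\<exists>d>0. \<forall>Y\<in>\<A>. dist Y X < d \<longrightarrow> dist (\<rho> Y) (\<rho> X) \<le> e"
    using \<open>e > 0\<close> by blast
qed

lemma word_in: "word_op E B \<alpha> \<in> \<A>"
  by (induction \<alpha>) (simp_all add: E_in A_compose B_in)

lemma rho_word: "\<rho> (word_op E B \<alpha>) = word_op (orth_proj K) (\<lambda>i. \<rho> (B i)) \<alpha>"
  by (induction \<alpha>) (simp_all add: rho_E rho_compose word_in B_in)

lemma rho_in: "X \<in> \<A> \<Longrightarrow> \<rho> X x \<in> K"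
  using rho_compose[OF E_in, of X] E_left[of X] K.orth_proj_in
  by (metis blinfun_apply_blinfun_compose rho_E)

lemma rho_bop: "X \<in> \<A> \<Longrightarrow> \<rho> X \<in> bop K K"
proof -
  assume X: "X \<in> \<A>"
  have "\<rho> X o\<^sub>L orth_proj K = \<rho> X"
    using rho_compose[OF X E_in] E_right[OF X] by (simp add: rho_E)
  then have "\<rho> X x = \<rho> X (orth_proj K x)" for x by (metis blinfun_apply_blinfun_compose)
  then have "\<forall>x\<in>orth_compl K. \<rho> X x = 0" using K.orth_proj_zero by (metis blinfun.zero_right)
  then show ?thesis using X by (simp add: bop_iff K rho_cblin rho_in)
qed

lemma dilation_apply: "adj (\<rho> (B i)) (\<iota> h) = \<iota> (adj (T i) h)"
  using dilation[of i] by (metis blinfun_apply_blinfun_compose)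

lemma cinner_iota: "cinner (\<iota> h) (\<iota> k) = cinner h k"
  using cinner_adj_right[OF iota_cblin, of h "\<iota> k"] iota_isometry
  by (metis blinfun_apply_blinfun_compose blinfun_apply_id_blinfun id_apply)

lemma word_T_cblin: "word_op id_blinfun T \<alpha> \<in> cblin"
  by (induction \<alpha>) (simp_all add: T_cblin)

lemma adj_word_iota: "adj (\<rho> (word_op E B \<alpha>)) (\<iota> h) = \<iota> (adj (word_op id_blinfun T \<alpha>) h)"
\<comment> \<open>Adjoints reverse the word, so the first letter acts on h first and the induction
  hypothesis is needed at \<open>adj (T i) h\<close>.\<close>
proof (induction \<alpha> arbitrary: h)
  case Nil
  then show ?case by (simp add: rho_E K.adj_orth_proj K.orth_proj_id iota_in)
next
  case (Cons i \<alpha>)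
  then show ?case
    by (simp add: rho_compose B_in word_in adj_compose rho_cblin T_cblin word_T_cblin dilation_apply)
qed

lemma moment:
  "cinner (\<iota> h) (\<rho> (word_op E B \<alpha> o\<^sub>L adj (word_op E B \<beta>)) (\<iota> k)) =
    cinner (adj (word_op id_blinfun T \<alpha>) h) (adj (word_op id_blinfun T \<beta>) k)"
  by (simp add: rho_compose word_in adj_in rho_adj rho_cblin adj_word_iota cinner_iota
      flip: cinner_adj_left)

text \<open>The closed span on the right is invariant under the image of the star-closed algebra
  \<A>, and contains the range of \<iota> because \<open>\<rho> E\<close> fixes it. It is thus a
  reducing subspace, and star-cyclicity makes it all of K.\<close>

lemma K_eq_algebra: "K = closure (cspan {\<rho> X (\<iota> h) |X h. X \<in> \<A>})"
proof
  let ?S = "{\<rho> X (\<iota> h) |X h. X \<in> \<A>}"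
  let ?M = "closure (cspan ?S)"
  show sub: "?M \<subseteq> K"
    by (rule closure_cspan_minimal) (auto simp: rho_in K.csub K.clo)
  have inv: "\<rho> X ` ?M \<subseteq> ?M" if X: "X \<in> \<A>" for X
  proof -
    have "?M \<subseteq> \<rho> X -` ?M"
    proof (rule closure_cspan_minimal)
      show "closed (\<rho> X -` ?M)"
        by (intro closed_vimage closed_closure linear_continuous_on blinfun.bounded_linear_right)
      show "csubspace (\<rho> X -` ?M)"
        by (rule csubspaceI)
          (auto simp: blinfun.add_right cblin_scaleC[OF rho_cblin[OF X]] cvs.subspace_0 cvs.subspace_add
            cvs.subspace_scale)
      show "?S \<subseteq> \<rho> X -` ?M"
      proof clarify
        fix Y h assume Y: "Y \<in> \<A>"
        have "\<rho> X (\<rho> Y (\<iota> h)) = \<rho> (X o\<^sub>L Y) (\<iota> h)" by (simp add: rho_compose X Y)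
        also have "\<dots> \<in> ?S" using A_compose[OF X Y] by blast
        finally show "\<rho> Y (\<iota> h) \<in> \<rho> X -` ?M" using closure_cspan_superset[of ?S] by blast
      qed
    qed
    then show ?thesis by blast
  qed
  have "\<iota> h \<in> ?M" for h
  proof -
    have "\<iota> h = \<rho> E (\<iota> h)" by (simp add: rho_E K.orth_proj_id iota_in)
    then have "\<iota> h \<in> ?S" using E_in by blast
    then show ?thesis using closure_cspan_superset[of ?S] by blast
  qed
  then have "?M \<in> {M. closed M \<and> csubspace M \<and> M \<subseteq> K \<and> range \<iota> \<subseteq> M \<and>
      (\<forall>i. \<rho> (B i) ` M \<subseteq> M \<and> adj (\<rho> (B i)) ` M \<subseteq> M)}"
    using sub inv[OF B_in] inv[OF adj_in[OF B_in]] by (auto simp: rho_adj[OF B_in])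
  then show "K \<subseteq> ?M" using cyclic by blast
qed

text \<open>For fixed h, the X in \<A> with \<open>\<rho> X (\<iota> h)\<close> in the closed span
  on the right form a closed subspace. It contains the spanning products of words and adjoint words,
  because an adjoint word maps \<open>\<iota> h\<close> back into the range of \<iota>.\<close>

lemma K_eq_words: "K = closure (cspan {\<rho> (word_op E B \<alpha>) (\<iota> h) |\<alpha> h. True})"
proof
  let ?S = "{\<rho> (word_op E B \<alpha>) (\<iota> h) |\<alpha> h. True}"
  let ?M = "closure (cspan ?S)"
  show "?M \<subseteq> K"
    by (rule closure_cspan_minimal) (auto simp: rho_in word_in K.csub K.clo)
  have "\<rho> X (\<iota> h) \<in> ?M" if X: "X \<in> \<A>" for X h
  proof -
    have "\<A> \<subseteq> \<A> \<inter> (\<lambda>X. \<rho> X (\<iota> h)) -` ?M"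
      unfolding dense[symmetric]
    proof (rule closure_cspan_minimal)
      show "closed (closure (cspan {word_op E B \<alpha> o\<^sub>L adj (word_op E B \<beta>) |\<alpha> \<beta>. True}) \<inter> (\<lambda>X. \<rho> X (\<iota> h)) -` ?M)"
        unfolding dense
        by (intro continuous_closed_preimage A_closed closed_closure continuous_intros continuous_on_rho)
      show "csubspace (closure (cspan {word_op E B \<alpha> o\<^sub>L adj (word_op E B \<beta>) |\<alpha> \<beta>. True}) \<inter> (\<lambda>X. \<rho> X (\<iota> h)) -` ?M)"
        unfolding dense
        by (rule csubspaceI)
          (auto simp: A_csubspace rho_zero rho_add rho_scaleC blinfun.add_left cvs.subspace_0
            cvs.subspace_add cvs.subspace_scale)
      show "{word_op E B \<alpha> o\<^sub>L adj (word_op E B \<beta>) |\<alpha> \<beta>. True} \<subseteq>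
          closure (cspan {word_op E B \<alpha> o\<^sub>L adj (word_op E B \<beta>) |\<alpha> \<beta>. True}) \<inter> (\<lambda>X. \<rho> X (\<iota> h)) -` ?M"
        unfolding dense
      proof clarify
        fix \<alpha> \<beta>
        have "\<rho> (word_op E B \<alpha> o\<^sub>L adj (word_op E B \<beta>)) (\<iota> h) =
            \<rho> (word_op E B \<alpha>) (\<iota> (adj (word_op id_blinfun T \<beta>) h))"
          by (simp add: rho_compose word_in adj_in rho_adj adj_word_iota)
        also have "\<dots> \<in> ?S" by blast
        finally have "\<rho> (word_op E B \<alpha> o\<^sub>L adj (word_op E B \<beta>)) (\<iota> h) \<in> ?M"
          using closure_cspan_superset[of ?S] by blast
        then show "word_op E B \<alpha> o\<^sub>L adj (word_op E B \<beta>) \<in> \<A> \<inter> (\<lambda>X. \<rho> X (\<iota> h)) -` ?M"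
          by (simp add: A_compose word_in adj_in)
      qed
    qed
    then show ?thesis using X by blast
  qed
  then have "closure (cspan {\<rho> X (\<iota> h) |X h. X \<in> \<A>}) \<subseteq> ?M"
    by (intro closure_cspan_minimal) auto
  then show "K \<subseteq> ?M" using K_eq_algebra by simp
qed

end

text \<open>The unitary sends \<open>\<rho> X (\<iota> h)\<close> to
  \<open>\<rho>' X (\<iota>' h)\<close>. Intertwining is obtained for the whole algebra, since words
  in the \<open>B i\<close> and their adjoints are needed later.\<close>

lemma cyclic_dilation_unique:
  assumes "cyclic_dilation \<A> E B \<rho> K \<iota> T" "cyclic_dilation \<A> E B \<rho>' K' \<iota>' T"
  shows "\<exists>U. unitary K K' U \<and> (\<forall>X\<in>\<A>. U o\<^sub>L \<rho> X = \<rho>' X o\<^sub>L U) \<and> U o\<^sub>L \<iota> = \<iota>'"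
proof -
  interpret d: cyclic_dilation \<A> E B \<rho> K \<iota> T by fact
  interpret d': cyclic_dilation \<A> E B \<rho>' K' \<iota>' T by fact
  have moments: "cinner (\<iota> h) (\<rho> X (\<iota> k)) = cinner (\<iota>' h) (\<rho>' X (\<iota>' k))" if X: "X \<in> \<A>" for X h k
  proof -
    \<comment> \<open>The difference of the two moments is linear and continuous in X and vanishes
      on products whose span is dense in \<A>.\<close>
    define f where "f X = cinner (\<iota> h) (\<rho> X (\<iota> k)) - cinner (\<iota>' h) (\<rho>' X (\<iota>' k))" for X
    have "closed (\<A> \<inter> f -` {0})"
      unfolding f_def
      by (intro continuous_closed_preimage d.A_closed continuous_intros d.continuous_on_rho
          d'.continuous_on_rho)
    moreover have "csubspace (\<A> \<inter> f -` {0})"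
      by (rule csubspaceI)
        (auto simp: f_def d.A_csubspace d.rho_zero d.rho_add d.rho_scaleC d'.rho_zero d'.rho_add
          d'.rho_scaleC blinfun.add_left cvs.subspace_0 cvs.subspace_add cvs.subspace_scale cinner_algebra)
    moreover have "{word_op E B \<alpha> o\<^sub>L adj (word_op E B \<beta>) |\<alpha> \<beta>. True} \<subseteq> \<A> \<inter> f -` {0}"
      by (auto simp: f_def d.moment d'.moment d.A_compose d.word_in d.adj_in)
    ultimately have "closure (cspan {word_op E B \<alpha> o\<^sub>L adj (word_op E B \<beta>) |\<alpha> \<beta>. True}) \<subseteq> \<A> \<inter> f -` {0}"
      by (intro closure_cspan_minimal)
    then show ?thesis unfolding d.dense using X by (auto simp: f_def)
  qed
  define S where "S = {(\<rho> X (\<iota> h), \<rho>' X (\<iota>' h)) |X h. X \<in> \<A>}"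
  have fst: "fst ` S = {\<rho> X (\<iota> h) |X h. X \<in> \<A>}" and snd: "snd ` S = {\<rho>' X (\<iota>' h) |X h. X \<in> \<A>}"
    by (force simp: S_def)+
  have "cinner (fst p) (fst q) = cinner (snd p) (snd q)" if pq: "p \<in> S" "q \<in> S" for p q
  proof -
    obtain X h Y k where X: "X \<in> \<A>" and Y: "Y \<in> \<A>"
      and p: "p = (\<rho> X (\<iota> h), \<rho>' X (\<iota>' h))" and q: "q = (\<rho> Y (\<iota> k), \<rho>' Y (\<iota>' k))"
      using pq unfolding S_def by blast
    \<comment> \<open>Moving \<open>\<rho> X\<close> across the inner product turns the Gram entry
      of p and q into the moment of this element.\<close>
    have "adj X o\<^sub>L Y \<in> \<A>" using X Y d.A_compose d.adj_in by blast
    from moments[OF this, of h k] show ?thesis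
      by (simp add: p q X Y d.rho_compose d'.rho_compose d.adj_in d.rho_adj d'.rho_adj
          cinner_adj_right d.rho_cblin d'.rho_cblin)
  qed
  from unitary_extension[of S, OF this] obtain U where U: "unitary K K' U"
    and US: "\<And>p. p \<in> S \<Longrightarrow> blinfun_apply U (fst p) = snd p"
    unfolding fst snd d.K_eq_algebra[symmetric] d'.K_eq_algebra[symmetric] by blast
  have UX: "U (\<rho> X (\<iota> h)) = \<rho>' X (\<iota>' h)" if "X \<in> \<A>" for X h
    using US[of "(\<rho> X (\<iota> h), \<rho>' X (\<iota>' h))"] that by (auto simp: S_def)
  have Ubop: "U \<in> bop K K'" using U by (simp add: unitary_def isometry_def)
  have "U o\<^sub>L \<rho> X = \<rho>' X o\<^sub>L U" if X: "X \<in> \<A>" for X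
  proof (rule bop_eqI[OF d'.K, where S = "{\<rho> X (\<iota> h) |X h. X \<in> \<A>}"], unfold d.K_eq_algebra[symmetric])
    show "U o\<^sub>L \<rho> X \<in> bop K K'"
      by (rule bop_compose[OF d.K d.K d'.K Ubop d.rho_bop[OF X]])
    show "\<rho>' X o\<^sub>L U \<in> bop K K'"
      by (rule bop_compose[OF d.K d'.K d'.K d'.rho_bop[OF X] Ubop])
    fix s assume "s \<in> {\<rho> X (\<iota> h) |X h. X \<in> \<A>}"
    then obtain Y h where Y: "Y \<in> \<A>" "s = \<rho> Y (\<iota> h)" by blast
    have "U (\<rho> X s) = U (\<rho> (X o\<^sub>L Y) (\<iota> h))" by (simp add: d.rho_compose X Y)
    also have "\<dots> = \<rho>' (X o\<^sub>L Y) (\<iota>' h)" by (rule UX[OF d.A_compose[OF X Y(1)]])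
    also have "\<dots> = \<rho>' X (U s)" by (simp add: d'.rho_compose X Y UX)
    finally show "(U o\<^sub>L \<rho> X) s = (\<rho>' X o\<^sub>L U) s" by simp
  qed
  moreover have "U o\<^sub>L \<iota> = \<iota>'"
  proof (rule blinfun_eqI)
    show "(U o\<^sub>L \<iota>) h = \<iota>' h" for h
      using UX[OF d.E_in, of h] by (simp add: d.rho_E d'.rho_E d.K.orth_proj_id d'.K.orth_proj_id d.iota_in d'.iota_in)
  qed
  ultimately show ?thesis using U by blast
qed

text \<open>Uniqueness compares dilations of one and the same tuple; precomposing the embedding with
  W turns a dilation of T' into one of T on the same space.\<close>

lemma cyclic_dilation_transport:
  fixes \<iota>' :: "'h'::chilbert_space \<Rightarrow>\<^sub>L 'k::chilbert_space" and W :: "'h::chilbert_space \<Rightarrow>\<^sub>L 'h'"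
  assumes d: "cyclic_dilation \<A> E B \<rho> K \<iota>' T'" and W: "unitary UNIV UNIV W"
    and T: "\<And>i. T i \<in> cblin" "\<And>i. T i = adj W o\<^sub>L T' i o\<^sub>L W"
  shows "cyclic_dilation \<A> E B \<rho> K (\<iota>' o\<^sub>L W) T"
proof -
  interpret cyclic_dilation \<A> E B \<rho> K \<iota>' T' by fact
  have Wc: "W \<in> cblin" by (rule unitary_cblin[OF _ _ W]) simp_all
  have W1: "adj W (W x) = x" for x using unitary_adj_apply[OF _ _ W, of x] by simp
  have W2: "W (adj W y) = y" for y using unitary_apply_adj[OF _ _ W, of y] by simp
  \<comment> \<open>W is onto, so the embedded subspace, and hence star-cyclicity, is
    unchanged.\<close>
  have r: "range (\<iota>' o\<^sub>L W) = range \<iota>'"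
    by (auto simp: image_iff) (metis W2)
  show ?thesis
  proof
    show "\<iota>' o\<^sub>L W \<in> cblin" by (simp add: iota_cblin Wc)
    show "adj (\<iota>' o\<^sub>L W) o\<^sub>L (\<iota>' o\<^sub>L W) = id_blinfun"
    proof (rule blinfun_eqI)
      have "adj \<iota>' (\<iota>' x) = x" for x using iota_isometry by (metis blinfun_apply_blinfun_compose blinfun_apply_id_blinfun id_apply)
      then show "(adj (\<iota>' o\<^sub>L W) o\<^sub>L (\<iota>' o\<^sub>L W)) x = id_blinfun x" for x
        by (simp add: adj_compose iota_cblin Wc W1)
    qed
    show "(\<iota>' o\<^sub>L W) o\<^sub>L adj (T i) = adj (\<rho> (B i)) o\<^sub>L (\<iota>' o\<^sub>L W)" for i
      by (rule blinfun_eqI)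
        (simp add: T(2) adj_compose adj_cblin adj_adj Wc T_cblin W2 dilation_apply)
    show "\<Inter>{M. closed M \<and> csubspace M \<and> M \<subseteq> K \<and> range (\<iota>' o\<^sub>L W) \<subseteq> M \<and>
      (\<forall>i. \<rho> (B i) ` M \<subseteq> M \<and> adj (\<rho> (B i)) ` M \<subseteq> M)} = K"
      unfolding r by (rule cyclic)
    show "T i \<in> cblin" for i by (rule T(1))
  qed (use dense in \<open>simp_all add: A_cblin A_closed A_csubspace A_adj A_compose E_in E_left E_right
      B_in rep K rho_E iota_in\<close>)
qed


section \<open>Direct sums\<close>

lemma op_dsum_apply: "op_dsum A B x = (A (fst x), B (snd x))"
  by (simp add: op_dsum.rep_eq)

lemma op_dsum_cblin: "A \<in> cblin \<Longrightarrow> B \<in> cblin \<Longrightarrow> op_dsum A B \<in> cblin"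
  by (simp add: cblin_def op_dsum_apply scaleC_prod_def)

lemma adj_op_dsum:
  fixes A :: "'a::chilbert_space \<Rightarrow>\<^sub>L 'b::complex_inner" and B :: "'c::chilbert_space \<Rightarrow>\<^sub>L 'd::complex_inner"
  assumes "A \<in> cblin" "B \<in> cblin"
  shows "adj (op_dsum A B) = op_dsum (adj A) (adj B)"
  by (rule adj_eqI) (simp add: op_dsum_apply cinner_prod_def cinner_adj_left assms)

lemma op_dsum_compose: "op_dsum A B o\<^sub>L op_dsum C D = op_dsum (A o\<^sub>L C) (B o\<^sub>L D)"
  by (rule blinfun_eqI) (simp add: op_dsum_apply)

lemma op_dsum_add: "op_dsum (A + C) (B + D) = op_dsum A B + op_dsum C D"
  by (rule blinfun_eqI) (simp add: op_dsum_apply blinfun.add_left)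

lemma op_dsum_scaleC: "op_dsum (c *\<^sub>C A) (c *\<^sub>C B) = c *\<^sub>C op_dsum A B"
  by (rule blinfun_eqI) (simp add: op_dsum_apply scaleC_prod_def)

lemma op_dsum_eq_iff: "op_dsum A B = op_dsum C D \<longleftrightarrow> A = C \<and> B = D"
proof
  assume eq: "op_dsum A B = op_dsum C D"
  have "A x = C x" for x using arg_cong[OF eq, of "\<lambda>X. fst (blinfun_apply X (x, 0))"] by (simp add: op_dsum_apply)
  moreover have "B x = D x" for x using arg_cong[OF eq, of "\<lambda>X. snd (blinfun_apply X (0, x))"] by (simp add: op_dsum_apply)
  ultimately show "A = C \<and> B = D" by (auto intro: blinfun_eqI)
qed simp

lemma orth_compl_Times:
  assumes "0 \<in> M" "0 \<in> N"
  shows "orth_compl (M \<times> N) = orth_compl M \<times> orth_compl N"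
proof -
  have "x \<in> orth_compl M \<and> y \<in> orth_compl N" if "(x, y) \<in> orth_compl (M \<times> N)" for x y
  proof -
    have z: "cinner z (x, y) = 0" if "z \<in> M \<times> N" for z
      using that \<open>(x, y) \<in> orth_compl (M \<times> N)\<close> by (auto simp: orth_compl_def)
    have "cinner m x = 0" if "m \<in> M" for m using z[of "(m, 0)"] that assms by (simp add: cinner_prod_def)
    moreover have "cinner n y = 0" if "n \<in> N" for n
      using z[of "(0, n)"] that assms by (simp add: cinner_prod_def)
    ultimately show ?thesis by (simp add: orth_compl_def)
  qed
  moreover have "(x, y) \<in> orth_compl (M \<times> N)" if "x \<in> orth_compl M" "y \<in> orth_compl N" for x y
    using that by (simp add: orth_compl_def cinner_prod_def)
  ultimately show ?thesis by auto
qed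

lemma orth_proj_Times:
  assumes M: "closed_csubspace M" and N: "closed_csubspace N"
  shows "orth_proj (M \<times> N) = op_dsum (orth_proj M) (orth_proj N)"
proof (rule blinfun_eqI)
  interpret M: closed_csubspace M by fact
  interpret N: closed_csubspace N by fact
  interpret MN: closed_csubspace "M \<times> N" by (rule closed_csubspace_Times[OF M N])
  fix x :: "'a \<times> 'b"
  show "orth_proj (M \<times> N) x = op_dsum (orth_proj M) (orth_proj N) x"
  proof (rule orth_proj_eqI[OF MN.csub MN.clo])
    show "op_dsum (orth_proj M) (orth_proj N) x \<in> M \<times> N"
      by (simp add: op_dsum_apply M.orth_proj_in N.orth_proj_in)
    show "x - op_dsum (orth_proj M) (orth_proj N) x \<in> orth_compl (M \<times> N)"
      using M.orth_proj_diff[of "fst x"] N.orth_proj_diff[of "snd x"]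
      by (cases x) (simp add: orth_compl_Times cvs.subspace_0 M.csub N.csub op_dsum_apply)
  qed
qed

lemma op_dsum_bop_iff:
  assumes "\<Lambda> \<in> cblin" "\<Gamma> \<in> cblin"
    "closed_csubspace M" "closed_csubspace M'" "closed_csubspace N" "closed_csubspace N'"
  shows "op_dsum \<Lambda> \<Gamma> \<in> bop (M \<times> M') (N \<times> N') \<longleftrightarrow> \<Lambda> \<in> bop M N \<and> \<Gamma> \<in> bop M' N'"
  using assms
  by (simp add: bop_def orth_proj_Times op_dsum_compose op_dsum_eq_iff op_dsum_cblin)

lemma unitary_op_dsum_iff:
  assumes c: "\<Lambda> \<in> cblin" "\<Gamma> \<in> cblin"
    and s: "closed_csubspace M" "closed_csubspace M'" "closed_csubspace N" "closed_csubspace N'"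
  shows "unitary (M \<times> M') (N \<times> N') (op_dsum \<Lambda> \<Gamma>) \<longleftrightarrow> unitary M N \<Lambda> \<and> unitary M' N' \<Gamma>"
  unfolding unitary_def isometry_def
  by (auto simp: op_dsum_bop_iff[OF c s] adj_op_dsum c op_dsum_compose orth_proj_Times s op_dsum_eq_iff)

text \<open>\<open>UM\<close> makes one off-diagonal corner of U zero, and \<open>UN\<close> the
  other by duality; the diagonal blocks then inherit unitarity.\<close>

lemma unitary_block_diagonal:
  fixes M :: "'a::chilbert_space set" and N :: "'b::chilbert_space set"
    and U :: "('a \<times> 'c::chilbert_space) \<Rightarrow>\<^sub>L ('b \<times> 'd::chilbert_space)"
  assumes M: "closed_csubspace M" and N: "closed_csubspace N"
    and U: "unitary (M \<times> UNIV) (N \<times> UNIV) U"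
    and UM: "\<And>y. y \<in> M \<Longrightarrow> snd (U (y, 0)) = 0" and UN: "\<And>y. y \<in> N \<Longrightarrow> snd (adj U (y, 0)) = 0"
  shows "\<exists>\<Lambda> \<Gamma>. U = op_dsum \<Lambda> \<Gamma> \<and> unitary M N \<Lambda> \<and> unitary UNIV UNIV \<Gamma>"
proof -
  interpret M: closed_csubspace M by fact
  interpret N: closed_csubspace N by fact
  have MU: "closed_csubspace (M \<times> (UNIV :: 'c set))" and NU: "closed_csubspace (N \<times> (UNIV :: 'd set))"
    by (simp_all add: closed_csubspace_Times M N)
  have Uc: "U \<in> cblin" by (rule unitary_cblin[OF MU NU U])
  have Ubop: "U \<in> bop (M \<times> UNIV) (N \<times> UNIV)" using U by (simp add: unitary_def isometry_def)
  have bl: "bounded_linear (\<lambda>y. fst (U (y, 0)))" "bounded_linear (\<lambda>k. snd (U (0, k)))"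
    by (intro bounded_linear_intros blinfun.bounded_linear_right bounded_linear_ident bounded_linear_Pair
        bounded_linear_compose[OF bounded_linear_fst] bounded_linear_compose[OF bounded_linear_snd]
        bounded_linear_compose[OF blinfun.bounded_linear_right] bounded_linear_zero)+
  define \<Lambda> where "\<Lambda> = Blinfun (\<lambda>y. fst (U (y, 0)))"
  define \<Gamma> where "\<Gamma> = Blinfun (\<lambda>k. snd (U (0, k)))"
  have L: "\<Lambda> y = fst (U (y, 0))" and G: "\<Gamma> k = snd (U (0, k))" for y k
    unfolding \<Lambda>_def \<Gamma>_def by (simp_all add: bounded_linear_Blinfun_apply bl)
  have sc: "U (c *\<^sub>C y, 0) = c *\<^sub>C U (y, 0)" "U (0, c *\<^sub>C k) = c *\<^sub>C U (0, k)" for c y k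
    using cblin_scaleC[OF Uc, of c "(y, 0)"] cblin_scaleC[OF Uc, of c "(0, k)"] by (simp_all add: scaleC_prod_def)
  have c: "\<Lambda> \<in> cblin" "\<Gamma> \<in> cblin" by (simp_all add: cblin_def L G sc)
  \<comment> \<open>General y reduce to M because U vanishes on the orthogonal complement of its
    domain.\<close>
  have 1: "snd (U (y, 0)) = 0" for y
  proof -
    have "U (y, 0) = U (orth_proj (M \<times> UNIV) (y, 0))"
      by (rule bop_apply_orth_proj[OF MU NU Ubop, symmetric])
    also have "\<dots> = U (orth_proj M y, 0)"
      by (simp add: orth_proj_Times[OF M] op_dsum_apply)
    finally show ?thesis by (simp add: UM M.orth_proj_in)
  qed
  have 2: "fst (U (0, k)) = 0" for k
  proof -
    define z where "z = fst (U (0, k))"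
    have "z \<in> N" using unitary_in[OF MU NU U, of "(0, k)"] by (auto simp: z_def mem_Times_iff)
    have "cinner z z = cinner (z, 0) (U (0, k))" by (simp add: cinner_prod_def z_def)
    also have "\<dots> = cinner (adj U (z, 0)) (0, k)" by (rule cinner_adj_left[OF Uc, symmetric])
    also have "\<dots> = 0" using UN[OF \<open>z \<in> N\<close>] by (simp add: cinner_prod_def)
    finally show ?thesis by (simp add: z_def)
  qed
  have U_eq: "U = op_dsum \<Lambda> \<Gamma>"
  proof (rule blinfun_eqI)
    fix x :: "'a \<times> 'c"
    have "U x = U ((fst x, 0) + (0, snd x))" by simp
    also have "\<dots> = U (fst x, 0) + U (0, snd x)" by (simp only: blinfun.add_right)
    finally show "U x = op_dsum \<Lambda> \<Gamma> x"
      by (simp add: op_dsum_apply L G prod_eq_iff 1 2)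
  qed
  moreover have "unitary M N \<Lambda> \<and> unitary UNIV UNIV \<Gamma>"
    using U unfolding U_eq by (subst (asm) unitary_op_dsum_iff) (simp_all add: c M N)
  ultimately show ?thesis by blast
qed


section \<open>Hilbert space dimension\<close>

definition orthonormal :: "'a::complex_inner set \<Rightarrow> bool" where
  "orthonormal B \<longleftrightarrow> (\<forall>x\<in>B. \<forall>y\<in>B. cinner x y = (if x = y then 1 else 0))"

text \<open>\<open>hilbert_dim\<close> selects a basis with \<open>SOME\<close>, so existence must
  be secured. A maximal orthonormal subset of M spans densely: otherwise a normalised remainder
  orthogonal to it could be added.\<close>

lemma orthonormal_basis_exists:
  fixes M :: "'a::chilbert_space set"
  assumes "closed_csubspace M"
  shows "\<exists>B. orthonormal_basis M B"
proof -
  interpret M: closed_csubspace M by fact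
  have "\<exists>B\<in>{B. B \<subseteq> M \<and> orthonormal B}. \<forall>X\<in>{B. B \<subseteq> M \<and> orthonormal B}. B \<subseteq> X \<longrightarrow> X = B"
  proof (rule subset_Zorn')
    fix C assume C: "subset.chain {B. B \<subseteq> M \<and> orthonormal B} C"
    have "cinner x y = (if x = y then 1 else 0)" if xy: "x \<in> \<Union> C" "y \<in> \<Union> C" for x y
    proof -
      obtain X Y where "X \<in> C" "Y \<in> C" "x \<in> X" "y \<in> Y" using xy by blast
      then obtain Z where "Z \<in> C" "x \<in> Z" "y \<in> Z"
        using C unfolding subset_chain_def by blast
      then show ?thesis using C unfolding subset_chain_def orthonormal_def by blast
    qed
    moreover have "\<Union> C \<subseteq> M" using C unfolding subset_chain_def by blast
    ultimately show "\<Union> C \<in> {B. B \<subseteq> M \<and> orthonormal B}" by (simp add: orthonormal_def)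
  qed
  then obtain B where "B \<in> {B. B \<subseteq> M \<and> orthonormal B}"
    and "\<forall>X\<in>{B. B \<subseteq> M \<and> orthonormal B}. B \<subseteq> X \<longrightarrow> X = B" by (rule bexE)
  then have B: "B \<subseteq> M" "orthonormal B"
    and max: "X \<subseteq> M \<Longrightarrow> orthonormal X \<Longrightarrow> B \<subseteq> X \<Longrightarrow> X = B" for X by simp_all
  let ?S = "closure (cspan B)"
  interpret S: closed_csubspace ?S by simp
  have sub: "?S \<subseteq> M" by (rule closure_cspan_minimal) (simp_all add: B M.csub M.clo)
  have "M \<subseteq> ?S"
  proof
    fix x assume x: "x \<in> M"
    define z where "z = x - orth_proj ?S x"
    have zM: "z \<in> M"
      unfolding z_def by (rule cvs.subspace_diff[OF M.csub x]) (use sub S.orth_proj_in in blast)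
    have zB: "cinner b z = 0" if "b \<in> B" for b
      using S.orth_proj_diff[of x] closure_cspan_superset[of B] that by (auto simp: z_def orth_compl_def)
    have "z = 0"
    proof (rule ccontr)
      assume "z \<noteq> 0"
      define u where "u = of_real (inverse (norm z)) *\<^sub>C z"
      have "norm u = 1" using \<open>z \<noteq> 0\<close> by (simp add: u_def norm_scaleC norm_inverse)
      then have uu: "cinner u u = 1" by (simp add: cinner_self)
      have uB: "cinner b u = 0 \<and> cinner u b = 0" if "b \<in> B" for b
        using zB[OF that] cinner_eq_0_commute[of b z] by (simp add: u_def cinner_algebra)
      have "orthonormal (insert u B)"
        using B(2) uu uB by (auto simp: orthonormal_def)
      moreover have "insert u B \<subseteq> M" using B zM by (simp add: u_def cvs.subspace_scale M.csub)
      ultimately have "u \<in> B" using max by blast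
      then show False using uB[of u] uu by simp
    qed
    then show "x \<in> ?S" using S.orth_proj_in[of x] by (simp add: z_def)
  qed
  then have "?S = M" using sub by (rule antisym[rotated])
  then have "orthonormal_basis M B" using B by (simp add: orthonormal_basis_def orthonormal_def)
  then show ?thesis by blast
qed

text \<open>Distinct orthonormal vectors have squared distance 2, so points of a countable dense set
  chosen within 1/2 of them are distinct.\<close>

lemma orthonormal_countable:
  fixes B :: "'a::complex_inner set"
  assumes sep: "separable_space (euclidean :: 'a topology)" and B: "orthonormal B"
  shows "countable B"
proof -
  obtain C :: "'a set" where C: "countable C" "closure C = UNIV"
    using sep by (auto simp: separable_space_def)
  have "\<forall>b. \<exists>c\<in>C. dist c b < 1 / 2"
    using C(2) closure_approachable[of _ C] by (metis UNIV_I half_gt_zero_iff zero_less_one)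
  then obtain c where c: "\<And>b. c b \<in> C" "\<And>b. dist (c b) b < 1 / 2" by metis
  have "inj_on c B"
  proof (rule inj_onI, rule ccontr)
    fix x y assume xy: "x \<in> B" "y \<in> B" "c x = c y" "x \<noteq> y"
    have "norm (x - y) < 1"
      using dist_triangle_half_r[of "c x" x 1 y] c(2)[of x] c(2)[of y] xy(3) by (simp add: dist_norm)
    then have "(norm (x - y))\<^sup>2 < 1" by (simp add: power_less_one_iff abs_square_less_1)
    moreover have "(norm (x - y))\<^sup>2 = 2"
      using B xy unfolding orthonormal_def by (simp add: norm_sq_cinner cinner_algebra)
    ultimately show False by simp
  qed
  moreover have "countable (c ` B)" using C(1) c(1) by (blast intro: countable_subset)
  ultimately show ?thesis by (rule countable_image_inj_on[rotated])
qed

lemma orthonormal_independent: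
  assumes "orthonormal B"
  shows "cvs.independent B"
  unfolding cvs.dependent_def
proof clarify
  fix b assume b: "b \<in> B" "b \<in> cspan (B - {b})"
  have "cspan (B - {b}) \<subseteq> orth_compl {b}"
    using assms b by (intro cvs.span_minimal csubspace_orth_compl) (auto simp: orth_compl_def orthonormal_def)
  then show False using assms b by (auto simp: orth_compl_def orthonormal_def)
qed

text \<open>For finite B the Fourier expansion, valid on B, extends to the closed span by
  continuity; so the closed span is the algebraic one, and the exchange lemma bounds the size of
  F.\<close>

lemma orthonormal_finite_card_le:
  fixes B :: "'a::complex_inner set"
  assumes B: "orthonormal B" "finite B" and F: "orthonormal F" "F \<subseteq> closure (cspan B)"
  shows "finite F \<and> card F \<le> card B"
proof (rule cvs.independent_span_bound[OF B(2) orthonormal_independent[OF F(1)]])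
  show "F \<subseteq> cspan B"
  proof
    fix f assume "f \<in> F"
    then have f: "f \<in> closure (cspan B)" using F by blast
    have "id f = (\<Sum>b\<in>B. cinner b f *\<^sub>C b)"
    proof (rule closure_cspan_eqI[OF _ f])
      show "bounded_linear (\<lambda>x. \<Sum>b\<in>B. cinner b x *\<^sub>C b)"
      proof (intro bounded_linear_sum)
        fix b :: 'a
        show "bounded_linear (\<lambda>x. cinner b x *\<^sub>C b)"
        proof (rule bounded_linear_intro[where K = "norm b * norm b"])
          show "norm (cinner b x *\<^sub>C b) \<le> norm x * (norm b * norm b)" for x
            using mult_right_mono[OF Cauchy_Schwarz_cinner[of b x] norm_ge_zero[of b]]
            by (simp add: norm_scaleC mult_ac)
        qed (simp_all add: cinner_algebra scaleC_add_left scaleC_scaleC flip: scaleC_of_real)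
      qed
      show "id s = (\<Sum>b\<in>B. cinner b s *\<^sub>C b)" if "s \<in> B" for s
      proof -
        have "(\<Sum>b\<in>B. cinner b s *\<^sub>C b) = (\<Sum>b\<in>B. if b = s then s else 0)"
          using B that by (intro sum.cong) (auto simp: orthonormal_def)
        then show ?thesis using B(2) that by simp
      qed
    qed (simp_all add: bounded_linear_ident id_def cinner_algebra scaleC_scaleC cvs.scale_sum_right)
    then show "f \<in> cspan B"
      by (metis (no_types, lifting) id_apply cvs.span_base cvs.span_scale cvs.span_sum)
  qed
qed

text \<open>The image of the chosen basis of M and the chosen basis of N are both orthonormal bases
  of N. If one is finite, comparison in both directions gives equal size; otherwise separability
  makes both countably infinite.\<close>

lemma hilbert_dim_ordIso:
  fixes M :: "'a::chilbert_space set" and N :: "'b::chilbert_space set"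
  assumes M: "closed_csubspace M" and N: "closed_csubspace N"
    and sep: "separable_space (euclidean :: 'a topology)" "separable_space (euclidean :: 'b topology)"
    and \<Phi>: "bounded_linear \<Phi>" "\<And>c x. \<Phi> (c *\<^sub>C x) = c *\<^sub>C \<Phi> x" "\<Phi> ` M = N"
    and iso: "\<And>x y. x \<in> M \<Longrightarrow> y \<in> M \<Longrightarrow> cinner (\<Phi> x) (\<Phi> y) = cinner x y"
  shows "(hilbert_dim M, hilbert_dim N) \<in> ordIso"
proof -
  interpret N: closed_csubspace N by fact
  define B where "B = (SOME B. orthonormal_basis M B)"
  define C where "C = (SOME C. orthonormal_basis N C)"
  have "orthonormal_basis M B" "orthonormal_basis N C"
    unfolding B_def C_def using orthonormal_basis_exists M N someI_ex by metis+
  then have B: "B \<subseteq> M" "orthonormal B" "closure (cspan B) = M"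
    and C: "C \<subseteq> N" "orthonormal C" "closure (cspan C) = N"
    by (auto simp: orthonormal_basis_def orthonormal_def)
  have \<Phi>B: "orthonormal (\<Phi> ` B)" and inj: "inj_on \<Phi> B"
  proof -
    have *: "cinner (\<Phi> x) (\<Phi> y) = (if x = y then 1 else 0)" if "x \<in> B" "y \<in> B" for x y
      using iso[OF subsetD[OF B(1) that(1)] subsetD[OF B(1) that(2)]] B(2) that
      by (simp add: orthonormal_def)
    show inj: "inj_on \<Phi> B"
      by (rule inj_onI) (metis * zero_neq_one)
    show "orthonormal (\<Phi> ` B)"
      using * by (auto simp: orthonormal_def inj_on_eq_iff[OF inj])
  qed
  have span: "N \<subseteq> closure (cspan (\<Phi> ` B))"
  proof -
    have "closure (cspan B) \<subseteq> \<Phi> -` closure (cspan (\<Phi> ` B))"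
    proof (rule closure_cspan_minimal)
      show "B \<subseteq> \<Phi> -` closure (cspan (\<Phi> ` B))" using closure_cspan_superset[of "\<Phi> ` B"] by blast
      show "csubspace (\<Phi> -` closure (cspan (\<Phi> ` B)))"
        using \<Phi>(1) by (intro csubspaceI)
          (auto simp: linear_simps \<Phi>(2) cvs.subspace_0 cvs.subspace_add cvs.subspace_scale)
      show "closed (\<Phi> -` closure (cspan (\<Phi> ` B)))"
        by (intro closed_vimage closed_closure linear_continuous_on \<Phi>)
    qed
    then show ?thesis using B(3) \<Phi>(3) by blast
  qed
  have "\<exists>g. bij_betw g (\<Phi> ` B) C"
  proof (cases "finite (\<Phi> ` B) \<or> finite C")
    case True
    have "\<Phi> ` B \<subseteq> closure (cspan C)" "C \<subseteq> closure (cspan (\<Phi> ` B))"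
      using B(1) C \<Phi>(3) span by blast+
    then have "finite (\<Phi> ` B)" "finite C" "card (\<Phi> ` B) = card C"
      using True orthonormal_finite_card_le[OF \<Phi>B _ C(2)] orthonormal_finite_card_le[OF C(2) _ \<Phi>B]
      by (auto intro: le_antisym)
    then show ?thesis by (rule finite_same_card_bij)
  next
    case False
    then have "bij_betw (to_nat_on (\<Phi> ` B)) (\<Phi> ` B) UNIV" "bij_betw (to_nat_on C) C UNIV"
      using orthonormal_countable[OF sep(2)] \<Phi>B C(2) by (auto intro: to_nat_on_infinite)
    then show ?thesis using bij_betw_trans bij_betw_inv_into by blast
  qed
  then obtain g where "bij_betw g (\<Phi> ` B) C" by blast
  moreover have "bij_betw \<Phi> B (\<Phi> ` B)" using inj by (simp add: bij_betw_def)
  ultimately have "\<exists>h. bij_betw h B C" using bij_betw_trans by blast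
  then show ?thesis
    unfolding hilbert_dim_def B_def[symmetric] C_def[symmetric] card_of_ordIso .
qed


section \<open>Constrained dilations\<close>

definition dil_rep :: "('n fock \<Rightarrow>\<^sub>L 'n fock) set \<Rightarrow> ('n::finite \<Rightarrow> 'h::chilbert_space \<Rightarrow>\<^sub>L 'h) \<Rightarrow>
    (('n fock \<Rightarrow>\<^sub>L 'n fock) \<Rightarrow> ('k::chilbert_space \<Rightarrow>\<^sub>L 'k)) \<Rightarrow>
    ('n fock \<Rightarrow>\<^sub>L 'n fock) \<Rightarrow> ((('n list, 'h) ell2 \<times> 'k) \<Rightarrow>\<^sub>L (('n list, 'h) ell2 \<times> 'k))" where
  "dil_rep J T \<pi> A = op_dsum (tensor_id (model_space J) (defect_space T) A) (\<pi> A)"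

lemma dil_op_eq: "dil_op J T \<pi> i = dil_rep J T \<pi> (model_op J i)"
  by (simp add: dil_op_def coupled_op_def dil_rep_def)

lemma row_contraction_cblin: "row_contraction T \<Longrightarrow> T i \<in> cblin"
  unfolding row_contraction_def by blast

lemma defect_space_closed_csubspace:
  fixes T :: "'n::finite \<Rightarrow> 'h::chilbert_space \<Rightarrow>\<^sub>L 'h"
  assumes T: "row_contraction T"
  shows "closed_csubspace (defect_space T)"
proof -
  define X where "X = (\<Sum>i\<in>UNIV. T i o\<^sub>L adj (T i))"
  have c: "T i \<in> cblin" for i using T by (rule row_contraction_cblin)
  have "X \<in> cblin" unfolding X_def by (rule cblin_sum) (simp add: c adj_cblin)
  moreover have "cinner x (X x) = of_real (\<Sum>i\<in>UNIV. (norm (adj (T i) x))\<^sup>2)" for x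
    by (simp add: X_def blinfun.sum_left cinner_sum_right cinner_adj_left[OF c, symmetric] cinner_self)
  \<comment> \<open>The root in \<open>defect_op\<close> is a \<open>THE\<close>, known to exist for
    operators between 0 and I; this is the upper bound.\<close>
  ultimately have "positive_op (id_blinfun - (id_blinfun - X))"
    by (simp add: positive_op_def complex_nonneg_Reals_iff sum_nonneg)
  moreover have "positive_op (id_blinfun - X)" using T by (simp add: row_contraction_def X_def)
  ultimately have "positive_op (defect_op T)"
    unfolding defect_op_def X_def[symmetric] by (intro positive_op_sqrt)
  then have d: "defect_op T \<in> cblin" by (simp add: positive_op_def)
  have "csubspace (range (defect_op T))"
  proof (rule csubspaceI)
    show "0 \<in> range (defect_op T)" by (rule range_eqI[of _ _ 0]) simp
    show "x + y \<in> range (defect_op T)" if "x \<in> range (defect_op T)" "y \<in> range (defect_op T)" for x y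
      using that by (auto simp flip: blinfun.add_right)
    show "c *\<^sub>C x \<in> range (defect_op T)" if "x \<in> range (defect_op T)" for c x
      using that by (auto simp flip: cblin_scaleC[OF d])
  qed
  then show ?thesis by (simp add: defect_space_def closed_csubspace_def csubspace_closure)
qed

lemma bounded_linear_ell2_apply: "bounded_linear (\<lambda>f :: ('i, 'a::real_normed_vector) ell2. ell2_apply f i)"
proof (rule bounded_linear_intro[where K = 1])
  show "norm (ell2_apply f i) \<le> norm f * 1" for f :: "('i, 'a) ell2"
    using L2_set_le_norm_ell2[of "{i}" f] by (simp add: L2_set_def)
qed (simp_all add: plus_ell2.rep_eq scaleR_ell2.rep_eq)

locale fock_dilation = fock_ideal J for J :: "('n::finite fock \<Rightarrow>\<^sub>L 'n fock) set" +
  fixes T :: "'n \<Rightarrow> 'h::chilbert_space \<Rightarrow>\<^sub>L 'h"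
    and \<pi> :: "('n fock \<Rightarrow>\<^sub>L 'n fock) \<Rightarrow> 'k::chilbert_space \<Rightarrow>\<^sub>L 'k"
    and \<iota> :: "'h \<Rightarrow>\<^sub>L (('n list, 'h) ell2 \<times> 'k)"
  assumes dense: "closure (cspan {model_word J \<alpha> o\<^sub>L adj (model_word J \<beta>) |\<alpha> \<beta>. True}) = model_cstar J"
    and row: "row_contraction T"
    and dil: "constrained_dilation J T \<pi> \<iota>"
begin

abbreviation "D \<equiv> defect_space T"

lemma D_closed: "closed_csubspace D"
  by (rule defect_space_closed_csubspace[OF row])

sublocale D: closed_csubspace D by (rule D_closed)

lemma coupled_closed: "closed_csubspace (coupled_space J T)"
  by (simp add: coupled_space_def)

lemma dil_space_closed: "closed_csubspace (dil_space J T :: (('n list, 'h) ell2 \<times> 'k) set)"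
  unfolding dil_space_def by (rule closed_csubspace_Times[OF coupled_closed closed_csubspace_UNIV])

lemma pi_rep: "star_representation (model_cstar J) \<pi>"
  using dil by (simp add: constrained_dilation_def)

lemma pi_cblin: "X \<in> model_cstar J \<Longrightarrow> \<pi> X \<in> cblin"
  using pi_rep by (auto simp: star_representation_def)

lemma pi_adj: "X \<in> model_cstar J \<Longrightarrow> \<pi> (adj X) = adj (\<pi> X)"
  using pi_rep by (auto simp: star_representation_def)

lemma pi_sum: "(\<Sum>i\<in>UNIV. \<pi> (B i) o\<^sub>L adj (\<pi> (B i))) = id_blinfun"
  using dil by (simp add: constrained_dilation_def)

lemma E_compose: "X \<in> bop N N \<Longrightarrow> E o\<^sub>L X = X" "X \<in> bop N N \<Longrightarrow> X o\<^sub>L E = X"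
  by (rule blinfun_eqI; simp add: bop_iff N.orth_proj_id bop_apply_orth_proj[OF N_closed N_closed])+

text \<open>\<open>star_representation\<close> does not ask for a unital map. Here
  \<open>\<pi> E\<close> fixes the ranges of all \<open>\<pi> (B i)\<close>, and by
  \<open>pi_sum\<close> every vector is a sum of vectors from these ranges.\<close>

lemma pi_E: "\<pi> E = id_blinfun"
proof -
  have "\<pi> E o\<^sub>L \<pi> (B i) = \<pi> (B i)" for i
  proof -
    have "\<pi> (E o\<^sub>L B i) = \<pi> E o\<^sub>L \<pi> (B i)"
      using pi_rep cstar_unit cstar_B by (simp add: star_representation_def)
    then show ?thesis by (simp add: E_compose B_bop)
  qed
  then have e: "\<pi> E (\<pi> (B i) x) = \<pi> (B i) x" for i x by (metis blinfun_apply_blinfun_compose)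
  have s: "x = (\<Sum>i\<in>UNIV. \<pi> (B i) (adj (\<pi> (B i)) x))" for x
    using arg_cong[OF pi_sum, of "\<lambda>A. blinfun_apply A x"] by (simp add: blinfun.sum_left)
  show ?thesis
  proof (rule blinfun_eqI)
    fix x
    have "\<pi> E x = (\<Sum>i\<in>UNIV. \<pi> E (\<pi> (B i) (adj (\<pi> (B i)) x)))"
      by (subst s) (rule blinfun.sum_right)
    then show "\<pi> E x = id_blinfun x" using s[of x] by (simp add: e)
  qed
qed

lemma tensor_cblin: "X \<in> model_cstar J \<Longrightarrow> tensor_id N D X \<in> cblin"
  using cstar_bop by (blast intro: bop_cblin tensor_id_bop[OF N_closed])

sublocale d: cyclic_dilation "model_cstar J" E B "dil_rep J T \<pi>" "dil_space J T" \<iota> T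
proof (rule cyclic_dilation.intro)
  have b: "X \<in> bop N N" if "X \<in> model_cstar J" for X using that cstar_bop by blast
  show "model_cstar J \<subseteq> cblin" using b bop_cblin by blast
  show "closed (model_cstar J)" "csubspace (model_cstar J)" "adj ` model_cstar J \<subseteq> model_cstar J"
    "E \<in> model_cstar J" "B i \<in> model_cstar J" for i
    by (fact cstar_closed cstar_csubspace cstar_adj cstar_unit cstar_B)+
  show "X o\<^sub>L Y \<in> model_cstar J" if "X \<in> model_cstar J" "Y \<in> model_cstar J" for X Y
    using that by (rule cstar_compose)
  show "E o\<^sub>L X = X" "X o\<^sub>L E = X" if "X \<in> model_cstar J" for X
    using E_compose b that by blast+
  show "closure (cspan {word_op E B \<alpha> o\<^sub>L adj (word_op E B \<beta>) |\<alpha> \<beta>. True}) = model_cstar J"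
    using dense by (simp add: model_word_def)
  show "star_representation (model_cstar J) (dil_rep J T \<pi>)"
    unfolding star_representation_def dil_rep_def
  proof (intro conjI ballI allI)
    show "(\<lambda>A. op_dsum (tensor_id N D A) (\<pi> A)) ` model_cstar J \<subseteq> cblin"
      by (auto intro: op_dsum_cblin tensor_cblin pi_cblin)
    fix X assume X: "X \<in> model_cstar J"
    show "op_dsum (tensor_id N D (c *\<^sub>C X)) (\<pi> (c *\<^sub>C X)) = c *\<^sub>C op_dsum (tensor_id N D X) (\<pi> X)" for c
      using pi_rep X by (simp add: tensor_id_scaleC[OF N_closed b] star_representation_def op_dsum_scaleC)
    show "op_dsum (tensor_id N D (adj X)) (\<pi> (adj X)) = adj (op_dsum (tensor_id N D X) (\<pi> X))"
      by (simp add: tensor_id_adj[OF N_closed b] X pi_adj adj_op_dsum tensor_cblin pi_cblin)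
    fix Y assume Y: "Y \<in> model_cstar J"
    show "op_dsum (tensor_id N D (X + Y)) (\<pi> (X + Y)) =
        op_dsum (tensor_id N D X) (\<pi> X) + op_dsum (tensor_id N D Y) (\<pi> Y)"
      using pi_rep X Y by (simp add: tensor_id_add[OF N_closed b b] star_representation_def op_dsum_add)
    show "op_dsum (tensor_id N D (X o\<^sub>L Y)) (\<pi> (X o\<^sub>L Y)) =
        op_dsum (tensor_id N D X) (\<pi> X) o\<^sub>L op_dsum (tensor_id N D Y) (\<pi> Y)"
      using pi_rep X Y
      by (simp add: tensor_id_compose[OF N_closed b b] star_representation_def op_dsum_compose)
  qed
  show "closed_csubspace (dil_space J T :: (('n list, 'h) ell2 \<times> 'k) set)" by (rule dil_space_closed)
  show "dil_rep J T \<pi> E = orth_proj (dil_space J T)"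
    by (simp add: dil_rep_def dil_space_def coupled_space_def orth_proj_Times pi_E
        tensor_id_orth_proj[OF N_closed orth_proj_bop[OF N_closed]])
  have "isometry UNIV (dil_space J T) \<iota>" using dil by (simp add: constrained_dilation_def)
  then show "\<iota> \<in> cblin" "adj \<iota> o\<^sub>L \<iota> = id_blinfun" "\<iota> h \<in> dil_space J T" for h
    using isometry_UNIV_iff[OF dil_space_closed] by blast+
  show "T i \<in> cblin" for i using row by (rule row_contraction_cblin)
  show "\<iota> o\<^sub>L adj (T i) = adj (dil_rep J T \<pi> (B i)) o\<^sub>L \<iota>" for i
    using dil by (simp add: constrained_dilation_def dil_op_eq)
  show "\<Inter>{M. closed M \<and> csubspace M \<and> M \<subseteq> dil_space J T \<and> range \<iota> \<subseteq> M \<and>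
      (\<forall>i. dil_rep J T \<pi> (B i) ` M \<subseteq> M \<and> adj (dil_rep J T \<pi> (B i)) ` M \<subseteq> M)} = dil_space J T"
    using dil by (simp add: constrained_dilation_def dil_op_eq)
qed

lemma minimal: "minimal_dilation J T \<pi> \<iota>"
  unfolding minimal_dilation_def dil_op_eq d.rho_word[symmetric] by (rule d.K_eq_words)

lemma dil_rep_apply: "dil_rep J T \<pi> X x = (tensor_id N D X (fst x), \<pi> X (snd x))"
  by (simp add: dil_rep_def op_dsum_apply)

lemma dil_rep_tensor:
  "X \<in> model_cstar J \<Longrightarrow> \<xi> \<in> N \<Longrightarrow> d \<in> D \<Longrightarrow> dil_rep J T \<pi> X (\<xi> \<otimes>\<^sub>2 d, 0) = (X \<xi> \<otimes>\<^sub>2 d, 0)"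
  using cstar_bop by (auto simp: dil_rep_apply tensor_id_tensor[OF N_closed])

lemma coupled_space_coefficient: "y \<in> coupled_space J T \<Longrightarrow> ell2_apply y w \<in> D"
proof -
  assume y: "y \<in> coupled_space J T"
  have "coupled_space J T \<subseteq> (\<lambda>y. ell2_apply y w) -` D"
    unfolding coupled_space_def tensor_space_def
  proof (rule closure_cspan_minimal)
    show "closed ((\<lambda>y. ell2_apply y w) -` D)"
      by (intro closed_vimage D.clo linear_continuous_on bounded_linear_ell2_apply)
  qed (auto intro!: csubspaceI simp: zero_ell2.rep_eq plus_ell2.rep_eq scaleC_ell2.rep_eq
      ell2_tensor_apply D.csub cvs.subspace_0 cvs.subspace_add cvs.subspace_scale)
  then show ?thesis using y by blast
qed

text \<open>On elementary tensors this is \<open>defect_B\<close> in the first factor; the second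
  summand contributes 0 because of \<open>pi_sum\<close>.\<close>

lemma dilation_defect:
  assumes "x \<in> dil_space J T"
  shows "x - (\<Sum>i\<in>UNIV. dil_rep J T \<pi> (B i) (dil_rep J T \<pi> (adj (B i)) x)) =
    (fock_basis [] \<otimes>\<^sub>2 ell2_apply (fst x) [], 0)"
proof -
  have y: "fst x \<in> tensor_space N D" using assms by (auto simp: dil_space_def coupled_space_def)
  have adjB: "adj (B i) \<in> model_cstar J" for i using cstar_adj cstar_B by blast
  \<comment> \<open>The first component as one bounded operator, so that its values on elementary
    tensors determine it on their closed span.\<close>
  define q where "q = id_blinfun - (\<Sum>i\<in>UNIV. tensor_id N D (B i) o\<^sub>L tensor_id N D (adj (B i)))"
  have qc: "q \<in> cblin"
    unfolding q_def by (intro cblin_diff cblin_id cblin_sum cblin_compose tensor_cblin cstar_B adjB)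
  have "q z = fock_basis [] \<otimes>\<^sub>2 ell2_apply z []" if z: "z \<in> tensor_space N D" for z
  proof (rule closure_cspan_eqI[OF _ z[unfolded tensor_space_def]])
    show "bounded_linear (\<lambda>z :: ('n list, 'h) ell2. (fock_basis [] :: 'n fock) \<otimes>\<^sub>2 ell2_apply z [])"
      by (rule bounded_linear_compose[OF bounded_linear_ell2_tensor_right bounded_linear_ell2_apply])
    fix s assume "s \<in> {\<xi> \<otimes>\<^sub>2 d |\<xi> d. \<xi> \<in> N \<and> d \<in> D}"
    then obtain \<xi> d where s: "s = \<xi> \<otimes>\<^sub>2 d" "\<xi> \<in> N" "d \<in> D" by blast
    interpret t: bounded_linear "\<lambda>\<xi>. \<xi> \<otimes>\<^sub>2 d" by (rule bounded_linear_ell2_tensor_left)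
    have aN: "adj (B i) \<xi> \<in> N" for i using s(2) by (simp add: adj_B_apply adj_creation_N)
    have "q s = (\<xi> - (\<Sum>i\<in>UNIV. B i (adj (B i) \<xi>))) \<otimes>\<^sub>2 d"
      using s aN by (simp add: q_def blinfun.diff_left blinfun.sum_left t.diff t.sum
          tensor_id_tensor[OF N_closed] B_bop adj_bop[OF N_closed N_closed])
    also have "\<dots> = fock_basis [] \<otimes>\<^sub>2 ell2_apply s []"
      by (simp add: defect_B[OF s(2)] s(1) ell2_tensor_apply ell2_tensor_scaleC_left ell2_tensor_scaleC_right)
    finally show "q s = fock_basis [] \<otimes>\<^sub>2 ell2_apply s []" .
  qed (simp_all add: blinfun.bounded_linear_right cblin_scaleC[OF qc] scaleC_ell2.rep_eq ell2_tensor_scaleC_right)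
  from this[OF y] have "fst x - (\<Sum>i\<in>UNIV. tensor_id N D (B i) (tensor_id N D (adj (B i)) (fst x))) =
      fock_basis [] \<otimes>\<^sub>2 ell2_apply (fst x) []"
    by (simp add: q_def blinfun.diff_left blinfun.sum_left)
  moreover have "snd x - (\<Sum>i\<in>UNIV. \<pi> (B i) (\<pi> (adj (B i)) (snd x))) = 0"
    using arg_cong[OF pi_sum, of "\<lambda>A. blinfun_apply A (snd x)"]
    by (simp add: blinfun.sum_left pi_adj cstar_B)
  ultimately show ?thesis
    by (simp add: prod_eq_iff fst_sum snd_sum dil_rep_apply)
qed

lemma vacuum_tensor_in: "d \<in> D \<Longrightarrow> (fock_basis [] \<otimes>\<^sub>2 d, 0) \<in> dil_space J T"
  by (simp add: dil_space_def coupled_space_def ell2_tensor_in_tensor_space vacuum_N)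

end

text \<open>The vacuum tensored with d is fixed by the operator of \<open>dilation_defect\<close>
  for the first dilation. U carries that operator to its counterpart for the second, so the image is
  fixed there and has the stated shape.\<close>

lemma intertwiner_vacuum:
  fixes T :: "'n::finite \<Rightarrow> 'h::chilbert_space \<Rightarrow>\<^sub>L 'h" and \<pi> :: "('n fock \<Rightarrow>\<^sub>L 'n fock) \<Rightarrow> 'k::chilbert_space \<Rightarrow>\<^sub>L 'k"
  assumes "fock_dilation J T \<pi> \<iota>" "fock_dilation J T' \<pi>' \<iota>'"
    and U: "unitary (dil_space J T) (dil_space J T') U"
    and int: "\<And>X. X \<in> model_cstar J \<Longrightarrow> U o\<^sub>L dil_rep J T \<pi> X = dil_rep J T' \<pi>' X o\<^sub>L U"
    and d: "d \<in> defect_space T"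
  shows "\<exists>d'\<in>defect_space T'. U (fock_basis [] \<otimes>\<^sub>2 d, 0) = (fock_basis [] \<otimes>\<^sub>2 d', 0)"
proof -
  interpret t: fock_dilation J T \<pi> \<iota> by fact
  interpret t': fock_dilation J T' \<pi>' \<iota>' by fact
  define x :: "('n list, 'h) ell2 \<times> 'k" where "x = (fock_basis [] \<otimes>\<^sub>2 d, 0)"
  have x: "x \<in> dil_space J T" unfolding x_def by (rule t.vacuum_tensor_in[OF d])
  have Ux: "U x \<in> dil_space J T'" by (rule unitary_in[OF t.dil_space_closed t'.dil_space_closed U])
  have adjB: "adj (model_op J i) \<in> model_cstar J" for i using t.cstar_adj t.cstar_B by blast
  have i: "U (dil_rep J T \<pi> X y) = dil_rep J T' \<pi>' X (U y)" if "X \<in> model_cstar J" for X y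
    using arg_cong[OF int[OF that], of "\<lambda>A. blinfun_apply A y"] by simp
  have "x = (fock_basis [] \<otimes>\<^sub>2 ell2_apply (fst x) [], 0)"
    by (simp add: x_def ell2_tensor_apply fock_basis.rep_eq)
  then have "U x = U (x - (\<Sum>i\<in>UNIV. dil_rep J T \<pi> (model_op J i) (dil_rep J T \<pi> (adj (model_op J i)) x)))"
    using t.dilation_defect[OF x] by simp
  also have "\<dots> = U x - (\<Sum>i\<in>UNIV. dil_rep J T' \<pi>' (model_op J i) (dil_rep J T' \<pi>' (adj (model_op J i)) (U x)))"
    by (simp add: blinfun.diff_right blinfun.sum_right i t.cstar_B adjB)
  also have "\<dots> = (fock_basis [] \<otimes>\<^sub>2 ell2_apply (fst (U x)) [], 0)" by (rule t'.dilation_defect[OF Ux])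
  finally have "U x = (fock_basis [] \<otimes>\<^sub>2 ell2_apply (fst (U x)) [], 0)" .
  moreover have "ell2_apply (fst (U x)) [] \<in> defect_space T'"
    using Ux by (auto simp: dil_space_def intro: t'.coupled_space_coefficient)
  ultimately show ?thesis unfolding x_def[symmetric] by blast
qed

text \<open>Words in the model tuple applied to the vacuum span N densely, and U carries their
  action to the second dilation. So U only replaces d by d' in such tensors and creates no
  \<pi>-component.\<close>

lemma intertwiner_coupled:
  fixes T :: "'n::finite \<Rightarrow> 'h::chilbert_space \<Rightarrow>\<^sub>L 'h" and \<pi> :: "('n fock \<Rightarrow>\<^sub>L 'n fock) \<Rightarrow> 'k::chilbert_space \<Rightarrow>\<^sub>L 'k"
  assumes "fock_dilation J T \<pi> \<iota>" "fock_dilation J T' \<pi>' \<iota>'"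
    and U: "unitary (dil_space J T) (dil_space J T') U"
    and int: "\<And>X. X \<in> model_cstar J \<Longrightarrow> U o\<^sub>L dil_rep J T \<pi> X = dil_rep J T' \<pi>' X o\<^sub>L U"
    and y: "y \<in> coupled_space J T"
  shows "snd (U (y, 0)) = 0"
proof -
  interpret t: fock_dilation J T \<pi> \<iota> by fact
  interpret t': fock_dilation J T' \<pi>' \<iota>' by fact
  have Uc: "U \<in> cblin" by (rule unitary_cblin[OF t.dil_space_closed t'.dil_space_closed U])
  have bl: "bounded_linear (\<lambda>y. snd (U (y, 0)))"
    by (intro bounded_linear_compose[OF bounded_linear_snd]
        bounded_linear_compose[OF blinfun.bounded_linear_right] bounded_linear_Pair bounded_linear_ident
        bounded_linear_zero)
  have sc: "snd (U (c *\<^sub>C y, 0)) = c *\<^sub>C snd (U (y, 0))" for c y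
    using cblin_scaleC[OF Uc, of c "(y, 0)"] by (simp add: scaleC_prod_def)
  have i: "U (dil_rep J T \<pi> X y) = dil_rep J T' \<pi>' X (U y)" if "X \<in> model_cstar J" for X y
    using arg_cong[OF int[OF that], of "\<lambda>A. blinfun_apply A y"] by simp
  have gen: "snd (U (\<xi> \<otimes>\<^sub>2 d, 0)) = 0" if \<xi>: "\<xi> \<in> model_space J" and d: "d \<in> defect_space T" for \<xi> d
  proof (rule closure_cspan_eqI[OF _ subsetD[OF equalityD1[OF t.N_eq_closure] \<xi>]])
    show "bounded_linear (\<lambda>\<xi> :: 'n fock. snd (U (\<xi> \<otimes>\<^sub>2 d, 0)))"
      by (rule bounded_linear_compose[OF bl bounded_linear_ell2_tensor_left])
    fix s assume "s \<in> {orth_proj (model_space J) (fock_basis \<alpha>) |\<alpha>. True}"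
    then obtain \<alpha> where "s = orth_proj (model_space J) (fock_basis \<alpha>)" by blast
    then have s: "s = word_op (orth_proj (model_space J)) (model_op J) \<alpha> (fock_basis [])"
      by (simp only: t.word_op_B_vacuum)
    obtain d' where d': "d' \<in> defect_space T'" "U (fock_basis [] \<otimes>\<^sub>2 d, 0) = (fock_basis [] \<otimes>\<^sub>2 d', 0)"
      using intertwiner_vacuum[OF assms(1,2) U int d] by blast
    have "U (s \<otimes>\<^sub>2 d, 0) = U (dil_rep J T \<pi> (word_op (orth_proj (model_space J)) (model_op J) \<alpha>) (fock_basis [] \<otimes>\<^sub>2 d, 0))"
      unfolding s by (subst t.dil_rep_tensor[OF t.d.word_in t.vacuum_N d]) simp
    also have "\<dots> = (s \<otimes>\<^sub>2 d', 0)"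
      unfolding i[OF t.d.word_in] d'(2) s by (rule t'.dil_rep_tensor[OF t.d.word_in t.vacuum_N d'(1)])
    finally show "snd (U (s \<otimes>\<^sub>2 d, 0)) = 0" by simp
  qed (simp_all add: ell2_tensor_scaleC_left sc bounded_linear_zero)
  show ?thesis
    by (rule closure_cspan_eqI[OF _ y[unfolded coupled_space_def tensor_space_def] bl bounded_linear_zero])
      (auto simp: gen sc)
qed

text \<open>This allows the intertwiner lemmas to be applied to the inverse of U. The hypothesis is
  used at \<open>adj X\<close>, and adjoints are taken on both sides.\<close>

lemma intertwiner_adj:
  fixes T :: "'n::finite \<Rightarrow> 'h::chilbert_space \<Rightarrow>\<^sub>L 'h" and \<pi> :: "('n fock \<Rightarrow>\<^sub>L 'n fock) \<Rightarrow> 'k::chilbert_space \<Rightarrow>\<^sub>L 'k"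
  assumes "fock_dilation J T \<pi> \<iota>" "fock_dilation J T' \<pi>' \<iota>'"
    and U: "unitary (dil_space J T) (dil_space J T') U"
    and int: "\<And>X. X \<in> model_cstar J \<Longrightarrow> U o\<^sub>L dil_rep J T \<pi> X = dil_rep J T' \<pi>' X o\<^sub>L U"
    and X: "X \<in> model_cstar J"
  shows "adj U o\<^sub>L dil_rep J T' \<pi>' X = dil_rep J T \<pi> X o\<^sub>L adj U"
proof -
  interpret t: fock_dilation J T \<pi> \<iota> by fact
  interpret t': fock_dilation J T' \<pi>' \<iota>' by fact
  have Uc: "U \<in> cblin" by (rule unitary_cblin[OF t.dil_space_closed t'.dil_space_closed U])
  have aX: "adj X \<in> model_cstar J" and Xc: "X \<in> cblin"
    using X t.cstar_adj t.d.A_cblin by blast+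
  have "adj (U o\<^sub>L dil_rep J T \<pi> (adj X)) = adj (dil_rep J T' \<pi>' (adj X) o\<^sub>L U)"
    using int[OF aX] by simp
  then show ?thesis
    by (simp add: adj_compose Uc t.d.rho_cblin t'.d.rho_cblin aX adj_adj Xc
        t.d.rho_adj[OF aX, symmetric] t'.d.rho_adj[OF aX, symmetric])
qed

text \<open>The assignment d \<mapsto> d' of \<open>intertwiner_vacuum\<close> is isometric since
  the vacuum is a unit vector, and onto because the adjoint of U provides preimages.\<close>

lemma intertwiner_hilbert_dim:
  fixes T :: "'n::finite \<Rightarrow> 'h::chilbert_space \<Rightarrow>\<^sub>L 'h" and T' :: "'n \<Rightarrow> 'g::chilbert_space \<Rightarrow>\<^sub>L 'g"
  assumes t: "fock_dilation J T \<pi> \<iota>" and t': "fock_dilation J T' \<pi>' \<iota>'"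
    and sep: "separable_space (euclidean :: 'h topology)" "separable_space (euclidean :: 'g topology)"
    and U: "unitary (dil_space J T) (dil_space J T') U"
    and int: "\<And>X. X \<in> model_cstar J \<Longrightarrow> U o\<^sub>L dil_rep J T \<pi> X = dil_rep J T' \<pi>' X o\<^sub>L U"
  shows "(hilbert_dim (defect_space T), hilbert_dim (defect_space T')) \<in> ordIso"
proof -
  interpret t: fock_dilation J T \<pi> \<iota> by fact
  interpret t': fock_dilation J T' \<pi>' \<iota>' by fact
  let ?e = "fock_basis [] :: 'n fock"
  have Uc: "U \<in> cblin" by (rule unitary_cblin[OF t.dil_space_closed t'.dil_space_closed U])
  \<comment> \<open>Reading d' off as the vacuum coefficient gives a bounded linear map on the whole
    space, with no choice involved.\<close>
  define \<Phi> where "\<Phi> d = ell2_apply (fst (U (?e \<otimes>\<^sub>2 d, 0))) []" for d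
  have coef: "ell2_apply (?e \<otimes>\<^sub>2 d) [] = d" for d :: 'g
    by (simp add: ell2_tensor_apply fock_basis.rep_eq)
  have U\<Phi>: "\<Phi> d \<in> defect_space T' \<and> U (?e \<otimes>\<^sub>2 d, 0) = (?e \<otimes>\<^sub>2 \<Phi> d, 0)" if d: "d \<in> defect_space T" for d
    using intertwiner_vacuum[OF t t' U int d] unfolding \<Phi>_def
    by (auto simp: ell2_tensor_apply fock_basis.rep_eq)
  have ee: "cinner ?e ?e = 1" by (simp add: cinner_fock_basis fock_basis.rep_eq)
  show ?thesis
  proof (rule hilbert_dim_ordIso[OF t.D_closed t'.D_closed sep])
    show "bounded_linear \<Phi>"
      unfolding \<Phi>_def
      by (intro bounded_linear_compose[OF bounded_linear_ell2_apply]
          bounded_linear_compose[OF bounded_linear_fst]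
          bounded_linear_compose[OF blinfun.bounded_linear_right] bounded_linear_Pair
          bounded_linear_ell2_tensor_right bounded_linear_zero)
    show "\<Phi> (c *\<^sub>C d) = c *\<^sub>C \<Phi> d" for c d
      using cblin_scaleC[OF Uc, of c "(?e \<otimes>\<^sub>2 d, 0)"]
      by (simp add: \<Phi>_def scaleC_prod_def ell2_tensor_scaleC_right scaleC_ell2.rep_eq)
    show "cinner (\<Phi> x) (\<Phi> y) = cinner x y" if x: "x \<in> defect_space T" and y: "y \<in> defect_space T" for x y
    proof -
      have "cinner (\<Phi> x) (\<Phi> y) = cinner (U (?e \<otimes>\<^sub>2 x, 0)) (U (?e \<otimes>\<^sub>2 y, 0))"
        by (simp add: U\<Phi> x y cinner_prod_def cinner_ell2_tensor ee)
      also have "\<dots> = cinner (?e \<otimes>\<^sub>2 x, 0) (adj U (U (?e \<otimes>\<^sub>2 y, 0)))"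
        by (rule cinner_adj_right[OF Uc, symmetric])
      also have "adj U (U (?e \<otimes>\<^sub>2 y, 0)) = (?e \<otimes>\<^sub>2 y, 0)"
        by (subst unitary_adj_apply[OF t.dil_space_closed t'.dil_space_closed U])
          (rule t.d.K.orth_proj_id[OF t.vacuum_tensor_in[OF y]])
      finally show ?thesis by (simp add: cinner_prod_def cinner_ell2_tensor ee)
    qed
    show "\<Phi> ` defect_space T = defect_space T'"
    proof
      show "\<Phi> ` defect_space T \<subseteq> defect_space T'" using U\<Phi> by blast
      show "defect_space T' \<subseteq> \<Phi> ` defect_space T"
      proof
        fix d' assume d': "d' \<in> defect_space T'"
        have U': "unitary (dil_space J T') (dil_space J T) (adj U)"
          by (rule unitary_adj[OF t.dil_space_closed t'.dil_space_closed U])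
        obtain d where d: "d \<in> defect_space T" "adj U (?e \<otimes>\<^sub>2 d', 0) = (?e \<otimes>\<^sub>2 d, 0)"
          using intertwiner_vacuum[OF t' t U' intertwiner_adj[OF t t' U int] d'] by blast
        have "U (?e \<otimes>\<^sub>2 d, 0) = (?e \<otimes>\<^sub>2 d', 0)"
          unfolding d(2)[symmetric]
          by (subst unitary_apply_adj[OF t.dil_space_closed t'.dil_space_closed U])
            (rule t'.d.K.orth_proj_id[OF t'.vacuum_tensor_in[OF d']])
        then have "\<Phi> d = d'" by (simp add: \<Phi>_def coef)
        then show "d' \<in> \<Phi> ` defect_space T" using d(1) by blast
      qed
    qed
  qed
qed

text \<open>Transported along W, the dilation of T' becomes one of T, and uniqueness supplies U.
  Block diagonality uses \<open>intertwiner_coupled\<close> for U and for its adjoint; the range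
  identity comes from U \<iota> = \<iota>' W with W onto.\<close>

lemma unitarily_equivalent_imp:
  fixes T :: "'n::finite \<Rightarrow> 'h::chilbert_space \<Rightarrow>\<^sub>L 'h" and T' :: "'n \<Rightarrow> 'g::chilbert_space \<Rightarrow>\<^sub>L 'g"
  assumes t: "fock_dilation J T \<pi> \<iota>" and t': "fock_dilation J T' \<pi>' \<iota>'"
    and sep: "separable_space (euclidean :: 'h topology)" "separable_space (euclidean :: 'g topology)"
    and eq: "unitarily_equivalent T T'"
  shows "(hilbert_dim (defect_space T), hilbert_dim (defect_space T')) \<in> ordIso \<and>
    (\<exists>\<Lambda> \<Gamma>. unitary (coupled_space J T) (coupled_space J T') \<Lambda> \<and> unitary UNIV UNIV \<Gamma> \<and>
      (\<forall>i. \<Lambda> o\<^sub>L coupled_op J T i = coupled_op J T' i o\<^sub>L \<Lambda>) \<and>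
      (\<forall>i. \<Gamma> o\<^sub>L \<pi> (model_op J i) = \<pi>' (model_op J i) o\<^sub>L \<Gamma>) \<and>
      op_dsum \<Lambda> \<Gamma> ` range \<iota> = range \<iota>')"
proof -
  interpret t: fock_dilation J T \<pi> \<iota> by fact
  interpret t': fock_dilation J T' \<pi>' \<iota>' by fact
  obtain W where W: "unitary UNIV UNIV W" "\<And>i. T i = adj W o\<^sub>L T' i o\<^sub>L W"
    using eq by (auto simp: unitarily_equivalent_def)
  have "cyclic_dilation (model_cstar J) (orth_proj (model_space J)) (model_op J) (dil_rep J T' \<pi>')
      (dil_space J T') (\<iota>' o\<^sub>L W) T"
    by (rule cyclic_dilation_transport[OF t'.d.cyclic_dilation_axioms W(1) t.d.T_cblin W(2)])
  from cyclic_dilation_unique[OF t.d.cyclic_dilation_axioms this]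
  obtain U where U: "unitary (dil_space J T) (dil_space J T') U"
    and int: "\<And>X. X \<in> model_cstar J \<Longrightarrow> U o\<^sub>L dil_rep J T \<pi> X = dil_rep J T' \<pi>' X o\<^sub>L U"
    and U\<iota>: "U o\<^sub>L \<iota> = \<iota>' o\<^sub>L W" by blast
  have U': "unitary (dil_space J T') (dil_space J T) (adj U)"
    by (rule unitary_adj[OF t.dil_space_closed t'.dil_space_closed U])
  obtain \<Lambda> \<Gamma> where UL: "U = op_dsum \<Lambda> \<Gamma>" and \<Lambda>: "unitary (coupled_space J T) (coupled_space J T') \<Lambda>"
    and \<Gamma>: "unitary UNIV UNIV \<Gamma>"
    using unitary_block_diagonal[OF t.coupled_closed t'.coupled_closed U[unfolded dil_space_def]
        intertwiner_coupled[OF t t' U int] intertwiner_coupled[OF t' t U' intertwiner_adj[OF t t' U int]]]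
    by blast
  have "\<Lambda> o\<^sub>L coupled_op J T i = coupled_op J T' i o\<^sub>L \<Lambda> \<and>
      \<Gamma> o\<^sub>L \<pi> (model_op J i) = \<pi>' (model_op J i) o\<^sub>L \<Gamma>" for i
    using int[OF t.cstar_B, of i]
    by (simp add: UL dil_rep_def op_dsum_compose op_dsum_eq_iff coupled_op_def)
  moreover have "op_dsum \<Lambda> \<Gamma> ` range \<iota> = range \<iota>'"
  proof -
    have "U (\<iota> h) = \<iota>' (W h)" for h using U\<iota> by (metis blinfun_apply_blinfun_compose)
    then have "U ` range \<iota> = \<iota>' ` range W" by (simp add: image_image)
    moreover have "W (adj W g) = g" for g using unitary_apply_adj[OF _ _ W(1), of g] by simp
    then have "range W = UNIV" by (metis surjI)
    ultimately show ?thesis by (simp add: UL)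
  qed
  ultimately show ?thesis
    using \<Lambda> \<Gamma> intertwiner_hilbert_dim[OF t t' sep U int] by blast
qed

text \<open>As \<Lambda> \<oplus> \<Gamma> maps the range of \<iota> onto that of \<iota>', its
  compression through the two embeddings is a unitary from the space of T to that of T'.\<close>

lemma unitarily_equivalentI:
  fixes T :: "'n::finite \<Rightarrow> 'h::chilbert_space \<Rightarrow>\<^sub>L 'h" and T' :: "'n \<Rightarrow> 'g::chilbert_space \<Rightarrow>\<^sub>L 'g"
  assumes t: "fock_dilation J T \<pi> \<iota>" and t': "fock_dilation J T' \<pi>' \<iota>'"
    and \<Lambda>: "unitary (coupled_space J T) (coupled_space J T') \<Lambda>" and \<Gamma>: "unitary UNIV UNIV \<Gamma>"
    and int: "\<And>i. \<Lambda> o\<^sub>L coupled_op J T i = coupled_op J T' i o\<^sub>L \<Lambda>"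
      "\<And>i. \<Gamma> o\<^sub>L \<pi> (model_op J i) = \<pi>' (model_op J i) o\<^sub>L \<Gamma>"
    and range: "op_dsum \<Lambda> \<Gamma> ` range \<iota> = range \<iota>'"
  shows "unitarily_equivalent T T'"
proof -
  interpret t: fock_dilation J T \<pi> \<iota> by fact
  interpret t': fock_dilation J T' \<pi>' \<iota>' by fact
  define W where "W = op_dsum \<Lambda> \<Gamma>"
  have c: "\<Lambda> \<in> cblin" "\<Gamma> \<in> cblin"
    using unitary_cblin[OF t.coupled_closed t'.coupled_closed \<Lambda>]
      unitary_cblin[OF closed_csubspace_UNIV closed_csubspace_UNIV \<Gamma>] by auto
  have W: "unitary (dil_space J T) (dil_space J T') W"
    unfolding W_def dil_space_def using c \<Lambda> \<Gamma> t.coupled_closed t'.coupled_closed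
    by (subst unitary_op_dsum_iff) simp_all
  have Wc: "W \<in> cblin" using c by (simp add: W_def op_dsum_cblin)
  note tc = t.dil_space_closed t'.dil_space_closed
  have WW: "adj W (W (\<iota> h)) = \<iota> h" for h
    by (simp add: unitary_adj_apply[OF tc W] t.d.K.orth_proj_id t.d.iota_in)
  have isoJ: "adj \<iota> (\<iota> h) = h" for h
    using t.d.iota_isometry by (metis blinfun_apply_blinfun_compose blinfun_apply_id_blinfun id_apply)
  have isoJ': "adj \<iota>' (\<iota>' h) = h" for h
    using t'.d.iota_isometry by (metis blinfun_apply_blinfun_compose blinfun_apply_id_blinfun id_apply)
  define U where "U = adj \<iota>' o\<^sub>L W o\<^sub>L \<iota>"
  have "W (\<iota> h) \<in> range \<iota>'" for h unfolding range[symmetric] W_def by blast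
  then have WU: "W (\<iota> h) = \<iota>' (U h)" for h
  proof -
    obtain g where "W (\<iota> h) = \<iota>' g" using \<open>\<And>h. W (\<iota> h) \<in> range \<iota>'\<close> by blast
    then show ?thesis by (simp add: U_def isoJ')
  qed
  have Uc: "U \<in> cblin" by (simp add: U_def Wc t.d.iota_cblin t'.d.iota_cblin adj_cblin)
  have adjU: "adj U g = adj \<iota> (adj W (\<iota>' g))" for g
    by (simp add: U_def adj_compose adj_cblin adj_adj Wc t.d.iota_cblin t'.d.iota_cblin)
  have UU: "adj U (U h) = h" for h by (simp add: adjU WU[symmetric] WW isoJ)
  have U'U: "U (adj U g) = g" for g
  proof -
    have "\<iota>' g \<in> op_dsum \<Lambda> \<Gamma> ` range \<iota>" unfolding range by blast
    then obtain h where "\<iota>' g = W (\<iota> h)" unfolding W_def by blast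
    then have "g = U h" using WU isoJ' by metis
    then show ?thesis using UU by simp
  qed
  have "unitary UNIV UNIV U"
  proof (rule unitaryI[where U' = "adj U"])
    show "U \<in> bop UNIV UNIV" "adj U \<in> bop UNIV UNIV" using Uc adj_cblin[OF Uc]
      by (auto simp: bop_def intro: blinfun_eqI)
    show "cinner (U x) (U y) = cinner x y" for x y by (simp add: cinner_adj_right[OF Uc, symmetric] UU)
  qed (simp_all add: UU U'U)
  moreover have "T i = adj U o\<^sub>L T' i o\<^sub>L U" for i
  proof -
    have VW: "W o\<^sub>L dil_rep J T \<pi> (model_op J i) = dil_rep J T' \<pi>' (model_op J i) o\<^sub>L W"
      using int[of i] by (simp add: W_def dil_rep_def op_dsum_compose coupled_op_def)
    \<comment> \<open>The embeddings intertwine adjoints, so T i is moved to the left entry,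
      exchanged there for the adjoint of V, and moved back.\<close>
    have "cinner x (T i y) = cinner x (adj U (T' i (U y)))" for x y
    proof -
      define V V' where "V = dil_rep J T \<pi> (model_op J i)" and "V' = dil_rep J T' \<pi>' (model_op J i)"
      have Vc: "V \<in> cblin" "V' \<in> cblin"
        by (simp_all add: V_def V'_def t.d.rho_cblin t'.d.rho_cblin t.cstar_B)
      have "cinner x (T i y) = cinner (\<iota> (adj (T i) x)) (\<iota> y)"
        by (simp add: t.d.cinner_iota cinner_adj_left t.d.T_cblin)
      also have "\<dots> = cinner (\<iota> x) (V (\<iota> y))"
        by (simp add: t.d.dilation_apply[symmetric] V_def[symmetric] cinner_adj_left Vc)
      also have "\<dots> = cinner (W (\<iota> x)) (W (V (\<iota> y)))"
        using cinner_adj_left[OF Wc, of "W (\<iota> x)" "V (\<iota> y)"] by (simp add: WW)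
      also have "W (V (\<iota> y)) = V' (W (\<iota> y))"
        using arg_cong[OF VW, of "\<lambda>A. blinfun_apply A (\<iota> y)"] by (simp add: V_def V'_def)
      also have "cinner (W (\<iota> x)) (V' (W (\<iota> y))) = cinner (\<iota>' (adj (T' i) (U x))) (\<iota>' (U y))"
        by (simp add: WU t'.d.dilation_apply[symmetric] V'_def[symmetric] cinner_adj_left Vc)
      also have "\<dots> = cinner x (adj U (T' i (U y)))"
        by (simp add: t'.d.cinner_iota cinner_adj_left t'.d.T_cblin cinner_adj_right Uc)
      finally show ?thesis .
    qed
    then have "T i y = (adj U o\<^sub>L T' i o\<^sub>L U) y" for y
      by (simp add: cinner_eqI[of "T i y" "adj U (T' i (U y))"])
    then show ?thesis by (rule blinfun_eqI)
  qed
  ultimately show ?thesis unfolding unitarily_equivalent_def by blast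
qed

text \<open>Two dilations of the same T share the first summand, so both act on
  \<open>dil_space J T\<close>, possibly with different types for the second summand. Dimensions are
  cardinals over different types and are compared by \<open>ordIso\<close>.\<close>

theorem corollary2p6:
  fixes P :: "'n::finite ncpoly set"
    and J :: "('n fock \<Rightarrow>\<^sub>L 'n fock) set"
    and T :: "'n \<Rightarrow> 'h::chilbert_space \<Rightarrow>\<^sub>L 'h"
    and \<pi> :: "('n fock \<Rightarrow>\<^sub>L 'n fock) \<Rightarrow> 'k::chilbert_space \<Rightarrow>\<^sub>L 'k"
    and \<iota> :: "'h \<Rightarrow>\<^sub>L (('n list, 'h) ell2 \<times> 'k)"
  assumes "\<forall>p\<in>P. homogeneous p"
    and "wot_ideal J"
    and "J = wot_ideal_generated P"
    and "J \<noteq> F_inf"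
    and "separable_space (euclidean :: 'h topology)"
    and "row_contraction T"
    and "\<forall>p\<in>P. poly_eval T p = 0"
    and "closure (cspan {model_word J \<alpha> o\<^sub>L adj (model_word J \<beta>) |\<alpha> \<beta>. True}) = model_cstar J"
    and "constrained_dilation J T \<pi> \<iota>"
  shows "minimal_dilation J T \<pi> \<iota> \<and>
    (\<forall>(\<pi>\<^sub>2 :: ('n fock \<Rightarrow>\<^sub>L 'n fock) \<Rightarrow> 'k2::chilbert_space \<Rightarrow>\<^sub>L 'k2) \<iota>\<^sub>2.
       constrained_dilation J T \<pi>\<^sub>2 \<iota>\<^sub>2 \<longrightarrow>
       (\<exists>U. unitary (dil_space J T) (dil_space J T) U \<and>
          (\<forall>i. U o\<^sub>L dil_op J T \<pi> i = dil_op J T \<pi>\<^sub>2 i o\<^sub>L U) \<and> U o\<^sub>L \<iota> = \<iota>\<^sub>2)) \<and>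
    (\<forall>(T' :: 'n \<Rightarrow> 'h'::chilbert_space \<Rightarrow>\<^sub>L 'h')
       (\<pi>' :: ('n fock \<Rightarrow>\<^sub>L 'n fock) \<Rightarrow> 'k'::chilbert_space \<Rightarrow>\<^sub>L 'k') \<iota>'.
       separable_space (euclidean :: 'h' topology) \<and> row_contraction T' \<and>
       (\<forall>p\<in>P. poly_eval T' p = 0) \<and> constrained_dilation J T' \<pi>' \<iota>' \<longrightarrow>
       (unitarily_equivalent T T' \<longleftrightarrow>
          (hilbert_dim (defect_space T), hilbert_dim (defect_space T')) \<in> ordIso \<and>
          (\<exists>\<Lambda> \<Gamma>. unitary (coupled_space J T) (coupled_space J T') \<Lambda> \<and> unitary UNIV UNIV \<Gamma> \<and>
             (\<forall>i. \<Lambda> o\<^sub>L coupled_op J T i = coupled_op J T' i o\<^sub>L \<Lambda>) \<and>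
             (\<forall>i. \<Gamma> o\<^sub>L \<pi> (model_op J i) = \<pi>' (model_op J i) o\<^sub>L \<Gamma>) \<and>
             op_dsum \<Lambda> \<Gamma> ` range \<iota> = range \<iota>')))"
proof -
  have ideal: "fock_ideal J"
    by standard (fact assms(2), rule homogeneous_ideal_vacuum[OF assms(1-4)])
  have dil: "fock_dilation J S \<sigma> \<kappa>" if "row_contraction S" "constrained_dilation J S \<sigma> \<kappa>"
    for S :: "'n \<Rightarrow> 'g::chilbert_space \<Rightarrow>\<^sub>L 'g" and \<sigma> :: "('n fock \<Rightarrow>\<^sub>L 'n fock) \<Rightarrow> 'l::chilbert_space \<Rightarrow>\<^sub>L 'l" and \<kappa>
    by (intro fock_dilation.intro fock_dilation_axioms.intro ideal assms(8) that)
  have t: "fock_dilation J T \<pi> \<iota>" by (rule dil[OF assms(6,9)])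
  show ?thesis
  proof (intro conjI allI impI)
    show "minimal_dilation J T \<pi> \<iota>" by (rule fock_dilation.minimal[OF t])
  next
    fix \<pi>\<^sub>2 :: "('n fock \<Rightarrow>\<^sub>L 'n fock) \<Rightarrow> 'k2 \<Rightarrow>\<^sub>L 'k2" and \<iota>\<^sub>2
    assume "constrained_dilation J T \<pi>\<^sub>2 \<iota>\<^sub>2"
    then have t2: "fock_dilation J T \<pi>\<^sub>2 \<iota>\<^sub>2" by (rule dil[OF assms(6)])
    interpret t: fock_dilation J T \<pi> \<iota> by (rule t)
    interpret t2: fock_dilation J T \<pi>\<^sub>2 \<iota>\<^sub>2 by (rule t2)
    show "\<exists>U. unitary (dil_space J T) (dil_space J T) U \<and>
        (\<forall>i. U o\<^sub>L dil_op J T \<pi> i = dil_op J T \<pi>\<^sub>2 i o\<^sub>L U) \<and> U o\<^sub>L \<iota> = \<iota>\<^sub>2"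
      using cyclic_dilation_unique[OF t.d.cyclic_dilation_axioms t2.d.cyclic_dilation_axioms] t.cstar_B
      unfolding dil_op_eq by blast
  next
    fix T' :: "'n \<Rightarrow> 'h' \<Rightarrow>\<^sub>L 'h'" and \<pi>' :: "('n fock \<Rightarrow>\<^sub>L 'n fock) \<Rightarrow> 'k' \<Rightarrow>\<^sub>L 'k'" and \<iota>'
    assume a: "separable_space (euclidean :: 'h' topology) \<and> row_contraction T' \<and>
       (\<forall>p\<in>P. poly_eval T' p = 0) \<and> constrained_dilation J T' \<pi>' \<iota>'"
    then have t': "fock_dilation J T' \<pi>' \<iota>'" by (intro dil) auto
    show "unitarily_equivalent T T' \<longleftrightarrow>
          (hilbert_dim (defect_space T), hilbert_dim (defect_space T')) \<in> ordIso \<and>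
          (\<exists>\<Lambda> \<Gamma>. unitary (coupled_space J T) (coupled_space J T') \<Lambda> \<and> unitary UNIV UNIV \<Gamma> \<and>
             (\<forall>i. \<Lambda> o\<^sub>L coupled_op J T i = coupled_op J T' i o\<^sub>L \<Lambda>) \<and>
             (\<forall>i. \<Gamma> o\<^sub>L \<pi> (model_op J i) = \<pi>' (model_op J i) o\<^sub>L \<Gamma>) \<and>
             op_dsum \<Lambda> \<Gamma> ` range \<iota> = range \<iota>')"
      (is "_ \<longleftrightarrow> ?dim \<and> ?unitaries")
    proof
      assume "unitarily_equivalent T T'"
      then show "?dim \<and> ?unitaries"
        by (rule unitarily_equivalent_imp[OF t t' assms(5) conjunct1[OF a]])
    next
      assume "?dim \<and> ?unitaries"
      then show "unitarily_equivalent T T'"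
        by (elim conjE exE)
          (rule unitarily_equivalentI[OF t t'], assumption, assumption, erule spec, erule spec, assumption)
    qed
  qed
qed

end
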